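(* There is a universal constant $C>0$ such that the following holds. Let $A$ be the adjacency matrix of an inhomogeneous (undirected) Erdős–Rényi graph on $n$ vertices with edge probabilities $p_{ij}$, and set $$d=\max_i\sum_j p_{ij},\qquad \kappa=\frac{\max_{i,j}p_{ij}}{d/n},\qquad q=\min\{\sqrt d,\ n^{1/10}\kappa^{-1/9}\}.$$ If $q\ge 1$, then $$\frac{\mathbb{E}\|A-\mathbb{E}A\|}{\sqrt d}\le 2+C\,\frac{\eta}{\sqrt{\max\{1,\log\eta\}}},\qquad\text{where }\eta=\frac{\sqrt{\log n}}{q}.$$ If $$d\ge 1\qquad\text{and}\qquad d^{7/2}\max_{i,j}p_{ij}\le n^{-1/10},$$ then $$\mathbb{E}\|A-\mathbb{E}A\|\le 2\sqrt d+C\sqrt{\frac{\log n}{\max\{1,\log(\frac{\log n}{d})\}}}.$$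
   Context: Inhomogeneous undirected Erdős–Rényi graph: on vertex set $\{1,\dots,n\}$, each edge $\{i,j\}$ with $1\le i<j\le n$ is included with probability $p_{ij}\in[0,1]$, independently of the others. Conventions: $p_{ji}=p_{ij}$ and $p_{ii}=0$; $A$ is the symmetric $0/1$ adjacency matrix, with zero diagonal; $d>0$, so that $\kappa$ is well defined. $\|\cdot\|$ is the $\ell^2\to\ell^2$ operator norm. *)

theory Defs
  imports
    "HOL-Probability.Product_PMF"
    "HOL-Analysis.L2_Norm"
    "Jordan_Normal_Form.Matrix"
begin

definition vec_norm2 :: "real Matrix.vec \<Rightarrow> real" where
  "vec_norm2 v = L2_set (vec_index v) {..<dim_vec v}"

definition op_norm :: "real mat \<Rightarrow> real" where
  "op_norm M =
     Sup {vec_norm2 (mult_mat_vec M v) | v. v \<in> carrier_vec (dim_col M) \<and> vec_norm2 v \<le> 1}"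

text \<open>Vertices are numbered from 0, matching the matrix indices; an undirected graph is
  represented by its set of edges \<open>{i, j}\<close>.\<close>

definition edge_probs :: "nat \<Rightarrow> (nat \<Rightarrow> nat \<Rightarrow> real) \<Rightarrow> bool" where
  "edge_probs n p \<longleftrightarrow>
     (\<forall>i<n. \<forall>j<n. 0 \<le> p i j \<and> p i j \<le> 1 \<and> p j i = p i j) \<and> (\<forall>i<n. p i i = 0)"

definition erdos_renyi :: "nat \<Rightarrow> (nat \<Rightarrow> nat \<Rightarrow> real) \<Rightarrow> nat set set pmf" where
  "erdos_renyi n p =
     map_pmf (\<lambda>\<omega>. {{i, j} | i j. i < j \<and> j < n \<and> \<omega> (i, j)})
       (Pi_pmf {(i, j). i < j \<and> j < n} False (\<lambda>(i, j). bernoulli_pmf (p i j)))"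

text \<open>The diagonal below is zero for loopless graphs: \<open>{i, i}\<close> is a singleton, never an edge.\<close>

definition adj_matrix :: "nat \<Rightarrow> nat set set \<Rightarrow> real mat" where
  "adj_matrix n E = mat n n (\<lambda>(i, j). of_bool ({i, j} \<in> E))"

definition mean_adj_matrix :: "nat \<Rightarrow> (nat \<Rightarrow> nat \<Rightarrow> real) \<Rightarrow> real mat" where
  "mean_adj_matrix n p =
     mat n n (\<lambda>ij. measure_pmf.expectation (erdos_renyi n p) (\<lambda>E. index_mat (adj_matrix n E) ij))"

definition expected_deviation :: "nat \<Rightarrow> (nat \<Rightarrow> nat \<Rightarrow> real) \<Rightarrow> real" where
  "expected_deviation n p =
     measure_pmf.expectation (erdos_renyi n p)
       (\<lambda>E. op_norm (adj_matrix n E - mean_adj_matrix n p))"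

text \<open>The following maxima are unspecified for \<open>n = 0\<close>; they are only meant for \<open>n \<ge> 1\<close>.\<close>

definition max_degree :: "nat \<Rightarrow> (nat \<Rightarrow> nat \<Rightarrow> real) \<Rightarrow> real" where
  "max_degree n p = Max ((\<lambda>i. \<Sum>j<n. p i j) ` {..<n})"

definition max_prob :: "nat \<Rightarrow> (nat \<Rightarrow> nat \<Rightarrow> real) \<Rightarrow> real" where
  "max_prob n p = Max ((\<lambda>(i, j). p i j) ` ({..<n} \<times> {..<n}))"

end

theory Submission
  imports Defs "HOL-Analysis.Analysis"
begin

text \<open>
  Let \<open>X\<close> be the centred adjacency matrix and \<open>d\<close> the maximal expected degree. The constant two comes
  from a deterministic inequality of Ihara-Bass type: if \<open>b \<ge> 1\<close> bounds all row norms of a symmetric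
  matrix with zero diagonal and entries in \<open>[-1, 1]\<close>, and \<open>b ^ (2 * l)\<close> exceeds the squared Frobenius norm of
  the \<open>l\<close>-th power of its nonbacktracking operator, then the norm of the matrix is at most
  \<open>2 * b + 3\<close> (\<open>abs_quadratic_form_le\<close>). It remains to see that the row norms and the
  root of order \<open>2 * l\<close> of the squared Frobenius norm are close to \<open>sqrt d\<close>.

  The row norms are controlled by their exponential moments, summed over the rows
  (\<open>expectation_exp_row_le\<close>). Their fluctuations produce the logarithmic error terms, with the
  normal tail when \<open>d\<close> is above \<open>ln n\<close> and with the Poisson tail below.

  The Frobenius norm is a sum over pairs of nonbacktracking walks. Its expectation is of order
  \<open>d ^ l\<close> up to powers of \<open>n\<close> (\<open>expectation_path_energy_le\<close>), since in a typical pair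
  the first walk explores a path of new vertices, each step with total weight \<open>d\<close>, and the
  second walk repeats it. No Catalan numbers appear: a nonbacktracking walk can turn back into
  the known graph only by an edge that closes a cycle, and the number of such edges times their largest
  probability is small. This count is made by a potential function on the states of a
  walk, not by an enumeration of shapes. The potential satisfies a local inequality
  (\<open>potential_step\<close>) which is summed along the walk.

  The two parts combine in \<open>expected_deviation_le\<close>. One choice of its parameters gives the sharp constant
  (\<open>sharp_bound\<close>). Another gives the bound up to a constant (\<open>crude_bound\<close>), which is enough when
  the degree, or the effective degree \<open>q\<^sup>2\<close>, is below \<open>ln n\<close>.
\<close>

section \<open>Walks and visit counts\<close>

text \<open>The pair is increasing, as in the index set of the independent edge indicators.\<close>

definition edge :: "nat \<Rightarrow> nat \<Rightarrow> nat \<times> nat" where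
  "edge x y = (min x y, max x y)"

lemma edge_commute: "edge x y = edge y x"
  by (simp add: edge_def min.commute max.commute)

lemma edge_eq_iff: "edge x y = edge u v \<longleftrightarrow> (x = u \<and> y = v) \<or> (x = v \<and> y = u)"
  by (auto simp: edge_def min_def max_def)

definition edges :: "nat \<Rightarrow> (nat \<times> nat) set" where
  "edges n = {(i, j). i < j \<and> j < n}"

lemma finite_edges [simp]: "finite (edges n)"
  by (rule finite_subset[of _ "{..<n} \<times> {..<n}"]) (auto simp: edges_def)

lemma edge_in_edges: "x < n \<Longrightarrow> y < n \<Longrightarrow> x \<noteq> y \<Longrightarrow> edge x y \<in> edges n"
  by (auto simp: edge_def edges_def min_def max_def)

definition traverse :: "(nat \<times> nat \<Rightarrow> nat) \<Rightarrow> nat \<Rightarrow> nat \<Rightarrow> (nat \<times> nat \<Rightarrow> nat)" where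
  "traverse c x y = c(edge x y := Suc (c (edge x y)))"

text \<open>The sum of \<open>f\<close> over all walks with \<open>t\<close> further steps. The vertices \<open>a\<close> and \<open>x\<close> are the
  previous and the current one, and \<open>c\<close> counts the visits to each edge; \<open>f\<close> sees these three
  data at the end of the walk. A step does not return to \<open>a\<close>, since the walks are nonbacktracking,
  and does not stay at \<open>x\<close>, since the matrix has zero diagonal.\<close>

primrec walk_sum :: "nat \<Rightarrow> nat \<Rightarrow> nat \<Rightarrow> nat \<Rightarrow> (nat \<times> nat \<Rightarrow> nat) \<Rightarrow>
    (nat \<Rightarrow> nat \<Rightarrow> (nat \<times> nat \<Rightarrow> nat) \<Rightarrow> real) \<Rightarrow> real" where
  "walk_sum n 0 a x c f = f a x c"
| "walk_sum n (Suc t) a x c f = (\<Sum>y\<in>{..<n} - {a, x}. walk_sum n t x y (traverse c x y) f)"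

definition steps :: "nat \<Rightarrow> (nat \<times> nat \<Rightarrow> nat) \<Rightarrow> nat" where
  "steps n c = (\<Sum>e\<in>edges n. c e)"

lemma steps_traverse:
  assumes "x < n" "y < n" "x \<noteq> y"
  shows "steps n (traverse c x y) = Suc (steps n c)"
proof -
  have e: "edge x y \<in> edges n" using assms by (rule edge_in_edges)
  have "(\<Sum>e\<in>edges n - {edge x y}. traverse c x y e) = (\<Sum>e\<in>edges n - {edge x y}. c e)"
    by (rule sum.cong) (simp_all add: traverse_def)
  then show ?thesis
    unfolding steps_def sum.remove[OF finite_edges e] by (simp add: traverse_def)
qed

definition nbrs :: "nat \<Rightarrow> (nat \<times> nat \<Rightarrow> nat) \<Rightarrow> nat \<Rightarrow> nat set" where
  "nbrs n c x = {y \<in> {..<n} - {x}. c (edge x y) > 0}"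

text \<open>An edge is open while it has been visited exactly once. A centred independent entry has mean zero,
  so a walk contributes to a moment only if no edge is left open at the end.\<close>

definition open_nbrs :: "nat \<Rightarrow> (nat \<times> nat \<Rightarrow> nat) \<Rightarrow> nat \<Rightarrow> nat set" where
  "open_nbrs n c x = {y \<in> nbrs n c x. c (edge x y) = 1}"

lemma finite_nbrs [simp]: "finite (nbrs n c x)" "finite (open_nbrs n c x)"
  by (auto simp: nbrs_def open_nbrs_def)

lemma card_visited_edges_le: "card {e \<in> edges n. c e > 0} \<le> steps n c"
proof -
  have "card {e \<in> edges n. c e > 0} = (\<Sum>e\<in>{e \<in> edges n. c e > 0}. 1)" by simp
  also have "\<dots> \<le> (\<Sum>e\<in>{e \<in> edges n. c e > 0}. c e)" by (intro sum_mono) auto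
  also have "\<dots> \<le> steps n c" unfolding steps_def by (intro sum_mono2) auto
  finally show ?thesis .
qed

lemma card_nbrs_le:
  assumes "x < n" shows "card (nbrs n c x) \<le> steps n c"
proof -
  have "card (nbrs n c x) \<le> card {e \<in> edges n. c e > 0}"
  proof (rule card_inj_on_le[of "edge x"])
    show "inj_on (edge x) (nbrs n c x)" by (simp add: inj_on_def edge_eq_iff)
    show "edge x ` nbrs n c x \<subseteq> {e \<in> edges n. c e > 0}"
      using assms by (auto simp: nbrs_def edge_in_edges)
  qed simp
  then show ?thesis using card_visited_edges_le[of n c] by linarith
qed

text \<open>Bounds the number of old vertices to which a walk can return along a new edge.\<close>

lemma card_nonisolated_le: "card {v. v < n \<and> nbrs n c v \<noteq> {}} \<le> 2 * steps n c"
proof -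
  let ?E = "{e \<in> edges n. c e > 0}"
  have "{v. v < n \<and> nbrs n c v \<noteq> {}} \<subseteq> fst ` ?E \<union> snd ` ?E"
  proof
    fix v assume "v \<in> {v. v < n \<and> nbrs n c v \<noteq> {}}"
    then obtain y where y: "v < n" "y < n" "y \<noteq> v" "c (edge v y) > 0" by (auto simp: nbrs_def)
    then have "edge v y \<in> ?E" by (auto intro: edge_in_edges)
    moreover have "v = fst (edge v y) \<or> v = snd (edge v y)" by (auto simp: edge_def)
    ultimately show "v \<in> fst ` ?E \<union> snd ` ?E" by (auto intro: rev_image_eqI)
  qed
  then have "card {v. v < n \<and> nbrs n c v \<noteq> {}} \<le> card (fst ` ?E \<union> snd ` ?E)"
    by (intro card_mono) auto
  also have "\<dots> \<le> card ?E + card ?E"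
    using card_Un_le[of "fst ` ?E" "snd ` ?E"] card_image_le[of ?E fst] card_image_le[of ?E snd]
    by simp
  finally show ?thesis using card_visited_edges_le[of n c] by linarith
qed

text \<open>The surplus measures how far the visited graph is from a union of paths and cycles, and it bounds
  all degrees. A nonbacktracking walk raises it only by leaving the known graph from the inside or by
  closing a cycle, which are rare events.\<close>

definition surplus :: "nat \<Rightarrow> (nat \<times> nat \<Rightarrow> nat) \<Rightarrow> nat" where
  "surplus n c = (\<Sum>v<n. card (nbrs n c v) - 2)"

text \<open>The open edges at branching vertices: these are the only places where a walk inside the known graph
  has a genuine choice among edges whose traversal is not penalised.\<close>

definition forks :: "nat \<Rightarrow> (nat \<times> nat \<Rightarrow> nat) \<Rightarrow> nat" where
  "forks n c = (\<Sum>v<n. if card (nbrs n c v) \<ge> 3 then card (open_nbrs n c v) else 0)"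

lemma nbrs_traverse:
  assumes "x < n" "y < n" "x \<noteq> y"
  shows "nbrs n (traverse c x y) v =
    (if v = x then insert y (nbrs n c x) else if v = y then insert x (nbrs n c y) else nbrs n c v)"
  using assms by (auto simp: nbrs_def traverse_def edge_eq_iff)

lemma nbrs_traverse_known:
  assumes "c (edge x y) > 0"
  shows "nbrs n (traverse c x y) v = nbrs n c v"
  using assms by (auto simp: nbrs_def traverse_def)

lemma open_nbrs_traverse_new:
  assumes "x < n" "y < n" "x \<noteq> y" "c (edge x y) = 0"
  shows "open_nbrs n (traverse c x y) v =
    (if v = x then insert y (open_nbrs n c x) else if v = y then insert x (open_nbrs n c y)
     else open_nbrs n c v)"
  using assms by (auto simp: open_nbrs_def nbrs_def traverse_def edge_eq_iff edge_commute)

lemma sum_split2: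
  fixes f :: "nat \<Rightarrow> nat"
  assumes "x < n" "y < n" "x \<noteq> y"
  shows "(\<Sum>v<n. f v) = f x + f y + (\<Sum>v\<in>{..<n} - {x, y}. f v)"
proof -
  have "(\<Sum>v<n. f v) = f x + (\<Sum>v\<in>{..<n} - {x}. f v)" using assms by (intro sum.remove) auto
  also have "(\<Sum>v\<in>{..<n} - {x}. f v) = f y + (\<Sum>v\<in>{..<n} - {x} - {y}. f v)"
    using assms by (intro sum.remove) auto
  also have "{..<n} - {x} - {y} = {..<n} - {x, y}" by auto
  finally show ?thesis by simp
qed

lemma nbrs_notin:
  assumes "c (edge x y) = 0" shows "y \<notin> nbrs n c x" "x \<notin> nbrs n c y" "y \<notin> open_nbrs n c x" "x \<notin> open_nbrs n c y"
  using assms by (auto simp: nbrs_def open_nbrs_def edge_commute)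

lemma card_open_nbrs_le: "card (open_nbrs n c v) \<le> card (nbrs n c v)"
  by (intro card_mono) (auto simp: open_nbrs_def)

text \<open>A new edge at a vertex of degree at most one makes no branching vertex there. At a vertex of degree
  two, which becomes a branching vertex, up to three open edges start to count.\<close>

lemma surplus_forks_new:
  assumes "x < n" "y < n" "x \<noteq> y" "c (edge x y) = 0"
  defines "k \<equiv> of_bool (card (nbrs n c x) \<ge> 2) + of_bool (card (nbrs n c y) \<ge> 2)"
  shows "surplus n (traverse c x y) \<le> surplus n c + k"
    and "forks n (traverse c x y) \<le> forks n c + 3 * k"
proof -
  note nt = nbrs_traverse[OF assms(1-3), of c] open_nbrs_traverse_new[where c = c, OF assms(1-4)]
  note ni = nbrs_notin[where c = c, OF assms(4), of n]
  have r1: "(\<Sum>v\<in>{..<n} - {x, y}. card (nbrs n (traverse c x y) v) - 2)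
     = (\<Sum>v\<in>{..<n} - {x, y}. card (nbrs n c v) - 2)"
    by (intro sum.cong) (auto simp: nt)
  show "surplus n (traverse c x y) \<le> surplus n c + k"
    unfolding surplus_def sum_split2[OF assms(1-3)] r1 k_def using ni assms(3) by (auto simp: nt)
  let ?f = "\<lambda>c v. if card (nbrs n c v) \<ge> 3 then card (open_nbrs n c v) else 0"
  have r2: "(\<Sum>v\<in>{..<n} - {x, y}. ?f (traverse c x y) v) = (\<Sum>v\<in>{..<n} - {x, y}. ?f c v)"
    by (intro sum.cong) (auto simp: nt)
  have "?f (traverse c x y) x \<le> ?f c x + 3 * of_bool (card (nbrs n c x) \<ge> 2)"
    using ni card_open_nbrs_le[of n c x] by (auto simp: nt)
  moreover have "?f (traverse c x y) y \<le> ?f c y + 3 * of_bool (card (nbrs n c y) \<ge> 2)"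
    using ni card_open_nbrs_le[of n c y] assms(3) by (auto simp: nt)
  ultimately show "forks n (traverse c x y) \<le> forks n c + 3 * k"
    unfolding forks_def sum_split2[OF assms(1-3)] r2 k_def distrib_left
    by (rule order_trans[OF add_right_mono[OF add_mono]]) simp
qed

lemma open_nbrs_traverse_known:
  assumes "c (edge x y) > 0"
  shows "open_nbrs n (traverse c x y) v \<subseteq> open_nbrs n c v"
  using assms by (auto simp: open_nbrs_def nbrs_def traverse_def split: if_splits)

lemma surplus_known: "c (edge x y) > 0 \<Longrightarrow> surplus n (traverse c x y) = surplus n c"
  by (simp add: surplus_def nbrs_traverse_known)

lemma forks_known: "c (edge x y) > 0 \<Longrightarrow> forks n (traverse c x y) \<le> forks n c"
  unfolding forks_def
  by (intro sum_mono) (auto simp: nbrs_traverse_known intro!: card_mono open_nbrs_traverse_known)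

text \<open>Choosing an open edge at a branching vertex uses up that choice, which pays for it in the potential
  below.\<close>

lemma forks_close:
  assumes "x < n" "y \<in> open_nbrs n c x" "card (nbrs n c x) \<ge> 3"
  shows "forks n (traverse c x y) < forks n c"
proof -
  have c: "c (edge x y) > 0" using assms(2) by (auto simp: open_nbrs_def nbrs_def)
  have "open_nbrs n (traverse c x y) x \<subset> open_nbrs n c x"
    using open_nbrs_traverse_known[where c = c, OF c, of n x] assms(2)
    by (auto simp: open_nbrs_def traverse_def)
  then have "card (open_nbrs n (traverse c x y) x) < card (open_nbrs n c x)"
    by (intro psubset_card_mono) auto
  then show ?thesis unfolding forks_def
    by (intro sum_strict_mono_ex1)
       (use assms c in \<open>auto simp: nbrs_traverse_known intro!: card_mono open_nbrs_traverse_known bexI[of _ x]\<close>)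
qed

lemma card_nbrs_le_surplus:
  assumes "x < n" shows "card (nbrs n c x) \<le> surplus n c + 2"
proof -
  have "card (nbrs n c x) - 2 \<le> surplus n c"
    unfolding surplus_def using assms by (intro member_le_sum) auto
  then show ?thesis by simp
qed

section \<open>A potential for nonbacktracking walks\<close>

text \<open>The parameter \<open>D\<close> bounds the expected degrees, and \<open>\<delta>\<close> is the largest probability relative to
  \<open>D\<close>: it is the price of a new edge that ends in an old vertex. The last assumption says that this
  price beats the number of ways, polynomial in \<open>l\<close>, in which a walk can use such an edge.\<close>

locale walk_weights =
  fixes n l :: nat and p :: "nat \<Rightarrow> nat \<Rightarrow> real" and D \<delta> :: real
  assumes p_nonneg: "\<And>x y. x < n \<Longrightarrow> y < n \<Longrightarrow> 0 \<le> p x y"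
    and p_sym: "\<And>x y. x < n \<Longrightarrow> y < n \<Longrightarrow> p x y = p y x"
    and row_le: "\<And>x. x < n \<Longrightarrow> (\<Sum>y<n. p x y) \<le> D"
    and p_le: "\<And>x y. x < n \<Longrightarrow> y < n \<Longrightarrow> p x y \<le> \<delta> * D"
    and D_ge: "D \<ge> 1" and l_ge: "l \<ge> 1" and delta_nonneg: "\<delta> \<ge> 0"
    and small: "4 ^ 7 * real l ^ 9 * exp (4 * real l / sqrt D) ^ 2 * \<delta> \<le> 1"
begin

definition prob_of :: "nat \<times> nat \<Rightarrow> real" where "prob_of e = p (fst e) (snd e)"

lemma prob_of_edge: "x < n \<Longrightarrow> y < n \<Longrightarrow> prob_of (edge x y) = p x y"
  by (auto simp: prob_of_def edge_def min_def max_def p_sym)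

text \<open>The weights are normalised such that a walk of \<open>2 * l\<close> steps that visits no edge exactly once has
  total weight \<open>D ^ (- l)\<close> times the product of the probabilities of its distinct edges. The first
  visit to a new vertex then has total weight at most one, the second visit to an edge has weight one,
  and each later visit is penalised.\<close>

definition step_weight :: "nat \<Rightarrow> nat \<times> nat \<Rightarrow> real" where
  "step_weight k e = (if k = 0 then prob_of e / D else if k = 1 then 1 else 1 / sqrt D)"

text \<open>The constant \<open>M\<close> pays for the choice of an open edge at a branching vertex, whose degree is at most
  \<open>2 * l\<close>; \<open>r\<close> bounds the change of \<open>\<Psi> ^ (2 * l)\<close> when the surplus grows by one; and \<open>R\<close> is the
  value of standing at a vertex from which the walk can continue along known edges. The factor
  \<open>R = l * M ^ 3 * r\<close> makes leaving such a vertex along a new edge cost \<open>1 / l\<close>, even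
  if the exit creates a branching vertex.\<close>

definition M :: real where "M = 4 * l"
definition r :: real where "r = exp (4 * real l / sqrt D)"
definition R :: real where "R = l * M ^ 3 * r"

definition live :: "(nat \<times> nat \<Rightarrow> nat) \<Rightarrow> nat \<Rightarrow> nat \<Rightarrow> bool" where
  "live c a x \<longleftrightarrow> nbrs n c x - {a} \<noteq> {}"

text \<open>The growth rate per step that is caused by choices among edges visited at least twice: at a vertex of
  degree at most \<open>surplus + 2\<close> their weights sum to at most \<open>(surplus + 2) / sqrt D\<close>.\<close>

definition \<Psi> :: "(nat \<times> nat \<Rightarrow> nat) \<Rightarrow> real" where
  "\<Psi> c = 1 + 2 * (surplus n c + 2) / sqrt D"

definition base :: "nat \<Rightarrow> (nat \<times> nat \<Rightarrow> nat) \<Rightarrow> real" where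
  "base t c = (1 + 2 / l) ^ t * \<Psi> c ^ t * M ^ forks n c"

text \<open>An upper bound, up to a constant, for the total weight of all walks with \<open>t\<close> further steps.\<close>

definition potential :: "nat \<Rightarrow> (nat \<times> nat \<Rightarrow> nat) \<Rightarrow> nat \<Rightarrow> nat \<Rightarrow> real" where
  "potential t c a x = base t c * (if live c a x then R else 1)"

lemma sqrtD: "sqrt D \<ge> 1" using D_ge by simp
lemma M_ge: "M \<ge> 4" using l_ge by (simp add: M_def)
lemma r_ge: "r \<ge> 1" unfolding r_def using sqrtD by simp
lemma R_ge: "R \<ge> 1"
proof -
  have "M ^ 3 \<ge> 1" using M_ge by (intro one_le_power) auto
  then have "1 * 1 * 1 \<le> real l * M ^ 3 * r" using r_ge l_ge M_ge by (intro mult_mono) auto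
  then show ?thesis by (simp add: R_def)
qed

lemma Psi_ge: "\<Psi> c \<ge> 1" using sqrtD by (simp add: \<Psi>_def)

lemma base_pos: "base t c > 0"
  unfolding base_def using Psi_ge[of c] M_ge l_ge
  by (intro mult_pos_pos zero_less_power) (auto intro: add_pos_nonneg)

lemma potential_le: "potential t c a x \<le> base t c * R"
  unfolding potential_def using base_pos[of t c] R_ge by (auto simp: mult_le_cancel_left)

lemma base_le_potential: "base t c \<le> potential t c a x"
  unfolding potential_def using base_pos[of t c] R_ge by (auto simp: mult_le_cancel_left)

text \<open>Here \<open>k\<close> counts the endpoints of a new edge that had degree at least two, and each of them changes
  the potential by a factor of at most \<open>M ^ 3 * r\<close>.\<close>

lemma base_mono:
  assumes "surplus n c' \<le> surplus n c + k" "forks n c' \<le> forks n c + 3 * k" "t \<le> 2 * l"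
  shows "base t c' \<le> base t c * (M ^ 3 * r) ^ k"
proof -
  have "\<Psi> c' \<le> \<Psi> c + 2 * k / sqrt D"
  proof -
    have "2 * (real (surplus n c') + 2) / sqrt D \<le> 2 * (real (surplus n c + k) + 2) / sqrt D"
      using sqrtD assms(1) by (intro divide_right_mono) auto
    then show ?thesis by (simp add: \<Psi>_def add_divide_distrib distrib_left)
  qed
  also have "\<dots> \<le> \<Psi> c * (1 + 2 * k / sqrt D)"
  proof -
    have "1 * (2 * k / sqrt D) \<le> \<Psi> c * (2 * k / sqrt D)"
      using Psi_ge[of c] sqrtD by (intro mult_right_mono) auto
    then show ?thesis by (simp add: distrib_left)
  qed
  also have "\<dots> \<le> \<Psi> c * exp (2 * k / sqrt D)"
    using Psi_ge[of c] exp_ge_add_one_self[of "2 * k / sqrt D"] by (intro mult_left_mono) auto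
  finally have "\<Psi> c' ^ t \<le> (\<Psi> c * exp (2 * k / sqrt D)) ^ t"
    using Psi_ge[of c'] by (intro power_mono) auto
  also have "\<dots> = \<Psi> c ^ t * exp (2 * k / sqrt D * t)"
    by (simp only: power_mult_distrib exp_of_nat2_mult)
  also have "\<dots> \<le> \<Psi> c ^ t * r ^ k"
  proof -
    have "real t \<le> 2 * real l" using assms(3) by linarith
    then have "2 * k / sqrt D * t \<le> 2 * k / sqrt D * (2 * real l)"
      using sqrtD by (intro mult_left_mono) auto
    also have "\<dots> = 4 * real l / sqrt D * k" by simp
    finally show ?thesis using Psi_ge[of c]
      by (intro mult_left_mono) (auto simp: r_def exp_of_nat2_mult[symmetric])
  qed
  finally have 1: "\<Psi> c' ^ t \<le> \<Psi> c ^ t * r ^ k" .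
  have "M ^ forks n c' \<le> M ^ (forks n c + 3 * k)"
    using M_ge assms(2) by (intro power_increasing) auto
  then have 2: "M ^ forks n c' \<le> M ^ forks n c * (M ^ 3) ^ k"
    by (simp add: power_add power_mult)
  have "base t c' \<le> (1 + 2 / l) ^ t * (\<Psi> c ^ t * r ^ k) * (M ^ forks n c * (M ^ 3) ^ k)"
    unfolding base_def using 1 2 Psi_ge[of c] Psi_ge[of c'] M_ge r_ge
    by (intro mult_mono) auto
  then show ?thesis by (simp add: base_def power_mult_distrib mult_ac)
qed

lemma excess_small: "4 * l * \<delta> * (M ^ 3 * r) * R \<le> 1 / l"
    "4 * l * \<delta> * (M ^ 3 * r) ^ 2 \<le> 1 / l"
proof -
  have l: "real l > 0" using l_ge by simp
  have "4 * l * \<delta> * (M ^ 3 * r) * R * l = 4 ^ 7 * real l ^ 9 * r ^ 2 * \<delta>"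
    by (simp add: R_def M_def power_mult_distrib power2_eq_square eval_nat_numeral)
  also have "\<dots> \<le> 1" using small by (simp add: r_def)
  finally show 1: "4 * l * \<delta> * (M ^ 3 * r) * R \<le> 1 / l" using l by (simp add: field_simps)
  have "4 * l * \<delta> * (M ^ 3 * r) ^ 2 * 1 \<le> 4 * l * \<delta> * (M ^ 3 * r) ^ 2 * l"
    using l_ge delta_nonneg r_ge M_ge by (intro mult_left_mono) auto
  also have "\<dots> = 4 * l * \<delta> * (M ^ 3 * r) * R" by (simp add: R_def power2_eq_square)
  finally show "4 * l * \<delta> * (M ^ 3 * r) ^ 2 \<le> 1 / l" using 1 by simp
qed

lemma not_liveD: "\<not> live c a x \<Longrightarrow> card (nbrs n c x) \<le> 1"
  unfolding live_def by (metis Diff_eq_empty_iff card.empty card_mono card.insert finite.emptyI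
    finite.insertI insert_absorb is_singletonI is_singleton_altdef order_refl subset_singletonD zero_le_one)

text \<open>The one-step inequality behind the whole moment bound. From a vertex without known continuation the
  walk goes to a new vertex, of total weight at most one, or closes a cycle at cost \<open>\<delta>\<close> for each old
  vertex. From a live vertex of degree two it has one known continuation. At a branching vertex
  an open edge is paid for by \<open>M\<close> and the other edges by \<open>\<Psi>\<close>. The number \<open>K\<close> is one along a walk;
  it allows for a start at a vertex that was not reached along a visited edge, which may have two known
  continuations although its degree is only two.\<close>

lemma potential_step:
  assumes x: "x < n" and tot: "steps n c \<le> 2 * l" and t: "t \<le> 2 * l" and K: "K \<ge> 1"
    and K2: "card (nbrs n c x) \<le> 2 \<Longrightarrow> card (nbrs n c x - {a}) \<le> K"
  shows "(\<Sum>y\<in>{..<n} - {a, x}. step_weight (c (edge x y)) (edge x y) *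
            potential t (traverse c x y) x y) \<le> K * potential (Suc t) c a x"
proof -
  define g where "g y = step_weight (c (edge x y)) (edge x y) * potential t (traverse c x y) x y" for y
  define b where "b = base t c"
  have b: "b > 0" by (simp add: b_def base_pos)
  define m where "m = M ^ 3 * r"
  have m: "m \<ge> 1" unfolding m_def using M_ge r_ge
    by (metis mult_mono' mult_1 one_le_power order_trans zero_le_one numeral_le_iff one_le_numeral)
  define k where "k = (of_bool (card (nbrs n c x) \<ge> 2) :: nat)"
  have kl: "k \<le> 1" by (simp add: k_def)
  have k0: "k = 0" if "\<not> live c a x" using not_liveD[OF that] by (simp add: k_def)
  \<comment> \<open>New vertices, old vertices along a new edge, and known edges are treated separately.\<close>
  define N where "N = {y \<in> {..<n} - {a, x}. nbrs n c y = {}}"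
  define O' where "O' = {y \<in> {..<n} - {a, x}. nbrs n c y \<noteq> {} \<and> c (edge x y) = 0}"
  have split: "{..<n} - {a, x} = N \<union> O' \<union> (nbrs n c x - {a})" "N \<inter> O' = {}" "(N \<union> O') \<inter> (nbrs n c x - {a}) = {}"
    using x by (auto simp: N_def O'_def nbrs_def edge_commute)
  have fin: "finite N" "finite O'" by (auto simp: N_def O'_def)
  have N0: "c (edge x y) = 0" if "y \<in> N" for y
    using that x by (auto simp: N_def nbrs_def edge_commute)
  have N1: "g y \<le> prob_of (edge x y) / D * (b * m ^ k)" if y: "y \<in> N" for y
  proof -
    have c0: "c (edge x y) = 0" using N0[OF y] .
    have y': "y < n" "x \<noteq> y" "nbrs n c y = {}" using y by (auto simp: N_def)
    have nl: "\<not> live (traverse c x y) x y"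
      using x y' by (auto simp: live_def nbrs_traverse)
    have "base t (traverse c x y) \<le> b * m ^ k"
      unfolding b_def m_def using surplus_forks_new[where c = c and x = x and y = y and n = n, OF x y'(1,2) c0] y'(3) t
      by (intro base_mono) (auto simp: k_def)
    moreover have "prob_of (edge x y) \<ge> 0" using x y'(1) p_nonneg by (simp add: prob_of_edge)
    ultimately show ?thesis unfolding g_def step_weight_def potential_def using nl c0 D_ge
      by (auto intro!: mult_left_mono divide_right_mono)
  qed
  have sN: "sum g N \<le> b * m ^ k"
  proof -
    have "sum g N \<le> (\<Sum>y\<in>N. prob_of (edge x y)) / D * (b * m ^ k)"
      unfolding sum_divide_distrib sum_distrib_right by (intro sum_mono N1)
    also have "(\<Sum>y\<in>N. prob_of (edge x y)) = (\<Sum>y\<in>N. p x y)"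
      using x by (intro sum.cong) (auto simp: N_def prob_of_edge)
    also have "(\<Sum>y\<in>N. p x y) / D * (b * m ^ k) \<le> 1 * (b * m ^ k)"
    proof (intro mult_right_mono)
      have "(\<Sum>y\<in>N. p x y) \<le> (\<Sum>y<n. p x y)"
        using x p_nonneg by (intro sum_mono2) (auto simp: N_def)
      also have "\<dots> \<le> D" using row_le x by simp
      finally show "(\<Sum>y\<in>N. p x y) / D \<le> 1" using D_ge by simp
    qed (use b m in auto)
    finally show ?thesis by simp
  qed
  have O1: "g y \<le> \<delta> * (b * m ^ Suc k * R)" if y: "y \<in> O'" for y
  proof -
    have y': "y < n" "x \<noteq> y" "c (edge x y) = 0" using y by (auto simp: O'_def)
    let ?k = "k + of_bool (card (nbrs n c y) \<ge> 2)"
    have "base t (traverse c x y) \<le> b * m ^ ?k"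
      unfolding b_def m_def using surplus_forks_new[where c = c and x = x and y = y and n = n, OF x y'] t
      by (intro base_mono) (auto simp: k_def)
    also have "\<dots> \<le> b * m ^ Suc k" using b m by (intro mult_left_mono power_increasing) auto
    finally have "potential t (traverse c x y) x y \<le> b * m ^ Suc k * R"
      using potential_le[of t "traverse c x y" x y] R_ge
      by (meson mult_right_mono order_trans zero_le_one)
    moreover have "prob_of (edge x y) / D \<le> \<delta>" "prob_of (edge x y) / D \<ge> 0"
      using p_le[OF x y'(1)] p_nonneg[OF x y'(1)] x y'(1) D_ge by (auto simp: prob_of_edge field_simps)
    moreover have "potential t (traverse c x y) x y \<ge> 0"
      using base_le_potential base_pos less_le_trans less_imp_le by metis
    ultimately have "prob_of (edge x y) / D * potential t (traverse c x y) x y \<le> \<delta> * (b * m ^ Suc k * R)"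
      by (intro mult_mono delta_nonneg)
    then show ?thesis by (simp add: g_def step_weight_def y'(3))
  qed
  have cO: "real (card O') \<le> 4 * l"
  proof -
    have "card O' \<le> card {v. v < n \<and> nbrs n c v \<noteq> {}}" by (intro card_mono) (auto simp: O'_def)
    then show ?thesis using card_nonisolated_le[of n c] tot by linarith
  qed
  have sO: "sum g O' \<le> b * (4 * l * \<delta> * m ^ Suc k * R)"
  proof -
    have "sum g O' \<le> real (card O') * (\<delta> * (b * m ^ Suc k * R))"
      using O1 by (intro sum_bounded_above) auto
    also have "\<dots> \<le> 4 * l * (\<delta> * (b * m ^ Suc k * R))"
      using cO b m R_ge delta_nonneg by (intro mult_right_mono) auto
    finally show ?thesis by (simp add: mult_ac)
  qed
  have pot: "potential (Suc t) c a x = (1 + 2 / l) * \<Psi> c * b * (if live c a x then R else 1)"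
    by (simp add: potential_def b_def base_def)
  have total: "(\<Sum>y\<in>{..<n} - {a, x}. g y) = sum g N + sum g O' + sum g (nbrs n c x - {a})"
    unfolding split(1) using fin split(2,3) by (simp add: sum.union_disjoint)
  have "(\<Sum>y\<in>{..<n} - {a, x}. g y) \<le> K * potential (Suc t) c a x"
  proof (cases "live c a x")
    case False
    then have "sum g (nbrs n c x - {a}) = 0" by (simp only: live_def sum.empty not_not)
    then have "(\<Sum>y\<in>{..<n} - {a, x}. g y) \<le> b + b * (4 * l * \<delta> * m * R)"
      using total sN sO k0[OF False] by simp
    also have "\<dots> \<le> b + b * (1 / l)"
      using excess_small(1) b unfolding m_def by (intro add_left_mono mult_left_mono) auto
    also have "\<dots> = 1 * (1 + 1 / l) * 1 * b" by (simp add: algebra_simps)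
    also have "\<dots> \<le> K * (1 + 2 / l) * \<Psi> c * b"
      using b K Psi_ge[of c] by (intro mult_mono) (auto simp: divide_right_mono)
    finally show ?thesis using False by (simp add: pot mult_ac)
  next
    case True
    have known: "potential t (traverse c x y) x y \<le> b * R" if "y \<in> nbrs n c x" for y
    proof -
      have c: "c (edge x y) > 0" using that by (auto simp: nbrs_def)
      have "base t (traverse c x y) \<le> b * (M ^ 3 * r) ^ 0"
        unfolding b_def using surplus_known[where c = c, OF c, of n] forks_known[where c = c, OF c, of n] t
        by (intro base_mono) auto
      then have "base t (traverse c x y) * R \<le> b * R"
        using R_ge by (intro mult_right_mono) auto
      then show ?thesis using potential_le[of t "traverse c x y" x y] by linarith
    qed
    have w1: "step_weight (c (edge x y)) (edge x y) \<le> 1" "step_weight (c (edge x y)) (edge x y) \<ge> 0"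
      if "y \<in> nbrs n c x" for y
      using that sqrtD by (auto simp: step_weight_def nbrs_def)
    have known0: "potential t c' x y \<ge> 0" for c' y
      using base_le_potential base_pos less_le_trans less_imp_le by metis
    have sK: "sum g (nbrs n c x - {a}) \<le> K * \<Psi> c * (b * R)"
    proof (cases "card (nbrs n c x) \<le> 2")
      case True
      have "sum g (nbrs n c x - {a}) \<le> real (card (nbrs n c x - {a})) * (1 * (b * R))"
        unfolding g_def using w1 known known0 b R_ge by (intro sum_bounded_above mult_mono) auto
      also have "\<dots> \<le> (K * \<Psi> c) * (b * R)"
      proof -
        have "real (card (nbrs n c x - {a})) * 1 \<le> K * \<Psi> c"
          using K2[OF True] K Psi_ge[of c] by (intro mult_mono) auto
        from mult_right_mono[OF this, of "b * R"] show ?thesis using b R_ge by simp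
      qed
      finally show ?thesis .
    next
      case False
      have 1: "sum g (open_nbrs n c x - {a}) \<le> 1 / 2 * (b * R)"
      proof -
        have *: "g y \<le> b / M * R" if y: "y \<in> open_nbrs n c x" for y
        proof -
          have c: "c (edge x y) = 1" using y by (auto simp: open_nbrs_def)
          have f: "forks n (traverse c x y) < forks n c"
            using False y x by (intro forks_close) auto
          have s: "surplus n (traverse c x y) = surplus n c" using c by (intro surplus_known) auto
          have "M ^ Suc (forks n (traverse c x y)) \<le> M ^ forks n c"
            using f M_ge by (intro power_increasing) auto
          then have "M ^ forks n (traverse c x y) \<le> M ^ forks n c / M"
            using M_ge by (simp add: field_simps)
          moreover have "\<Psi> (traverse c x y) = \<Psi> c" by (simp add: \<Psi>_def s)
          ultimately have "base t (traverse c x y) \<le> (1 + 2 / l) ^ t * \<Psi> c ^ t * (M ^ forks n c / M)"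
            unfolding base_def using Psi_ge[of c]
            by (auto simp del: times_divide_eq_right intro!: mult_left_mono)
          then have "base t (traverse c x y) \<le> b / M" by (simp add: b_def base_def)
          then have "potential t (traverse c x y) x y \<le> b / M * R"
            using potential_le[of t "traverse c x y" x y] R_ge
            by (meson mult_right_mono order_trans zero_le_one)
          then show ?thesis by (simp add: g_def step_weight_def c)
        qed
        have "sum g (open_nbrs n c x - {a}) \<le> real (card (open_nbrs n c x - {a})) * (b / M * R)"
          using * by (intro sum_bounded_above) auto
        also have "\<dots> \<le> (2 * l) * (b / M * R)"
        proof -
          have "card (open_nbrs n c x - {a}) \<le> card (nbrs n c x)"
            by (intro card_mono) (auto simp: open_nbrs_def)
          then have "real (card (open_nbrs n c x - {a})) \<le> 2 * l"
            using card_nbrs_le[OF x, of c] tot by linarith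
          then show ?thesis using b R_ge M_ge by (intro mult_right_mono) auto
        qed
        also have "\<dots> = 1 / 2 * (b * R)" using l_ge by (simp add: M_def field_simps)
        finally show ?thesis .
      qed
      have 2: "sum g (nbrs n c x - {a} - open_nbrs n c x) \<le> (\<Psi> c - 1) / 2 * (b * R)"
      proof -
        have "g y \<le> 1 / sqrt D * (b * R)" if y: "y \<in> nbrs n c x - {a} - open_nbrs n c x" for y
        proof -
          have "step_weight (c (edge x y)) (edge x y) = 1 / sqrt D"
            using y by (auto simp: step_weight_def nbrs_def open_nbrs_def)
          then show ?thesis using known[of y] y sqrtD b R_ge unfolding g_def
            by (auto intro!: divide_right_mono)
        qed
        then have "sum g (nbrs n c x - {a} - open_nbrs n c x)
            \<le> real (card (nbrs n c x - {a} - open_nbrs n c x)) * (1 / sqrt D * (b * R))"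
          by (intro sum_bounded_above) auto
        also have "\<dots> \<le> real (surplus n c + 2) * (1 / sqrt D * (b * R))"
        proof -
          have "card (nbrs n c x - {a} - open_nbrs n c x) \<le> card (nbrs n c x)" by (intro card_mono) auto
          then show ?thesis using b R_ge sqrtD card_nbrs_le_surplus[OF x, of c]
            by (intro mult_right_mono) auto
        qed
        also have "\<dots> = (\<Psi> c - 1) / 2 * (b * R)"
        proof -
          have "(\<Psi> c - 1) / 2 = real (surplus n c + 2) / sqrt D"
            using sqrtD by (simp add: \<Psi>_def divide_simps)
          then show ?thesis by (simp only:) (simp only: times_divide_eq_left mult_1 times_divide_eq_right)
        qed
        finally show ?thesis .
      qed
      have "nbrs n c x - {a} = (open_nbrs n c x - {a}) \<union> (nbrs n c x - {a} - open_nbrs n c x)"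
        by (auto simp: open_nbrs_def)
      then have "sum g (nbrs n c x - {a}) = sum g (open_nbrs n c x - {a}) + sum g (nbrs n c x - {a} - open_nbrs n c x)"
        by (subst sum.union_disjoint[symmetric]) auto
      also have "\<dots> \<le> 1 / 2 * (b * R) + (\<Psi> c - 1) / 2 * (b * R)" using 1 2 by linarith
      also have "\<dots> = (\<Psi> c / 2) * (b * R)" by (simp add: field_simps)
      also have "\<dots> \<le> (K * \<Psi> c) * (b * R)"
      proof -
        have "(1 / 2) * \<Psi> c \<le> K * \<Psi> c" using K Psi_ge[of c] by (intro mult_right_mono) auto
        from mult_right_mono[OF this, of "b * R"] show ?thesis using b R_ge by simp
      qed
      finally show ?thesis .
    qed
    have mk: "m ^ k \<le> m" "m ^ Suc k \<le> m ^ 2"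
      using m kl power_increasing[of k 1 m] power_increasing[of "Suc k" 2 m] by auto
    have "b * m ^ k \<le> b * m" using mk b by (intro mult_left_mono) auto
    then have "sum g N \<le> b * m" using sN by linarith
    also have "b * m = b * R / l" using l_ge by (simp add: R_def m_def field_simps)
    finally have sN': "sum g N \<le> b * R * (1 / l)" by simp
    have "b * (4 * l * \<delta> * m ^ Suc k * R) \<le> b * (4 * l * \<delta> * m ^ 2 * R)"
      using mk(2) b R_ge delta_nonneg by (intro mult_left_mono mult_right_mono) auto
    then have "sum g O' \<le> b * (4 * l * \<delta> * m ^ 2 * R)" using sO by linarith
    also have "\<dots> = b * R * (4 * l * \<delta> * m ^ 2)" by (simp add: mult_ac)
    also have "\<dots> \<le> b * R * (1 / l)"
      using excess_small(2) b R_ge unfolding m_def by (intro mult_left_mono) auto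
    finally have sO': "sum g O' \<le> b * R * (1 / l)" .
    have "(\<Sum>y\<in>{..<n} - {a, x}. g y) \<le> (K * \<Psi> c + 2 / l) * (b * R)"
    proof -
      have "(K * \<Psi> c + 2 / l) * (b * R) = K * \<Psi> c * (b * R) + b * R * (1 / l) + b * R * (1 / l)"
        by (simp add: algebra_simps)
      then show ?thesis using total sN' sO' sK by linarith
    qed
    also have "\<dots> \<le> (K * ((1 + 2 / l) * \<Psi> c)) * (b * R)"
    proof (intro mult_right_mono)
      have "1 * (2 / l) \<le> (K * \<Psi> c) * (2 / l)"
        using K Psi_ge[of c] mult_mono[of 1 K 1 "\<Psi> c"] by (intro mult_right_mono) auto
      then show "K * \<Psi> c + 2 / l \<le> K * ((1 + 2 / l) * \<Psi> c)" by (simp add: algebra_simps)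
    qed (use b R_ge in auto)
    finally show ?thesis using True by (simp add: pot mult_ac)
  qed
  then show ?thesis by (simp add: g_def)
qed

end

section \<open>The total weight of pairs of walks\<close>

text \<open>The number of steps taken is recorded, so that \<open>f\<close> and \<open>g\<close> need to be compared only for visit
  counts of the right total.\<close>

lemma walk_sum_mono:
  assumes "x < n" and "\<And>b z c'. z < n \<Longrightarrow> steps n c' = steps n c + t \<Longrightarrow> f b z c' \<le> g b z c'"
  shows "walk_sum n t a x c f \<le> walk_sum n t a x c g"
  using assms
proof (induction t arbitrary: a x c)
  case (Suc t)
  show ?case unfolding walk_sum.simps
  proof (rule sum_mono)
    fix y assume y: "y \<in> {..<n} - {a, x}"
    then have "steps n (traverse c x y) = Suc (steps n c)"
      using Suc.prems(1) by (intro steps_traverse) auto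
    then show "walk_sum n t x y (traverse c x y) f \<le> walk_sum n t x y (traverse c x y) g"
      using y Suc.prems(2) by (intro Suc.IH) auto
  qed
qed simp

context walk_weights begin

text \<open>The product of the step weights of the first \<open>k\<close> visits to \<open>e\<close>; the truncated subtraction
  accounts for the first two visits.\<close>

definition visit_weight :: "nat \<Rightarrow> nat \<times> nat \<Rightarrow> real" where
  "visit_weight k e = (if k = 0 then 1 else prob_of e / D * (1 / sqrt D) ^ (k - 2))"

definition weight :: "(nat \<times> nat \<Rightarrow> nat) \<Rightarrow> real" where
  "weight c = (\<Prod>e\<in>edges n. visit_weight (c e) e)"

lemma visit_weight_Suc: "visit_weight (Suc k) e = visit_weight k e * step_weight k e"
proof -
  consider "k = 0" | "k = 1" | m where "k = Suc (Suc m)" by (metis One_nat_def not0_implies_Suc)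
  then show ?thesis by cases (auto simp: visit_weight_def step_weight_def)
qed

lemma weight_traverse:
  assumes "x < n" "y < n" "x \<noteq> y"
  shows "weight (traverse c x y) = weight c * step_weight (c (edge x y)) (edge x y)"
proof -
  have e: "edge x y \<in> edges n" using assms by (rule edge_in_edges)
  have "(\<Prod>e\<in>edges n - {edge x y}. visit_weight (traverse c x y e) e)
      = (\<Prod>e\<in>edges n - {edge x y}. visit_weight (c e) e)"
    by (rule prod.cong) (simp_all add: traverse_def)
  then show ?thesis
    unfolding weight_def prod.remove[OF finite_edges e]
    by (simp add: traverse_def visit_weight_Suc mult_ac)
qed

lemma prob_of_nonneg: "e \<in> edges n \<Longrightarrow> prob_of e \<ge> 0"
  by (auto simp: prob_of_def edges_def intro: p_nonneg)

lemma weight_nonneg: "weight c \<ge> 0"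
  unfolding weight_def visit_weight_def using D_ge prob_of_nonneg by (intro prod_nonneg) auto

lemma potential_nonneg: "potential t c a x \<ge> 0"
  using base_le_potential[of t c a x] base_pos[of t c] by linarith

lemma walk_sum_le_potential:
  assumes "x < n" "steps n c + t + s \<le> 2 * l" "K \<ge> 1" "G \<ge> 0"
    and "card (nbrs n c x) \<le> 2 \<Longrightarrow> card (nbrs n c x - {a}) \<le> K"
    and "\<And>b z c'. z < n \<Longrightarrow> steps n c' = steps n c + t \<Longrightarrow>
           f b z c' \<le> G * weight c' * potential s c' b z"
  shows "walk_sum n t a x c f \<le> G * weight c * (K * potential (t + s) c a x)"
  using assms
proof (induction t arbitrary: a x c K)
  case 0
  have "1 * potential s c a x \<le> K * potential s c a x"
    using 0(3) potential_nonneg by (intro mult_right_mono) auto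
  then have "G * weight c * potential s c a x \<le> G * weight c * (K * potential s c a x)"
    using 0(4) weight_nonneg by (intro mult_left_mono) auto
  moreover have "f a x c \<le> G * weight c * potential s c a x" using 0(1,6) by simp
  ultimately show ?case by simp
next
  case (Suc t)
  have "walk_sum n (Suc t) a x c f \<le> (\<Sum>y\<in>{..<n} - {a, x}.
      G * weight (traverse c x y) * (1 * potential (t + s) (traverse c x y) x y))"
    unfolding walk_sum.simps
  proof (rule sum_mono)
    fix y assume y: "y \<in> {..<n} - {a, x}"
    then have tt: "steps n (traverse c x y) = Suc (steps n c)"
      using Suc.prems(1) by (intro steps_traverse) auto
    have "x \<in> nbrs n (traverse c x y) y"
      using y Suc.prems(1) by (auto simp: nbrs_def traverse_def edge_commute)
    then have few: "card (nbrs n (traverse c x y) y) \<le> 2 \<Longrightarrow> card (nbrs n (traverse c x y) y - {x}) \<le> 1"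
      by (simp add: card_Diff_singleton)
    have "walk_sum n t x y (traverse c x y) f \<le>
        G * weight (traverse c x y) * (real 1 * potential (t + s) (traverse c x y) x y)"
    proof (rule Suc.IH)
      fix b z c' assume "z < n" "steps n c' = steps n (traverse c x y) + t"
      then show "f b z c' \<le> G * weight c' * potential s c' b z"
        using Suc.prems(6) tt by simp
    qed (use y Suc.prems(2,4) tt few in simp_all)
    then show "walk_sum n t x y (traverse c x y) f \<le>
        G * weight (traverse c x y) * (1 * potential (t + s) (traverse c x y) x y)" by simp
  qed
  also have "\<dots> = G * weight c * (\<Sum>y\<in>{..<n} - {a, x}.
      step_weight (c (edge x y)) (edge x y) * potential (t + s) (traverse c x y) x y)"
    unfolding sum_distrib_left using Suc.prems(1)
    by (intro sum.cong refl) (auto simp: weight_traverse)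
  also have "\<dots> \<le> G * weight c * (K * potential (Suc (t + s)) c a x)"
    using Suc.prems weight_nonneg by (intro mult_left_mono potential_step) auto
  finally show ?case by simp
qed

text \<open>Both walks start from the directed edge from \<open>a\<close> to \<open>x\<close>. The second one begins with a jump back
  to it, which costs a factor \<open>R\<close> because the walk may become live, and a factor two by
  the constant \<open>K\<close> in the one-step inequality.\<close>

lemma double_walk_sum_le:
  assumes "x < n"
  shows "walk_sum n l a x (\<lambda>_. 0) (\<lambda>_ _ c. walk_sum n l a x c (\<lambda>_ _ c'. weight c'))
    \<le> 128 * exp 4 * real l ^ 4 * r ^ 3"
proof -
  have inner: "walk_sum n l a x c (\<lambda>_ _ c'. weight c') \<le> (2 * R) * weight c * potential l c b z"
    if "steps n c = l" for c b z
  proof -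
    have "walk_sum n l a x c (\<lambda>_ _ c'. weight c') \<le> 1 * weight c * (real 2 * potential (l + 0) c a x)"
    proof (rule walk_sum_le_potential)
      show "card (nbrs n c x - {a}) \<le> 2" if "card (nbrs n c x) \<le> 2"
        using that by (meson card_Diff1_le order_trans)
      show "weight c' \<le> 1 * weight c' * potential 0 c' b z" for c' b z
      proof -
        have "1 \<le> base 0 c'" using M_ge by (simp add: base_def)
        then have "1 \<le> potential 0 c' b z" using base_le_potential[of 0 c' b z] by linarith
        from mult_left_mono[OF this weight_nonneg[of c']] show ?thesis by simp
      qed
    qed (use assms that in auto)
    also have "\<dots> \<le> 1 * weight c * (2 * (base l c * R))"
      using weight_nonneg potential_le by (intro mult_left_mono) auto
    also have "\<dots> \<le> 1 * weight c * (2 * (potential l c b z * R))"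
      using weight_nonneg base_le_potential R_ge by (intro mult_left_mono mult_right_mono) auto
    finally show ?thesis by (simp add: mult_ac)
  qed
  have nb0: "nbrs n (\<lambda>_. 0) v = {}" for v by (simp add: nbrs_def)
  have t0: "steps n (\<lambda>_. 0) = 0" by (simp add: steps_def)
  have "walk_sum n l a x (\<lambda>_. 0) (\<lambda>_ _ c. walk_sum n l a x c (\<lambda>_ _ c'. weight c'))
    \<le> (2 * R) * weight (\<lambda>_. 0) * (real 1 * potential (l + l) (\<lambda>_. 0) a x)"
    using inner R_ge assms by (intro walk_sum_le_potential) (auto simp: nb0 t0)
  also have "weight (\<lambda>_. 0) = 1" by (simp add: weight_def visit_weight_def)
  also have "potential (l + l) (\<lambda>_. 0) a x = (1 + 2 / l) ^ (2 * l) * (1 + 4 / sqrt D) ^ (2 * l)"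
    by (simp add: potential_def live_def nb0 base_def \<Psi>_def surplus_def forks_def mult_2)
  also have "(1 + 2 / real l) ^ (2 * l) \<le> exp 4"
  proof -
    have "(1 + 2 / real l) ^ (2 * l) \<le> exp (2 / real l) ^ (2 * l)"
      by (intro power_mono exp_ge_add_one_self) auto
    also have "\<dots> = exp (2 / real l * real (2 * l))" by (rule exp_of_nat2_mult[symmetric])
    also have "2 / real l * real (2 * l) = 4" using l_ge by simp
    finally show ?thesis .
  qed
  also have "(1 + 4 / sqrt D) ^ (2 * l) \<le> r ^ 2"
  proof -
    have "(1 + 4 / sqrt D) ^ (2 * l) \<le> exp (4 / sqrt D) ^ (2 * l)"
      using sqrtD by (intro power_mono exp_ge_add_one_self) auto
    also have "\<dots> = (exp (4 / sqrt D) ^ l) ^ 2" by (simp add: mult.commute power_mult)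
    also have "exp (4 / sqrt D) ^ l = r" by (simp add: r_def exp_of_nat2_mult[symmetric])
    finally show ?thesis .
  qed
  finally have "walk_sum n l a x (\<lambda>_. 0) (\<lambda>_ _ c. walk_sum n l a x c (\<lambda>_ _ c'. weight c'))
    \<le> 2 * R * 1 * (real 1 * (exp 4 * r ^ 2))"
    using R_ge sqrtD by (simp add: mult_left_mono mult_right_mono)
  also have "\<dots> = 128 * exp 4 * real l ^ 4 * r ^ 3"
    by (simp add: R_def M_def power_mult_distrib eval_nat_numeral)
  finally show ?thesis .
qed

text \<open>Bounds the mixed moment of centred edge indicators with exponents \<open>c\<close>: it vanishes if an edge
  occurs once, and otherwise each edge contributes at most its probability.\<close>

definition cover_weight :: "(nat \<times> nat \<Rightarrow> nat) \<Rightarrow> real" where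
  "cover_weight c = (if \<exists>e\<in>edges n. c e = 1 then 0 else \<Prod>e\<in>edges n. if c e = 0 then 1 else prob_of e)"

lemma cover_weight_le:
  assumes "steps n c = 2 * l"
  shows "cover_weight c \<le> D ^ l * weight c"
proof (cases "\<exists>e\<in>edges n. c e = 1")
  case True
  then show ?thesis using D_ge weight_nonneg by (simp add: cover_weight_def)
next
  case False
  \<comment> \<open>Without single visits every visit to a visited edge carries the same factor.\<close>
  have "visit_weight (c e) e = (if c e = 0 then 1 else prob_of e) * (1 / sqrt D) ^ c e"
    if "e \<in> edges n" for e
  proof (cases "c e = 0")
    case False
    moreover have "c e \<noteq> 1" using \<open>\<not> (\<exists>e\<in>edges n. c e = 1)\<close> that by blast
    ultimately obtain m where m: "c e = Suc (Suc m)" by (cases "c e"; cases "c e - 1") auto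
    have "(1 / sqrt D) * (1 / sqrt D) = 1 / D" using D_ge by simp
    then show ?thesis using D_ge by (simp add: visit_weight_def m)
  qed (simp add: visit_weight_def)
  then have "weight c = (\<Prod>e\<in>edges n. if c e = 0 then 1 else prob_of e) * (\<Prod>e\<in>edges n. (1 / sqrt D) ^ c e)"
    unfolding weight_def by (simp add: prod.distrib)
  also have "(\<Prod>e\<in>edges n. (1 / sqrt D) ^ c e) = (1 / sqrt D) ^ (2 * l)"
    using assms by (simp add: power_sum[symmetric] steps_def)
  also have "\<dots> = ((1 / sqrt D) ^ 2) ^ l" by (rule power_mult)
  also have "(1 / sqrt D) ^ 2 = 1 / D" using D_ge by (simp add: power_divide)
  also have "(1 / D) ^ l = 1 / D ^ l" by (simp add: power_one_over)
  finally show ?thesis using False D_ge by (simp add: cover_weight_def)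
qed

end

section \<open>Powers of the nonbacktracking operator\<close>

text \<open>The kernel of the \<open>t\<close>-th power of the nonbacktracking operator \<open>B\<close>, which acts on functions \<open>u\<close>
  of directed edges by \<open>(B u) (a, x) = (\<Sum>y\<notin>{a, x}. X x y * u (x, y))\<close>.\<close>

primrec path_kernel :: "nat \<Rightarrow> (nat \<Rightarrow> nat \<Rightarrow> real) \<Rightarrow> nat \<Rightarrow> nat \<Rightarrow> nat \<Rightarrow> nat \<Rightarrow> nat \<Rightarrow> real" where
  "path_kernel n X 0 a x b z = of_bool (a = b \<and> x = z)"
| "path_kernel n X (Suc t) a x b z = (\<Sum>y\<in>{..<n} - {a, x}. X x y * path_kernel n X t x y b z)"

text \<open>The squared Frobenius norm of the \<open>l\<close>-th power of the nonbacktracking operator.\<close>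

definition path_energy :: "nat \<Rightarrow> (nat \<Rightarrow> nat \<Rightarrow> real) \<Rightarrow> nat \<Rightarrow> real" where
  "path_energy n X l = (\<Sum>a<n. \<Sum>x<n. \<Sum>b<n. \<Sum>z<n. (path_kernel n X l a x b z)\<^sup>2)"

definition monomial :: "nat \<Rightarrow> (nat \<Rightarrow> nat \<Rightarrow> real) \<Rightarrow> (nat \<times> nat \<Rightarrow> nat) \<Rightarrow> real" where
  "monomial n X c = (\<Prod>e\<in>edges n. X (fst e) (snd e) ^ c e)"

lemma monomial_traverse:
  assumes "x < n" "y < n" "x \<noteq> y" and sym: "X x y = X y x"
  shows "monomial n X (traverse c x y) = monomial n X c * X x y"
proof -
  have e: "edge x y \<in> edges n" using assms(1-3) by (rule edge_in_edges)
  have "(\<Prod>e\<in>edges n - {edge x y}. X (fst e) (snd e) ^ traverse c x y e)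
      = (\<Prod>e\<in>edges n - {edge x y}. X (fst e) (snd e) ^ c e)"
    by (rule prod.cong) (simp_all add: traverse_def)
  moreover have "X (fst (edge x y)) (snd (edge x y)) = X x y"
    using sym by (simp add: edge_def min_def max_def)
  ultimately show ?thesis
    unfolding monomial_def prod.remove[OF finite_edges e] by (simp add: traverse_def)
qed

lemma walk_sum_monomial:
  assumes sym: "\<And>x y. x < n \<Longrightarrow> y < n \<Longrightarrow> X x y = X y x" and "a < n" "x < n"
  shows "walk_sum n t a x c (\<lambda>b z c'. monomial n X c' * h b z) =
     monomial n X c * (\<Sum>b<n. \<Sum>z<n. path_kernel n X t a x b z * h b z)"
  using assms(2,3)
proof (induction t arbitrary: a x c)
  case 0
  have "(\<Sum>b<n. \<Sum>z<n. of_bool (a = b \<and> x = z) * h b z) = (\<Sum>b<n. if b = a then h a x else 0)"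
  proof (rule sum.cong)
    fix b assume "b \<in> {..<n}"
    show "(\<Sum>z<n. of_bool (a = b \<and> x = z) * h b z) = (if b = a then h a x else 0)"
    proof (cases "b = a")
      case True
      then have "(\<Sum>z<n. of_bool (a = b \<and> x = z) * h b z) = (\<Sum>z<n. if z = x then h a z else 0)"
        by (intro sum.cong) auto
      then show ?thesis using True 0 by simp
    qed auto
  qed simp
  then show ?case using 0 by simp
next
  case (Suc t)
  have "walk_sum n (Suc t) a x c (\<lambda>b z c'. monomial n X c' * h b z)
      = (\<Sum>y\<in>{..<n} - {a, x}. monomial n X c * (X x y * (\<Sum>b<n. \<Sum>z<n. path_kernel n X t x y b z * h b z)))"
    unfolding walk_sum.simps
  proof (rule sum.cong)
    fix y assume "y \<in> {..<n} - {a, x}"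
    then show "walk_sum n t x y (traverse c x y) (\<lambda>b z c'. monomial n X c' * h b z)
      = monomial n X c * (X x y * (\<Sum>b<n. \<Sum>z<n. path_kernel n X t x y b z * h b z))"
      using Suc.prems sym[of x y] by (simp add: Suc.IH monomial_traverse)
  qed simp
  also have "\<dots> = monomial n X c * (\<Sum>y\<in>{..<n} - {a, x}. \<Sum>b<n. \<Sum>z<n. X x y * (path_kernel n X t x y b z * h b z))"
    by (simp add: sum_distrib_left)
  also have "(\<Sum>y\<in>{..<n} - {a, x}. \<Sum>b<n. \<Sum>z<n. X x y * (path_kernel n X t x y b z * h b z))
     = (\<Sum>b<n. \<Sum>y\<in>{..<n} - {a, x}. \<Sum>z<n. X x y * (path_kernel n X t x y b z * h b z))"
    by (rule sum.swap)
  also have "\<dots> = (\<Sum>b<n. \<Sum>z<n. \<Sum>y\<in>{..<n} - {a, x}. X x y * (path_kernel n X t x y b z * h b z))"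
    by (intro sum.cong refl sum.swap)
  also have "\<dots> = (\<Sum>b<n. \<Sum>z<n. path_kernel n X (Suc t) a x b z * h b z)"
    by (simp add: sum_distrib_right mult.assoc)
  finally show ?case .
qed

text \<open>A square of the kernel is a sum over two walks with common first and last directed edges. The inner
  walk inherits the visit counts of the outer one, so that the monomial at its end collects all
  factors of both.\<close>

lemma path_energy_eq_walk_sum:
  assumes sym: "\<And>x y. x < n \<Longrightarrow> y < n \<Longrightarrow> X x y = X y x"
  shows "path_energy n X l = (\<Sum>a<n. \<Sum>x<n. walk_sum n l a x (\<lambda>_. 0)
    (\<lambda>b z c. walk_sum n l a x c (\<lambda>b' z' c'. monomial n X c' * of_bool (b' = b \<and> z' = z))))"
proof -
  have 1: "walk_sum n l a x c (\<lambda>b' z' c'. monomial n X c' * of_bool (b' = b \<and> z' = z))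
     = monomial n X c * (if b < n \<and> z < n then path_kernel n X l a x b z else 0)"
    if "a < n" "x < n" for a x b z c
  proof -
    have "(\<Sum>b'<n. \<Sum>z'<n. path_kernel n X l a x b' z' * of_bool (b' = b \<and> z' = z))
       = (\<Sum>b'<n. if b' = b then (if z < n then path_kernel n X l a x b z else 0) else 0)"
    proof (rule sum.cong)
      fix b' 
      have "path_kernel n X l a x b' z' * of_bool (b' = b \<and> z' = z)
        = (if z' = z then (if b' = b then path_kernel n X l a x b z else 0) else 0)" for z' by auto
      then show "(\<Sum>z'<n. path_kernel n X l a x b' z' * of_bool (b' = b \<and> z' = z))
        = (if b' = b then (if z < n then path_kernel n X l a x b z else 0) else 0)"
        by simp
    qed simp
    then show ?thesis using walk_sum_monomial[where X = X, OF sym that, where t = l and c = c and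
        h = "\<lambda>b' z'. of_bool (b' = b \<and> z' = z)"] by simp
  qed
  have "walk_sum n l a x (\<lambda>_. 0)
    (\<lambda>b z c. walk_sum n l a x c (\<lambda>b' z' c'. monomial n X c' * of_bool (b' = b \<and> z' = z)))
    = (\<Sum>b<n. \<Sum>z<n. (path_kernel n X l a x b z)\<^sup>2)" if "a < n" "x < n" for a x
  proof -
    have "monomial n X (\<lambda>_. 0) = 1" by (simp add: monomial_def)
    then show ?thesis
      using walk_sum_monomial[where X = X, OF sym that, where t = l and c = "\<lambda>_. 0" and
        h = "\<lambda>b z. if b < n \<and> z < n then path_kernel n X l a x b z else 0"]
      by (simp add: 1[OF that] power2_eq_square)
  qed
  then show ?thesis by (simp add: path_energy_def)
qed

section \<open>The Ihara-Bass identity and the quadratic form of the matrix\<close>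

lemma kernel_apply:
  assumes ev: "\<And>i j. i < n \<Longrightarrow> j < n \<Longrightarrow> \<mu> * u i j = (\<Sum>k\<in>{..<n} - {i, j}. X j k * u j k)"
    and "a < n" "x < n"
  shows "\<mu> ^ t * u a x = (\<Sum>b<n. \<Sum>z<n. path_kernel n X t a x b z * u b z)"
  using assms(2,3)
proof (induction t arbitrary: a x)
  case 0
  have "(\<Sum>b<n. \<Sum>z<n. of_bool (a = b \<and> x = z) * u b z) = (\<Sum>b<n. if b = a then u a x else 0)"
  proof (rule sum.cong)
    fix b assume "b \<in> {..<n}"
    show "(\<Sum>z<n. of_bool (a = b \<and> x = z) * u b z) = (if b = a then u a x else 0)"
    proof (cases "b = a")
      case True
      then have "(\<Sum>z<n. of_bool (a = b \<and> x = z) * u b z) = (\<Sum>z<n. if z = x then u a z else 0)"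
        by (intro sum.cong) auto
      then show ?thesis using True 0 by simp
    qed auto
  qed simp
  then show ?case using 0 by simp
next
  case (Suc t)
  have "\<mu> ^ Suc t * u a x = (\<Sum>y\<in>{..<n} - {a, x}. X x y * (\<mu> ^ t * u x y))"
  proof -
    have "\<mu> ^ Suc t * u a x = \<mu> ^ t * (\<mu> * u a x)" by simp
    also have "\<dots> = (\<Sum>y\<in>{..<n} - {a, x}. X x y * (\<mu> ^ t * u x y))"
      unfolding ev[OF Suc.prems] sum_distrib_left by (rule sum.cong) simp_all
    finally show ?thesis .
  qed
  also have "\<dots> = (\<Sum>y\<in>{..<n} - {a, x}. \<Sum>b<n. \<Sum>z<n. X x y * (path_kernel n X t x y b z * u b z))"
    using Suc by (intro sum.cong) (auto simp: sum_distrib_left)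
  also have "\<dots> = (\<Sum>b<n. \<Sum>y\<in>{..<n} - {a, x}. \<Sum>z<n. X x y * (path_kernel n X t x y b z * u b z))"
    by (rule sum.swap)
  also have "\<dots> = (\<Sum>b<n. \<Sum>z<n. \<Sum>y\<in>{..<n} - {a, x}. X x y * (path_kernel n X t x y b z * u b z))"
    by (intro sum.cong refl sum.swap)
  also have "\<dots> = (\<Sum>b<n. \<Sum>z<n. path_kernel n X (Suc t) a x b z * u b z)"
    by (simp add: sum_distrib_right mult.assoc)
  finally show ?case .
qed

text \<open>The spectral radius is at most the Frobenius norm of a power, by the Cauchy-Schwarz inequality.\<close>

lemma eigenvalue_le_energy:
  assumes ev: "\<And>i j. i < n \<Longrightarrow> j < n \<Longrightarrow> \<mu> * u i j = (\<Sum>k\<in>{..<n} - {i, j}. X j k * u j k)"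
    and nz: "i0 < n" "j0 < n" "u i0 j0 \<noteq> 0"
  shows "\<mu> ^ (2 * l) \<le> path_energy n X l"
proof -
  define I where "I = {..<n} \<times> {..<n}"
  define U where "U = (\<Sum>e\<in>I. (u (fst e) (snd e))\<^sup>2)"
  have dbl: "(\<Sum>a<n. \<Sum>x<n. h a x) = (\<Sum>e\<in>I. h (fst e) (snd e))" for h :: "nat \<Rightarrow> nat \<Rightarrow> real"
    by (simp add: I_def sum.cartesian_product split_def)
  have cs: "(\<mu> ^ l * u a x)\<^sup>2 \<le> (\<Sum>e\<in>I. (path_kernel n X l a x (fst e) (snd e))\<^sup>2) * U"
    if "a < n" "x < n" for a x
  proof -
    have "\<mu> ^ l * u a x = (\<Sum>b<n. \<Sum>z<n. path_kernel n X l a x b z * u b z)"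
      by (rule kernel_apply) (use ev that in auto)
    then have "\<mu> ^ l * u a x = (\<Sum>e\<in>I. path_kernel n X l a x (fst e) (snd e) * u (fst e) (snd e))"
      by (simp only: dbl)
    then show ?thesis unfolding U_def by (simp only: Cauchy_Schwarz_ineq_sum)
  qed
  have "\<mu> ^ (2 * l) * U = (\<Sum>e\<in>I. (\<mu> ^ l * u (fst e) (snd e))\<^sup>2)"
    by (simp add: U_def sum_distrib_left power_mult_distrib power_mult mult.commute)
  also have "\<dots> \<le> (\<Sum>e\<in>I. (\<Sum>f\<in>I. (path_kernel n X l (fst e) (snd e) (fst f) (snd f))\<^sup>2) * U)"
    by (intro sum_mono cs) (auto simp: I_def)
  also have "\<dots> = path_energy n X l * U"
    by (simp only: path_energy_def dbl sum_distrib_right)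
  finally have "\<mu> ^ (2 * l) * U \<le> path_energy n X l * U" .
  moreover have "U > 0"
  proof -
    have "(u i0 j0)\<^sup>2 \<le> U"
      using member_le_sum[of "(i0, j0)" I "\<lambda>e. (u (fst e) (snd e))\<^sup>2"] nz
      by (simp add: U_def I_def)
    then show ?thesis using nz(3) by (smt (verit) zero_less_power2)
  qed
  ultimately show ?thesis by (simp add: mult_le_cancel_right)
qed

text \<open>The bilinear form of the matrix of the Ihara-Bass identity for a weighted graph; it is singular
  exactly at eigenvalues \<open>\<mu>\<close> of the nonbacktracking operator, away from \<open>\<mu>\<^sup>2 = (X i j)\<^sup>2\<close>.\<close>

definition ihara_bass_form :: "nat \<Rightarrow> (nat \<Rightarrow> nat \<Rightarrow> real) \<Rightarrow> real \<Rightarrow> (nat \<Rightarrow> real) \<Rightarrow> (nat \<Rightarrow> real) \<Rightarrow> real" where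
  "ihara_bass_form n X \<mu> v w = (\<Sum>i<n. v i * w i * (1 + (\<Sum>j<n. (X i j)\<^sup>2 / (\<mu>\<^sup>2 - (X i j)\<^sup>2))))
     - (\<Sum>i<n. \<Sum>j<n. \<mu> * X i j / (\<mu>\<^sup>2 - (X i j)\<^sup>2) * v i * w j)"

text \<open>A kernel vector \<open>s\<close> of the Ihara-Bass matrix gives an eigenvector \<open>u\<close> of the nonbacktracking
  operator. If \<open>s j\<close> stands for the sum of \<open>X j k * u j k\<close> over all \<open>k\<close>, the eigenvalue equation is
  \<open>\<mu> * u i j = s j - X i j * u j i\<close>; this equation and its mirror image for \<open>(j, i)\<close>, solved for
  \<open>u i j\<close>, give the formula that defines \<open>u\<close>, and summing it is the kernel equation.\<close>

lemma ihara_bass_kernel: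
  assumes sym: "\<And>x y. x < n \<Longrightarrow> y < n \<Longrightarrow> X x y = X y x"
    and diag: "\<And>x. x < n \<Longrightarrow> X x x = 0"
    and bd: "\<And>x y. x < n \<Longrightarrow> y < n \<Longrightarrow> \<bar>X x y\<bar> \<le> 1"
    and mu: "\<mu> > 1"
    and ker: "\<And>i. i < n \<Longrightarrow> s i * (1 + (\<Sum>j<n. (X i j)\<^sup>2 / (\<mu>\<^sup>2 - (X i j)\<^sup>2)))
                 = (\<Sum>j<n. \<mu> * X i j / (\<mu>\<^sup>2 - (X i j)\<^sup>2) * s j)"
    and nz: "i0 < n" "s i0 \<noteq> 0"
  shows "\<mu> ^ (2 * l) \<le> path_energy n X l"
proof -
  define u where "u i j = (\<mu> * s j - X i j * s i) / (\<mu>\<^sup>2 - (X i j)\<^sup>2)" for i j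
  have den: "\<mu>\<^sup>2 - (X i j)\<^sup>2 > 0" if "i < n" "j < n" for i j
  proof -
    have "(X i j)\<^sup>2 \<le> 1" using bd[OF that] by (simp add: abs_square_le_1)
    moreover have "1 < \<mu>\<^sup>2" using mu by (simp add: one_less_power)
    ultimately show ?thesis by linarith
  qed
  have su: "(\<Sum>k<n. X j k * u j k) = s j" if j: "j < n" for j
  proof -
    have "X j k * u j k = \<mu> * X j k / (\<mu>\<^sup>2 - (X j k)\<^sup>2) * s k - s j * ((X j k)\<^sup>2 / (\<mu>\<^sup>2 - (X j k)\<^sup>2))" for k
      by (simp add: u_def diff_divide_distrib algebra_simps power2_eq_square)
    then have "(\<Sum>k<n. X j k * u j k) = (\<Sum>k<n. \<mu> * X j k / (\<mu>\<^sup>2 - (X j k)\<^sup>2) * s k)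
        - s j * (\<Sum>k<n. (X j k)\<^sup>2 / (\<mu>\<^sup>2 - (X j k)\<^sup>2))"
      by (simp only: sum_subtractf sum_distrib_left)
    also have "\<dots> = s j" using ker[OF j] by (simp only: distrib_left)
    finally show ?thesis .
  qed
  have sw: "\<mu> * u i j = s j - X j i * u j i" if "i < n" "j < n" for i j
  proof -
    define q where "q = X i j"
    have q: "X i j = q" "X j i = q" using sym[OF that] by (simp_all add: q_def)
    have "\<mu>\<^sup>2 - q\<^sup>2 \<noteq> 0" using den[OF that] q by simp
    then show ?thesis by (simp add: u_def q field_simps power2_eq_square)
  qed
  have ev: "\<mu> * u i j = (\<Sum>k\<in>{..<n} - {i, j}. X j k * u j k)" if ij: "i < n" "j < n" for i j
  proof (cases "i = j")
    case True
    have "(\<Sum>k<n. X j k * u j k) = X j j * u j j + (\<Sum>k\<in>{..<n} - {j}. X j k * u j k)"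
      using ij by (intro sum.remove) auto
    then show ?thesis using su[OF ij(2)] sw[OF ij] diag[OF ij(2)] True by simp
  next
    case False
    have "(\<Sum>k<n. X j k * u j k) = X j j * u j j + (\<Sum>k\<in>{..<n} - {j}. X j k * u j k)"
      using ij by (intro sum.remove) auto
    also have "(\<Sum>k\<in>{..<n} - {j}. X j k * u j k) = X j i * u j i + (\<Sum>k\<in>{..<n} - {j} - {i}. X j k * u j k)"
      using ij False by (intro sum.remove) auto
    also have "{..<n} - {j} - {i} = {..<n} - {i, j}" by auto
    finally show ?thesis using su[OF ij(2)] sw[OF ij] diag[OF ij(2)] by simp
  qed
  have "\<exists>k<n. u i0 k \<noteq> 0"
  proof (rule ccontr)
    assume "\<not> (\<exists>k<n. u i0 k \<noteq> 0)"
    then have "(\<Sum>k<n. X i0 k * u i0 k) = 0" by simp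
    then show False using su[OF nz(1)] nz(2) by simp
  qed
  then obtain k where "k < n" "u i0 k \<noteq> 0" by blast
  then show ?thesis using eigenvalue_le_energy[of n \<mu> u X, OF ev nz(1)] by blast
qed

lemma ihara_bass_form_add:
  "ihara_bass_form n X \<mu> (\<lambda>i. v i + t * w i) z = ihara_bass_form n X \<mu> v z + t * ihara_bass_form n X \<mu> w z"
proof -
  have "(\<Sum>i<n. (v i + t * w i) * z i * A i) = (\<Sum>i<n. v i * z i * A i) + t * (\<Sum>i<n. w i * z i * A i)"
    for A :: "nat \<Rightarrow> real"
    by (simp add: algebra_simps sum.distrib sum_distrib_left)
  moreover have "(\<Sum>i<n. \<Sum>j<n. B i j * (v i + t * w i) * z j)
      = (\<Sum>i<n. \<Sum>j<n. B i j * v i * z j) + t * (\<Sum>i<n. \<Sum>j<n. B i j * w i * z j)"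
    for B :: "nat \<Rightarrow> nat \<Rightarrow> real"
    by (simp add: algebra_simps sum.distrib sum_distrib_left)
  ultimately show ?thesis unfolding ihara_bass_form_def by (simp only: right_diff_distrib)
qed

lemma ihara_bass_form_sym:
  assumes sym: "\<And>x y. x < n \<Longrightarrow> y < n \<Longrightarrow> X x y = X y x"
  shows "ihara_bass_form n X \<mu> v w = ihara_bass_form n X \<mu> w v"
proof -
  have "(\<Sum>i<n. \<Sum>j<n. \<mu> * X i j / (\<mu>\<^sup>2 - (X i j)\<^sup>2) * v i * w j)
      = (\<Sum>j<n. \<Sum>i<n. \<mu> * X i j / (\<mu>\<^sup>2 - (X i j)\<^sup>2) * v i * w j)" by (rule sum.swap)
  also have "\<dots> = (\<Sum>i<n. \<Sum>j<n. \<mu> * X i j / (\<mu>\<^sup>2 - (X i j)\<^sup>2) * w i * v j)"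
  proof (intro sum.cong refl)
    fix j i assume "j \<in> {..<n}" "i \<in> {..<n}"
    then have "X i j = X j i" using sym by auto
    then show "\<mu> * X i j / (\<mu>\<^sup>2 - (X i j)\<^sup>2) * v i * w j = \<mu> * X j i / (\<mu>\<^sup>2 - (X j i)\<^sup>2) * w j * v i"
      by simp
  qed
  finally show ?thesis by (simp add: ihara_bass_form_def mult.commute)
qed

lemma ihara_bass_form_scale: "ihara_bass_form n X \<mu> (\<lambda>i. t * v i) (\<lambda>i. t * w i) = t\<^sup>2 * ihara_bass_form n X \<mu> v w"
  unfolding ihara_bass_form_def right_diff_distrib sum_distrib_left
  by (simp add: power2_eq_square mult_ac)

lemma ihara_bass_form_cong:
  assumes "\<And>i. i < n \<Longrightarrow> v i = v' i" "\<And>i. i < n \<Longrightarrow> w i = w' i"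
  shows "ihara_bass_form n X \<mu> v w = ihara_bass_form n X \<mu> v' w'"
  unfolding ihara_bass_form_def using assms by simp

lemma ihara_bass_form_unit:
  assumes "k < n"
  shows "ihara_bass_form n X \<mu> (\<lambda>i. of_bool (i = k)) w =
    w k * (1 + (\<Sum>j<n. (X k j)\<^sup>2 / (\<mu>\<^sup>2 - (X k j)\<^sup>2))) - (\<Sum>j<n. \<mu> * X k j / (\<mu>\<^sup>2 - (X k j)\<^sup>2) * w j)"
proof -
  have e: "(\<Sum>i<n. of_bool (i = k) * g i) = g k" for g :: "nat \<Rightarrow> real"
  proof -
    have "(\<Sum>i<n. of_bool (i = k) * g i) = (\<Sum>i<n. if i = k then g i else 0)"
      by (rule sum.cong) auto
    then show ?thesis using assms by simp
  qed
  have "(\<Sum>i<n. of_bool (i = k) * w i * (1 + (\<Sum>j<n. (X i j)\<^sup>2 / (\<mu>\<^sup>2 - (X i j)\<^sup>2))))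
    = w k * (1 + (\<Sum>j<n. (X k j)\<^sup>2 / (\<mu>\<^sup>2 - (X k j)\<^sup>2)))"
    using e[of "\<lambda>i. w i * (1 + (\<Sum>j<n. (X i j)\<^sup>2 / (\<mu>\<^sup>2 - (X i j)\<^sup>2)))"] by (simp only: mult.assoc)
  moreover have "(\<Sum>i<n. \<Sum>j<n. \<mu> * X i j / (\<mu>\<^sup>2 - (X i j)\<^sup>2) * of_bool (i = k) * w j)
     = (\<Sum>j<n. \<mu> * X k j / (\<mu>\<^sup>2 - (X k j)\<^sup>2) * w j)"
  proof -
    have "(\<Sum>i<n. \<Sum>j<n. \<mu> * X i j / (\<mu>\<^sup>2 - (X i j)\<^sup>2) * of_bool (i = k) * w j)
      = (\<Sum>i<n. of_bool (i = k) * (\<Sum>j<n. \<mu> * X i j / (\<mu>\<^sup>2 - (X i j)\<^sup>2) * w j))"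
      by (intro sum.cong) auto
    then show ?thesis using e by simp
  qed
  ultimately show ?thesis unfolding ihara_bass_form_def by simp
qed

lemma linear_term_zero:
  fixes b c :: real
  assumes "\<And>t. 0 \<le> 2 * t * b + t\<^sup>2 * c"
  shows "b = 0"
proof (rule ccontr)
  assume b: "b \<noteq> 0"
  define t where "t = - b / (\<bar>c\<bar> + 1)"
  have "t\<^sup>2 * c \<le> t\<^sup>2 * (\<bar>c\<bar> + 1)" by (intro mult_left_mono) auto
  also have "\<dots> = t * (t * (\<bar>c\<bar> + 1))" by (simp add: power2_eq_square)
  also have "t * (\<bar>c\<bar> + 1) = - b" by (simp add: t_def)
  finally have "0 \<le> t * b" using assms[of t] by linarith
  moreover have "t * b < 0" using b by (simp add: t_def divide_neg_pos flip: power2_eq_square)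
  ultimately show False by linarith
qed

lemma compact_Collect_continuous:
  fixes f :: "'a::topological_space \<Rightarrow> real"
  assumes "compact S" "continuous_on S f" "closed T"
  shows "compact {x \<in> S. f x \<in> T}"
proof -
  have "closedin (top_of_set S) (S \<inter> f -` T)"
    by (rule continuous_closedin_preimage[OF assms(2,3)])
  then have "compact (S \<inter> f -` T)" using closedin_compact assms(1) by blast
  then show ?thesis by (simp add: Int_def vimage_def)
qed

lemma compact_unit_box: "compact {w :: nat \<Rightarrow> real. \<forall>i. w i \<in> (if i < n then {-1..1} else {0})}"
proof -
  have "compactin (product_topology (\<lambda>i::nat. euclidean :: real topology) UNIV)
      (PiE UNIV (\<lambda>i. if i < n then {-1..1} else {0}))"
    unfolding compactin_PiE by auto
  then show ?thesis
    by (simp add: euclidean_product_topology PiE_UNIV_domain Pi_def)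
qed

text \<open>Above the spectral radius of the nonbacktracking operator the form is nonsingular, and for a large
  parameter it is positive, so by continuity it cannot change sign. In place of eigenvalues the proof
  takes the largest parameter \<open>\<mu>\<close> for which the form is not positive on the unit sphere. There the
  form is nonnegative with a nontrivial zero, and this zero is a kernel vector.\<close>

lemma ihara_bass_form_nonneg:
  assumes sym: "\<And>x y. x < n \<Longrightarrow> y < n \<Longrightarrow> X x y = X y x"
    and diag: "\<And>x. x < n \<Longrightarrow> X x x = 0"
    and bd: "\<And>x y. x < n \<Longrightarrow> y < n \<Longrightarrow> \<bar>X x y\<bar> \<le> 1"
    and lam1: "lam > 1" and F: "path_energy n X l < lam ^ (2 * l)"
  shows "0 \<le> ihara_bass_form n X lam v v"
proof (rule ccontr)
  assume neg: "\<not> 0 \<le> ihara_bass_form n X lam v v"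
  define q where "q \<mu> w = ihara_bass_form n X \<mu> w w" for \<mu> w
  define sq where "sq w = (\<Sum>i<n. (w i :: real)\<^sup>2)" for w
  \<comment> \<open>Beyond this parameter the off-diagonal coefficients are below 1 / n, so that the form is positive.\<close>
  define \<Lambda> where "\<Lambda> = max lam (2 * n + 2)"
  define Box where "Box = {w :: nat \<Rightarrow> real. \<forall>i. w i \<in> (if i < n then {-1..1} else {0})}"
  define K where "K = {p \<in> {p \<in> {lam..\<Lambda>} \<times> Box. sq (snd p) \<in> {1}}. q (fst p) (snd p) \<in> {..0}}"
  have X2: "(X i j)\<^sup>2 \<le> 1" if "i < n" "j < n" for i j
    using bd[OF that] by (simp add: abs_square_le_1)
  have mu2: "\<mu>\<^sup>2 > 1" if "\<mu> \<ge> lam" for \<mu>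
    using that lam1 by (simp add: one_less_power)
  have den: "\<mu>\<^sup>2 - (X i j)\<^sup>2 \<noteq> 0" if "\<mu> \<ge> lam" "i < n" "j < n" for \<mu> i j
    using X2[OF that(2,3)] mu2[OF that(1)] by linarith
  have cq: "continuous_on S (\<lambda>p. q (fst p) (snd p))" if "\<And>p. p \<in> S \<Longrightarrow> fst p \<ge> lam"
    for S :: "(real \<times> (nat \<Rightarrow> real)) set"
  proof -
    have co: "continuous_on S (\<lambda>p. snd p i)" for i
      by (rule continuous_on_product_then_coordinatewise[OF continuous_on_snd[OF continuous_on_id]])
    have ne: "(fst p)\<^sup>2 - (X i j)\<^sup>2 \<noteq> 0" if "p \<in> S" "i \<in> {..<n}" "j \<in> {..<n}" for p i j
      using den[of "fst p" i j] that \<open>\<And>p. p \<in> S \<Longrightarrow> fst p \<ge> lam\<close> by blast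
    show ?thesis unfolding q_def ihara_bass_form_def
      by (intro ne co continuous_intros ballI)
  qed
  have box: "compact ({lam..\<Lambda>} \<times> Box)"
    unfolding Box_def by (intro compact_Times compact_unit_box) auto
  have sqc: "continuous_on S (\<lambda>p. sq (snd p))" for S :: "(real \<times> (nat \<Rightarrow> real)) set"
  proof -
    have co: "continuous_on S (\<lambda>p. snd p i)" for i
      by (rule continuous_on_product_then_coordinatewise[OF continuous_on_snd[OF continuous_on_id]])
    show ?thesis unfolding sq_def by (intro co continuous_intros)
  qed
  have "compact K" unfolding K_def
    by (intro compact_Collect_continuous box sqc cq) auto
  have sq0: "w i = 0" if "sq w = 0" "i < n" for w i
    using that by (simp add: sq_def sum_nonneg_eq_0_iff)
  have q0: "q \<mu> w = 0" if "sq w = 0" for \<mu> w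
    unfolding q_def ihara_bass_form_def using sq0[OF that] by simp
  have norm: "\<exists>w'\<in>Box. sq w' = 1 \<and> (\<forall>\<mu>. q \<mu> w = sq w * q \<mu> w')" if "sq w \<noteq> 0" for w
  proof -
    have s: "sq w > 0" using that by (simp add: sq_def order_less_le sum_nonneg)
    define w' where "w' i = (if i < n then w i / sqrt (sq w) else 0)" for i
    have a: "sq w' = 1"
    proof -
      have "sq w' = (\<Sum>i<n. (w i)\<^sup>2 / sq w)"
        unfolding sq_def[of w'] using s by (intro sum.cong) (auto simp: w'_def power_divide)
      also have "\<dots> = 1" using s by (simp add: sq_def flip: sum_divide_distrib)
      finally show ?thesis .
    qed
    have "(w' i)\<^sup>2 \<le> 1" if "i < n" for i
      using member_le_sum[of i "{..<n}" "\<lambda>i. (w' i)\<^sup>2"] that a by (simp add: sq_def)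
    then have "\<bar>w' i\<bar> \<le> 1" if "i < n" for i using that by (simp only: abs_square_le_1)
    then have "w' i \<in> {-1..1}" if "i < n" for i
      using that by (fastforce simp only: abs_le_iff atLeastAtMost_iff minus_le_iff)
    moreover have "w' i = 0" if "\<not> i < n" for i using that by (simp add: w'_def)
    ultimately have b: "w' \<in> Box" by (simp add: Box_def)
    have "q \<mu> w = sq w * q \<mu> w'" for \<mu>
    proof -
      have "q \<mu> w = q \<mu> (\<lambda>i. sqrt (sq w) * w' i)"
        unfolding q_def using s by (intro ihara_bass_form_cong) (auto simp: w'_def)
      also have "\<dots> = sq w * q \<mu> w'" unfolding q_def ihara_bass_form_scale using s by simp
      finally show ?thesis .
    qed
    then show ?thesis using a b by blast
  qed
  have Lpos: "q \<Lambda> w > 0" if w: "sq w = 1" for w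
  proof -
    have L: "\<Lambda> \<ge> lam" "\<Lambda> \<ge> 2 * n + 2" "\<Lambda> \<ge> 2" by (auto simp: \<Lambda>_def)
    have coef: "\<bar>\<Lambda> * X i j / (\<Lambda>\<^sup>2 - (X i j)\<^sup>2)\<bar> \<le> 1 / (n + 1)" if "i < n" "j < n" for i j
    proof -
      have L2: "2 * \<Lambda> \<le> \<Lambda>\<^sup>2" using L by (simp add: power2_eq_square)
      then have d: "\<Lambda>\<^sup>2 / 2 \<le> \<Lambda>\<^sup>2 - (X i j)\<^sup>2" using X2[OF that] L by linarith
      have "\<bar>\<Lambda> * X i j\<bar> \<le> \<Lambda> * 1" unfolding abs_mult using bd[OF that] L by (intro mult_mono) auto
      then have "\<bar>\<Lambda> * X i j\<bar> / (\<Lambda>\<^sup>2 - (X i j)\<^sup>2) \<le> \<Lambda> / (\<Lambda>\<^sup>2 / 2)"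
        using d L by (intro frac_le) auto
      also have "\<dots> = 2 / \<Lambda>" using L by (simp add: power2_eq_square)
      also have "\<dots> \<le> 2 / (2 * n + 2)" using L by (intro divide_left_mono) auto
      also have "\<dots> = 1 / (n + 1)" by (simp add: field_simps)
      finally have "\<bar>\<Lambda> * X i j\<bar> / (\<Lambda>\<^sup>2 - (X i j)\<^sup>2) \<le> 1 / (n + 1)" .
      moreover have "\<bar>\<Lambda>\<^sup>2 - (X i j)\<^sup>2\<bar> = \<Lambda>\<^sup>2 - (X i j)\<^sup>2"
        using X2[OF that] mu2[OF L(1)] by simp
      ultimately show ?thesis by (simp only: abs_divide)
    qed
    have "(\<Sum>i<n. \<Sum>j<n. \<Lambda> * X i j / (\<Lambda>\<^sup>2 - (X i j)\<^sup>2) * w i * w j)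
       \<le> (\<Sum>i<n. \<Sum>j<n. 1 / (n + 1) * (((w i)\<^sup>2 + (w j)\<^sup>2) / 2))"
    proof (intro sum_mono)
      fix i j assume ij: "i \<in> {..<n}" "j \<in> {..<n}"
      have "\<Lambda> * X i j / (\<Lambda>\<^sup>2 - (X i j)\<^sup>2) * w i * w j \<le> \<bar>\<Lambda> * X i j / (\<Lambda>\<^sup>2 - (X i j)\<^sup>2)\<bar> * \<bar>w i * w j\<bar>"
        by (metis abs_ge_self abs_mult mult.assoc)
      also have "\<dots> \<le> 1 / (n + 1) * (((w i)\<^sup>2 + (w j)\<^sup>2) / 2)"
      proof (intro mult_mono)
        have "0 \<le> (\<bar>w i\<bar> - \<bar>w j\<bar>)\<^sup>2" by simp
        then show "\<bar>w i * w j\<bar> \<le> ((w i)\<^sup>2 + (w j)\<^sup>2) / 2"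
          by (simp add: power2_diff abs_mult)
      qed (use coef ij in auto)
      finally show "\<Lambda> * X i j / (\<Lambda>\<^sup>2 - (X i j)\<^sup>2) * w i * w j \<le> 1 / (n + 1) * (((w i)\<^sup>2 + (w j)\<^sup>2) / 2)" .
    qed
    also have "\<dots> = 1 / (n + 1) * ((\<Sum>i<n. \<Sum>j<n. (w i)\<^sup>2) + (\<Sum>i<n. \<Sum>j<n. (w j)\<^sup>2)) / 2"
      by (simp only: sum_distrib_left[symmetric] sum.distrib[symmetric] sum_divide_distrib[symmetric] times_divide_eq_right)
    also have "(\<Sum>i<n. \<Sum>j<n. (w i)\<^sup>2) = n" using w by (simp add: sq_def flip: sum_distrib_left)
    also have "(\<Sum>i<n. \<Sum>j<n. (w j)\<^sup>2) = n" using w by (simp add: sq_def)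
    also have "1 / real (n + 1) * (real n + real n) / 2 < 1" by (simp add: field_simps)
    finally have off: "(\<Sum>i<n. \<Sum>j<n. \<Lambda> * X i j / (\<Lambda>\<^sup>2 - (X i j)\<^sup>2) * w i * w j) < 1" .
    have "1 \<le> (\<Sum>i<n. w i * w i * (1 + (\<Sum>j<n. (X i j)\<^sup>2 / (\<Lambda>\<^sup>2 - (X i j)\<^sup>2))))"
    proof -
      have "(\<Sum>i<n. w i * w i * 1) \<le> (\<Sum>i<n. w i * w i * (1 + (\<Sum>j<n. (X i j)\<^sup>2 / (\<Lambda>\<^sup>2 - (X i j)\<^sup>2))))"
      proof (intro sum_mono mult_left_mono)
        fix i assume "i \<in> {..<n}"
        then have "(X i j)\<^sup>2 \<le> \<Lambda>\<^sup>2" if "j < n" for j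
          using X2[of i j] that mu2[OF L(1)] by simp
        then have "(\<Sum>j<n. (X i j)\<^sup>2 / (\<Lambda>\<^sup>2 - (X i j)\<^sup>2)) \<ge> 0"
          by (intro sum_nonneg divide_nonneg_nonneg) auto
        then show "1 \<le> 1 + (\<Sum>j<n. (X i j)\<^sup>2 / (\<Lambda>\<^sup>2 - (X i j)\<^sup>2))" by simp
      qed auto
      then show ?thesis using w by (simp add: sq_def power2_eq_square)
    qed
    then show ?thesis using off unfolding q_def ihara_bass_form_def by linarith
  qed
  have "K \<noteq> {}"
  proof -
    have "q lam v < 0" using neg by (simp add: q_def)
    then have "sq v \<noteq> 0" using q0 by force
    then obtain w where w: "w \<in> Box" "sq w = 1" "q lam v = sq v * q lam w" using norm by blast
    have "sq v \<ge> 0" by (simp add: sq_def sum_nonneg)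
    then have "q lam w \<le> 0" using w(3) \<open>q lam v < 0\<close> by (smt (verit) mult_nonneg_nonneg)
    then have "(lam, w) \<in> K" using w by (auto simp: K_def \<Lambda>_def)
    then show ?thesis by blast
  qed
  then obtain p where p: "p \<in> K" "\<And>p'. p' \<in> K \<Longrightarrow> fst p' \<le> fst p"
    using continuous_attains_sup[OF \<open>compact K\<close>, of fst] continuous_on_fst[OF continuous_on_id]
    by (metis continuous_on_fst continuous_on_id')
  \<comment> \<open>The largest parameter with a nonpositive value, and a unit vector that attains this value.\<close>
  obtain \<mu> s where ps: "p = (\<mu>, s)" by fastforce
  have mu: "lam \<le> \<mu>" "\<mu> \<le> \<Lambda>" "sq s = 1" "q \<mu> s \<le> 0" using p(1) by (auto simp: ps K_def)
  have qpos1: "q \<mu> w \<ge> 0" if w: "w \<in> Box" "sq w = 1" for w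
  proof (rule ccontr)
    assume "\<not> q \<mu> w \<ge> 0"
    have "continuous_on {\<mu>..\<Lambda>} (\<lambda>\<nu>. q \<nu> w)"
      unfolding q_def ihara_bass_form_def using den mu by (intro continuous_intros) auto
    then obtain \<nu> where nu: "\<mu> \<le> \<nu>" "\<nu> \<le> \<Lambda>" "q \<nu> w = 0"
      using IVT'[of "\<lambda>\<nu>. q \<nu> w" \<mu> 0 \<Lambda>] Lpos[OF w(2)] mu(2) \<open>\<not> q \<mu> w \<ge> 0\<close> by auto
    then have "(\<nu>, w) \<in> K" using w mu(1) by (auto simp: K_def)
    then have "\<nu> \<le> \<mu>" using p(2) ps by fastforce
    then show False using nu \<open>\<not> q \<mu> w \<ge> 0\<close> by simp
  qed
  have qpos: "q \<mu> w \<ge> 0" for w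
  proof (cases "sq w = 0")
    case False
    then obtain w' where w': "w' \<in> Box" "sq w' = 1" "q \<mu> w = sq w * q \<mu> w'" using norm by blast
    have "sq w \<ge> 0" by (simp add: sq_def sum_nonneg)
    then show ?thesis using w' qpos1 by simp
  qed (simp add: q0)
  have qs: "q \<mu> s = 0" using mu(4) qpos[of s] by linarith
  have "\<exists>i0<n. s i0 \<noteq> 0"
  proof (rule ccontr)
    assume "\<not> (\<exists>i0<n. s i0 \<noteq> 0)"
    then have "sq s = 0" by (simp add: sq_def)
    then show False using mu(3) by simp
  qed
  then obtain i0 where i0: "i0 < n" "s i0 \<noteq> 0" by blast
  have "s i * (1 + (\<Sum>j<n. (X i j)\<^sup>2 / (\<mu>\<^sup>2 - (X i j)\<^sup>2))) = (\<Sum>j<n. \<mu> * X i j / (\<mu>\<^sup>2 - (X i j)\<^sup>2) * s j)"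
    if i: "i < n" for i
  proof -
    define e where "e = (\<lambda>k. of_bool (k = i) :: real)"
    have fsym: "ihara_bass_form n X \<mu> v w = ihara_bass_form n X \<mu> w v" for v w
      by (rule ihara_bass_form_sym) (rule sym)
    have "0 \<le> 2 * t * ihara_bass_form n X \<mu> e s + t\<^sup>2 * q \<mu> e" for t
    proof -
      have "q \<mu> (\<lambda>k. s k + t * e k) = ihara_bass_form n X \<mu> s (\<lambda>k. s k + t * e k) + t * ihara_bass_form n X \<mu> e (\<lambda>k. s k + t * e k)"
        unfolding q_def by (rule ihara_bass_form_add)
      also have "ihara_bass_form n X \<mu> s (\<lambda>k. s k + t * e k) = q \<mu> s + t * ihara_bass_form n X \<mu> e s"
        by (simp only: q_def fsym[of s "\<lambda>k. s k + t * e k"] ihara_bass_form_add)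
      also have "ihara_bass_form n X \<mu> e (\<lambda>k. s k + t * e k) = ihara_bass_form n X \<mu> e s + t * q \<mu> e"
        by (simp only: q_def fsym[of e "\<lambda>k. s k + t * e k"] fsym[of e s] ihara_bass_form_add)
      finally have "q \<mu> (\<lambda>k. s k + t * e k) = 2 * t * ihara_bass_form n X \<mu> e s + t\<^sup>2 * q \<mu> e"
        using qs by (simp add: algebra_simps power2_eq_square)
      then show ?thesis using qpos by metis
    qed
    then have "ihara_bass_form n X \<mu> e s = 0" by (rule linear_term_zero)
    then show ?thesis unfolding e_def ihara_bass_form_unit[OF i] by simp
  qed
  then have "\<mu> ^ (2 * l) \<le> path_energy n X l"
    using ihara_bass_kernel[of n X \<mu> s i0 l, OF sym diag bd _ _ i0] mu(1) lam1 by simp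
  moreover have "lam ^ (2 * l) \<le> \<mu> ^ (2 * l)" using mu(1) lam1 by (intro power_mono) auto
  ultimately show False using F by linarith
qed

text \<open>Nonnegativity of the Ihara-Bass form bounds the form with coefficients
  \<open>lam * X / (lam\<^sup>2 - X\<^sup>2)\<close>, which is \<open>X / lam\<close> up to a cubic term. With \<open>b\<close> at least both the
  largest row norm and the root of the energy, the diagonal terms are at most two, and the cubic
  remainder contributes at most one because the entries are bounded by one.\<close>

lemma quadratic_form_le:
  assumes sym: "\<And>x y. x < n \<Longrightarrow> y < n \<Longrightarrow> X x y = X y x"
    and diag: "\<And>x. x < n \<Longrightarrow> X x x = 0"
    and bd: "\<And>x y. x < n \<Longrightarrow> y < n \<Longrightarrow> \<bar>X x y\<bar> \<le> 1"
    and b: "b \<ge> 1" and row: "\<And>x. x < n \<Longrightarrow> (\<Sum>y<n. (X x y)\<^sup>2) \<le> b\<^sup>2"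
    and F: "path_energy n X l < b ^ (2 * l)"
  shows "(\<Sum>i<n. \<Sum>j<n. X i j * v i * v j) \<le> (2 * b + 3) * (\<Sum>i<n. (v i)\<^sup>2)"
proof -
  \<comment> \<open>This choice makes all denominators at least the square of b.\<close>
  define lam where "lam = sqrt (b\<^sup>2 + 1)"
  have l2: "lam\<^sup>2 = b\<^sup>2 + 1" by (simp add: lam_def)
  have lb: "b \<le> lam" unfolding lam_def using b by (intro real_le_rsqrt) auto
  have l1: "lam > 1" unfolding lam_def using b by simp
  have lb1: "lam \<le> b + 1" unfolding lam_def using b by (intro real_le_lsqrt) (auto simp: power2_sum)
  have X2: "(X i j)\<^sup>2 \<le> 1" if "i < n" "j < n" for i j
    using bd[OF that] by (simp add: abs_square_le_1)
  have den: "b\<^sup>2 \<le> lam\<^sup>2 - (X i j)\<^sup>2" if "i < n" "j < n" for i j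
    using X2[OF that] l2 by linarith
  have b2: "b\<^sup>2 > 0" using b by simp
  have dpos: "(X i j)\<^sup>2 < lam\<^sup>2" if "i < n" "j < n" for i j
    using den[OF that] b2 by linarith
  have "b ^ (2 * l) \<le> lam ^ (2 * l)" using lb b by (intro power_mono) auto
  then have "path_energy n X l < lam ^ (2 * l)" using F by linarith
  then have Q: "0 \<le> ihara_bass_form n X lam v v"
    using ihara_bass_form_nonneg[of n X lam l v, OF sym diag bd l1] by blast
  define V where "V = (\<Sum>i<n. (v i)\<^sup>2)"
  have "(\<Sum>i<n. v i * v i * (1 + (\<Sum>j<n. (X i j)\<^sup>2 / (lam\<^sup>2 - (X i j)\<^sup>2)))) \<le> (\<Sum>i<n. v i * v i * 2)"
  proof (intro sum_mono mult_left_mono)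
    fix i assume i: "i \<in> {..<n}"
    have "(\<Sum>j<n. (X i j)\<^sup>2 / (lam\<^sup>2 - (X i j)\<^sup>2)) \<le> (\<Sum>j<n. (X i j)\<^sup>2 / b\<^sup>2)"
      using den i b2 dpos by (intro sum_mono divide_left_mono) (auto intro!: mult_pos_pos)
    also have "\<dots> = (\<Sum>j<n. (X i j)\<^sup>2) / b\<^sup>2" by (simp add: sum_divide_distrib)
    also have "\<dots> \<le> 1" using row[of i] i b2 by simp
    finally show "1 + (\<Sum>j<n. (X i j)\<^sup>2 / (lam\<^sup>2 - (X i j)\<^sup>2)) \<le> 2" by simp
  qed simp
  then have main: "(\<Sum>i<n. \<Sum>j<n. lam * X i j / (lam\<^sup>2 - (X i j)\<^sup>2) * v i * v j) \<le> 2 * V"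
    using Q unfolding ihara_bass_form_def V_def by (simp add: sum_distrib_left power2_eq_square mult.commute)
  have rest: "(\<Sum>i<n. \<Sum>j<n. - ((X i j)^3 / (lam\<^sup>2 - (X i j)\<^sup>2)) * v i * v j) \<le> V"
  proof -
    have "(\<Sum>i<n. \<Sum>j<n. - ((X i j)^3 / (lam\<^sup>2 - (X i j)\<^sup>2)) * v i * v j)
      \<le> (\<Sum>i<n. \<Sum>j<n. (X i j)\<^sup>2 / b\<^sup>2 * (((v i)\<^sup>2 + (v j)\<^sup>2) / 2))"
    proof (intro sum_mono)
      fix i j assume ij: "i \<in> {..<n}" "j \<in> {..<n}"
      have "- ((X i j)^3 / (lam\<^sup>2 - (X i j)\<^sup>2)) * v i * v j \<le> \<bar>(X i j)^3 / (lam\<^sup>2 - (X i j)\<^sup>2)\<bar> * \<bar>v i * v j\<bar>"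
        by (metis abs_ge_self abs_minus_cancel abs_mult mult.assoc)
      also have "\<dots> \<le> (X i j)\<^sup>2 / b\<^sup>2 * (((v i)\<^sup>2 + (v j)\<^sup>2) / 2)"
      proof (intro mult_mono)
        have "\<bar>X i j\<bar> ^ 3 \<le> \<bar>X i j\<bar> ^ 2" using bd ij by (intro power_decreasing) auto
        then have "\<bar>X i j\<bar> ^ 3 / (lam\<^sup>2 - (X i j)\<^sup>2) \<le> (X i j)\<^sup>2 / b\<^sup>2"
          using den ij b2 by (intro frac_le) auto
        moreover have "lam\<^sup>2 - (X i j)\<^sup>2 > 0" using dpos[of i j] ij by simp
        ultimately show "\<bar>(X i j)^3 / (lam\<^sup>2 - (X i j)\<^sup>2)\<bar> \<le> (X i j)\<^sup>2 / b\<^sup>2"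
          by (simp add: abs_divide power_abs)
        have "0 \<le> (\<bar>v i\<bar> - \<bar>v j\<bar>)\<^sup>2" by simp
        then show "\<bar>v i * v j\<bar> \<le> ((v i)\<^sup>2 + (v j)\<^sup>2) / 2"
          by (simp add: power2_diff abs_mult)
      qed auto
      finally show "- ((X i j)^3 / (lam\<^sup>2 - (X i j)\<^sup>2)) * v i * v j \<le> (X i j)\<^sup>2 / b\<^sup>2 * (((v i)\<^sup>2 + (v j)\<^sup>2) / 2)" .
    qed
    also have "\<dots> = (\<Sum>i<n. \<Sum>j<n. (X i j)\<^sup>2 / b\<^sup>2 * (v i)\<^sup>2 / 2) + (\<Sum>i<n. \<Sum>j<n. (X i j)\<^sup>2 / b\<^sup>2 * (v j)\<^sup>2 / 2)"
      by (simp add: sum.distrib[symmetric] distrib_left add_divide_distrib)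
    also have "(\<Sum>i<n. \<Sum>j<n. (X i j)\<^sup>2 / b\<^sup>2 * (v j)\<^sup>2 / 2) = (\<Sum>j<n. \<Sum>i<n. (X i j)\<^sup>2 / b\<^sup>2 * (v j)\<^sup>2 / 2)"
      by (rule sum.swap)
    also have "\<dots> = (\<Sum>i<n. \<Sum>j<n. (X i j)\<^sup>2 / b\<^sup>2 * (v i)\<^sup>2 / 2)"
    proof (intro sum.cong refl)
      fix j i assume "j \<in> {..<n}" "i \<in> {..<n}"
      then have "X i j = X j i" using sym by auto
      then show "(X i j)\<^sup>2 / b\<^sup>2 * (v j)\<^sup>2 / 2 = (X j i)\<^sup>2 / b\<^sup>2 * (v j)\<^sup>2 / 2" by simp
    qed
    also have "(\<Sum>i<n. \<Sum>j<n. (X i j)\<^sup>2 / b\<^sup>2 * (v i)\<^sup>2 / 2) = (\<Sum>i<n. (\<Sum>j<n. (X i j)\<^sup>2) / b\<^sup>2 * ((v i)\<^sup>2 / 2))"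
      by (simp add: sum_distrib_right sum_divide_distrib)
    also have "\<dots> \<le> (\<Sum>i<n. 1 * ((v i)\<^sup>2 / 2))"
      using row b2 by (intro sum_mono mult_right_mono) auto
    also have "(\<Sum>i<n. 1 * ((v i)\<^sup>2 / 2)) = V / 2" by (simp add: V_def sum_divide_distrib)
    finally show ?thesis by simp
  qed
  have "(\<Sum>i<n. \<Sum>j<n. X i j * v i * v j)
    = (\<Sum>i<n. \<Sum>j<n. lam * (lam * X i j / (lam\<^sup>2 - (X i j)\<^sup>2) * v i * v j) + (- ((X i j)^3 / (lam\<^sup>2 - (X i j)\<^sup>2)) * v i * v j))"
  proof (intro sum.cong refl)
    fix i j assume ij: "i \<in> {..<n}" "j \<in> {..<n}"
    have d: "lam\<^sup>2 - (X i j)\<^sup>2 \<noteq> 0" using dpos[of i j] ij by simp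
    have "X i j = lam * (lam * X i j / (lam\<^sup>2 - (X i j)\<^sup>2)) + (- ((X i j)^3 / (lam\<^sup>2 - (X i j)\<^sup>2)))"
    proof -
      define d where "d = lam\<^sup>2 - (X i j)\<^sup>2"
      have "X i j * d = lam * (lam * X i j) - (X i j)^3"
        by (simp add: d_def algebra_simps power2_eq_square power3_eq_cube)
      then have "X i j = (lam * (lam * X i j) - (X i j)^3) / d" using d by (simp add: d_def field_simps)
      then show ?thesis by (simp add: diff_divide_distrib flip: d_def)
    qed
    then have "X i j * (v i * v j) = (lam * (lam * X i j / (lam\<^sup>2 - (X i j)\<^sup>2)) + (- ((X i j)^3 / (lam\<^sup>2 - (X i j)\<^sup>2)))) * (v i * v j)"
      by (rule arg_cong)
    then show "X i j * v i * v j = lam * (lam * X i j / (lam\<^sup>2 - (X i j)\<^sup>2) * v i * v j) + (- ((X i j)^3 / (lam\<^sup>2 - (X i j)\<^sup>2)) * v i * v j)"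
      by (simp only: distrib_right mult.assoc)
  qed
  also have "\<dots> = lam * (\<Sum>i<n. \<Sum>j<n. lam * X i j / (lam\<^sup>2 - (X i j)\<^sup>2) * v i * v j)
      + (\<Sum>i<n. \<Sum>j<n. - ((X i j)^3 / (lam\<^sup>2 - (X i j)\<^sup>2)) * v i * v j)"
    by (simp only: sum.distrib sum_distrib_left)
  also have "\<dots> \<le> lam * (2 * V) + V" using main rest l1 by (intro add_mono mult_left_mono) auto
  also have "\<dots> = (2 * lam + 1) * V" by (simp add: algebra_simps)
  also have "\<dots> \<le> (2 * b + 3) * V" using lb1 by (intro mult_right_mono) (auto simp: V_def sum_nonneg)
  finally show ?thesis by (simp add: V_def)
qed

lemma path_energy_uminus: "path_energy n (\<lambda>i j. - X i j) l = path_energy n X l"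
proof -
  have "path_kernel n (\<lambda>i j. - X i j) t a x b z = (-1) ^ t * path_kernel n X t a x b z" for t a x b z
  proof (induction t arbitrary: a x)
    case (Suc t)
    then show ?case by (simp add: sum_distrib_left sum_negf mult_ac)
  qed simp
  then show ?thesis by (simp add: path_energy_def power_mult_distrib flip: power_mult)
qed

text \<open>Changing the sign of the matrix changes neither the row norms nor the energy.\<close>

lemma abs_quadratic_form_le:
  assumes sym: "\<And>x y. x < n \<Longrightarrow> y < n \<Longrightarrow> X x y = X y x"
    and diag: "\<And>x. x < n \<Longrightarrow> X x x = 0"
    and bd: "\<And>x y. x < n \<Longrightarrow> y < n \<Longrightarrow> \<bar>X x y\<bar> \<le> 1"
    and b: "b \<ge> 1" and row: "\<And>x. x < n \<Longrightarrow> (\<Sum>y<n. (X x y)\<^sup>2) \<le> b\<^sup>2"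
    and F: "path_energy n X l < b ^ (2 * l)"
  shows "\<bar>\<Sum>i<n. \<Sum>j<n. X i j * v i * v j\<bar> \<le> (2 * b + 3) * (\<Sum>i<n. (v i)\<^sup>2)"
proof -
  have "(\<Sum>i<n. \<Sum>j<n. X i j * v i * v j) \<le> (2 * b + 3) * (\<Sum>i<n. (v i)\<^sup>2)"
    by (rule quadratic_form_le) (use assms in auto)
  moreover have "(\<Sum>i<n. \<Sum>j<n. - X i j * v i * v j) \<le> (2 * b + 3) * (\<Sum>i<n. (v i)\<^sup>2)"
  proof (rule quadratic_form_le[where X = "\<lambda>i j. - X i j" and l = l])
    show "path_energy n (\<lambda>i j. - X i j) l < b ^ (2 * l)" using F by (simp add: path_energy_uminus)
  qed (use assms in auto)
  moreover have "(\<Sum>i<n. \<Sum>j<n. - X i j * v i * v j) = - (\<Sum>i<n. \<Sum>j<n. X i j * v i * v j)"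
    by (simp add: sum_negf)
  ultimately show ?thesis by linarith
qed

section \<open>Expectations over finitely supported distributions\<close>

lemma expectation_mono_finite:
  fixes f g :: "'a \<Rightarrow> real"
  assumes "finite (set_pmf P)" "\<And>\<omega>. \<omega> \<in> set_pmf P \<Longrightarrow> f \<omega> \<le> g \<omega>"
  shows "measure_pmf.expectation P f \<le> measure_pmf.expectation P g"
  using assms by (intro integral_mono_AE integrable_measure_pmf_finite AE_pmfI)

lemma expectation_prod_Pi_pmf_signed:
  fixes f :: "'a \<Rightarrow> 'b \<Rightarrow> real"
  assumes A: "finite A" "\<And>x. x \<in> A \<Longrightarrow> finite (set_pmf (P x))"
  shows "measure_pmf.expectation (Pi_pmf A dflt P) (\<lambda>y. \<Prod>x\<in>A. f x (y x)) =
    (\<Prod>x\<in>A. measure_pmf.expectation (P x) (f x))"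
proof -
  let ?Q = "Pi_pmf A dflt P"
  have fin: "finite (set_pmf ?Q)"
    using A by (subst set_Pi_pmf) (auto intro!: finite_PiE_dflt)
  have "prob_space.indep_vars ?Q (\<lambda>_. borel) (\<lambda>x y. f x (y x)) A"
    by (rule prob_space.indep_vars_compose2[OF measure_pmf.prob_space_axioms indep_vars_Pi_pmf]) (use A in auto)
  then have "measure_pmf.expectation ?Q (\<lambda>y. \<Prod>x\<in>A. f x (y x))
      = (\<Prod>x\<in>A. measure_pmf.expectation ?Q (\<lambda>y. f x (y x)))"
    by (intro prob_space.indep_vars_lebesgue_integral[OF measure_pmf.prob_space_axioms] A integrable_measure_pmf_finite fin)
  also have "\<dots> = (\<Prod>x\<in>A. measure_pmf.expectation (P x) (f x))"
  proof (rule prod.cong)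
    fix x assume "x \<in> A"
    then have "P x = map_pmf (\<lambda>y. y x) ?Q" using A by (simp add: Pi_pmf_component)
    then have "measure_pmf.expectation (P x) (f x) = measure_pmf.expectation (map_pmf (\<lambda>y. y x) ?Q) (f x)"
      by (rule arg_cong)
    then show "measure_pmf.expectation ?Q (\<lambda>y. f x (y x)) = measure_pmf.expectation (P x) (f x)"
      by (simp del: Pi_pmf_component)
  qed simp
  finally show ?thesis .
qed

lemma expectation_walk_sum:
  assumes fin: "finite (set_pmf P)"
  shows "measure_pmf.expectation P (\<lambda>\<omega>. walk_sum n t a x c (f \<omega>))
    = walk_sum n t a x c (\<lambda>b z c'. measure_pmf.expectation P (\<lambda>\<omega>. f \<omega> b z c'))"
proof (induction t arbitrary: a x c)
  case 0
  show ?case by (simp only: walk_sum.simps(1))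
next
  case (Suc t)
  have "measure_pmf.expectation P (\<lambda>\<omega>. walk_sum n (Suc t) a x c (f \<omega>))
    = (\<Sum>y\<in>{..<n} - {a, x}. measure_pmf.expectation P (\<lambda>\<omega>. walk_sum n t x y (traverse c x y) (f \<omega>)))"
    unfolding walk_sum.simps
    by (rule Bochner_Integration.integral_sum) (rule integrable_measure_pmf_finite[OF fin])
  also have "\<dots> = walk_sum n (Suc t) a x c (\<lambda>b z c'. measure_pmf.expectation P (\<lambda>\<omega>. f \<omega> b z c'))"
    by (simp only: Suc.IH walk_sum.simps(2))
  finally show ?case .
qed

section \<open>The operator norm of a symmetric matrix\<close>

text \<open>Polarisation: for a unit vector \<open>u\<close> in the direction of the image of \<open>x\<close>, the norm of the image is
  a quarter of the difference of the quadratic form at \<open>x + u\<close> and at \<open>x - u\<close>.\<close>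

lemma op_norm_mat_le:
  assumes sym: "\<And>x y. x < n \<Longrightarrow> y < n \<Longrightarrow> X x y = X y x"
    and c: "c \<ge> 0"
    and quad: "\<And>v. \<bar>\<Sum>i<n. \<Sum>j<n. X i j * v i * v j\<bar> \<le> c * (\<Sum>i<n. (v i)\<^sup>2)"
  shows "op_norm (mat n n (\<lambda>(i, j). X i j)) \<le> c"
proof -
  let ?A = "mat n n (\<lambda>(i, j). X i j)"
  have L: "vec_norm2 (mult_mat_vec ?A v) \<le> c" if v: "v \<in> carrier_vec n" "vec_norm2 v \<le> 1" for v
  proof -
    define x where "x i = vec_index v i" for i
    define w where "w i = (\<Sum>j<n. X i j * x j)" for i
    have vn: "vec_norm2 v = sqrt (\<Sum>i<n. (x i)\<^sup>2)"
      using v(1) by (auto simp: vec_norm2_def L2_set_def x_def)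
    have "vec_index (mult_mat_vec ?A v) i = w i" if "i < n" for i
      using that v(1) by (auto simp: w_def x_def scalar_prod_def atLeast0LessThan)
    then have mn: "vec_norm2 (mult_mat_vec ?A v) = sqrt (\<Sum>i<n. (w i)\<^sup>2)"
      by (simp add: vec_norm2_def L2_set_def)
    define N where "N = sqrt (\<Sum>i<n. (w i)\<^sup>2)"
    have N2: "N\<^sup>2 = (\<Sum>i<n. (w i)\<^sup>2)" by (simp add: N_def sum_nonneg)
    have x1: "(\<Sum>i<n. (x i)\<^sup>2) \<le> 1" using v(2) vn by (simp add: sum_nonneg)
    show ?thesis
    proof (cases "N = 0")
      case True
      then show ?thesis using c by (simp add: mn N_def[symmetric])
    next
      case False
      define u where "u i = w i / N" for i
      have u1: "(\<Sum>i<n. (u i)\<^sup>2) = 1"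
      proof -
        have "(\<Sum>i<n. (u i)\<^sup>2) = (\<Sum>i<n. (w i)\<^sup>2) / N\<^sup>2"
          by (simp add: u_def power_divide sum_divide_distrib)
        also have "\<dots> = 1" unfolding N2[symmetric] using False by simp
        finally show ?thesis .
      qed
      have uw: "(\<Sum>i<n. \<Sum>j<n. X i j * u i * x j) = N"
      proof -
        have "(\<Sum>i<n. \<Sum>j<n. X i j * u i * x j) = (\<Sum>i<n. u i * w i)"
          by (simp add: w_def sum_distrib_left mult_ac)
        also have "\<dots> = (\<Sum>i<n. (w i)\<^sup>2) / N" by (simp add: u_def power2_eq_square sum_divide_distrib)
        also have "\<dots> = N" unfolding N2[symmetric] using False by (simp add: power2_eq_square)
        finally show ?thesis .
      qed
      have xu: "(\<Sum>i<n. \<Sum>j<n. X i j * x i * u j) = N"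
      proof -
        have "(\<Sum>i<n. \<Sum>j<n. X i j * x i * u j) = (\<Sum>j<n. \<Sum>i<n. X i j * x i * u j)" by (rule sum.swap)
        also have "\<dots> = (\<Sum>i<n. \<Sum>j<n. X i j * u i * x j)"
        proof (intro sum.cong refl)
          fix j i assume "j \<in> {..<n}" "i \<in> {..<n}"
          then have "X i j = X j i" using sym by auto
          then show "X i j * x i * u j = X j i * u j * x i" by simp
        qed
        finally show ?thesis using uw by simp
      qed
      have "(\<Sum>i<n. \<Sum>j<n. X i j * (x i + u i) * (x j + u j)) - (\<Sum>i<n. \<Sum>j<n. X i j * (x i - u i) * (x j - u j))
        = (\<Sum>i<n. \<Sum>j<n. 2 * (X i j * u i * x j) + 2 * (X i j * x i * u j))"
        unfolding sum_subtractf[symmetric] by (intro sum.cong refl) (simp add: algebra_simps)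
      also have "\<dots> = 4 * N" by (simp only: sum.distrib sum_distrib_left[symmetric] uw xu)
      finally have "4 * N \<le> c * (\<Sum>i<n. (x i + u i)\<^sup>2) + c * (\<Sum>i<n. (x i - u i)\<^sup>2)"
        using quad[of "\<lambda>i. x i + u i"] quad[of "\<lambda>i. x i - u i"] by linarith
      also have "\<dots> = c * (\<Sum>i<n. 2 * (x i)\<^sup>2 + 2 * (u i)\<^sup>2)"
        unfolding distrib_left[symmetric] sum.distrib[symmetric]
        by (intro arg_cong[of _ _ "(*) c"] sum.cong refl) (simp add: power2_sum power2_diff)
      also have "\<dots> = c * (2 * (\<Sum>i<n. (x i)\<^sup>2) + 2)" by (simp add: sum.distrib u1 flip: sum_distrib_left)
      also have "\<dots> \<le> c * (2 * 1 + 2)" using x1 c by (intro mult_left_mono add_mono) auto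
      finally show ?thesis by (simp add: mn N_def[symmetric])
    qed
  qed
  show ?thesis unfolding op_norm_def
  proof (rule cSup_least)
    have "vec_norm2 (0\<^sub>v n) \<le> 1" by (simp add: vec_norm2_def L2_set_def)
    then show "{vec_norm2 (mult_mat_vec ?A v) |v. v \<in> carrier_vec (dim_col ?A) \<and> vec_norm2 v \<le> 1} \<noteq> {}"
      using zero_carrier_vec[of n] by (auto intro!: exI[of _ "0\<^sub>v n"])
  qed (use L in auto)
qed

lemma op_norm_mat_le_dim:
  assumes sym: "\<And>x y. x < n \<Longrightarrow> y < n \<Longrightarrow> X x y = X y x"
    and bd: "\<And>x y. x < n \<Longrightarrow> y < n \<Longrightarrow> \<bar>X x y\<bar> \<le> 1"
  shows "op_norm (mat n n (\<lambda>(i, j). X i j)) \<le> n"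
proof (rule op_norm_mat_le)
  fix v :: "nat \<Rightarrow> real"
  have "\<bar>\<Sum>i<n. \<Sum>j<n. X i j * v i * v j\<bar> \<le> (\<Sum>i<n. \<Sum>j<n. \<bar>X i j * v i * v j\<bar>)"
    by (intro order_trans[OF sum_abs] sum_mono sum_abs)
  also have "\<dots> \<le> (\<Sum>i<n. \<Sum>j<n. ((v i)\<^sup>2 + (v j)\<^sup>2) / 2)"
  proof (intro sum_mono)
    fix i j assume ij: "i \<in> {..<n}" "j \<in> {..<n}"
    have "\<bar>X i j * v i * v j\<bar> = \<bar>X i j\<bar> * \<bar>v i * v j\<bar>" by (simp add: abs_mult)
    also have "\<dots> \<le> 1 * \<bar>v i * v j\<bar>" using bd ij by (intro mult_right_mono) auto
    also have "\<dots> \<le> ((v i)\<^sup>2 + (v j)\<^sup>2) / 2"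
    proof -
      have "0 \<le> (\<bar>v i\<bar> - \<bar>v j\<bar>)\<^sup>2" by simp
      then show ?thesis by (simp add: power2_diff abs_mult)
    qed
    finally show "\<bar>X i j * v i * v j\<bar> \<le> ((v i)\<^sup>2 + (v j)\<^sup>2) / 2" .
  qed
  also have "\<dots> = ((\<Sum>i<n. \<Sum>j<n. (v i)\<^sup>2) + (\<Sum>i<n. \<Sum>j<n. (v j)\<^sup>2)) / 2"
    by (simp only: sum.distrib[symmetric] sum_divide_distrib[symmetric])
  also have "\<dots> = n * (\<Sum>i<n. (v i)\<^sup>2)" by (simp flip: sum_distrib_left)
  finally show "\<bar>\<Sum>i<n. \<Sum>j<n. X i j * v i * v j\<bar> \<le> real n * (\<Sum>i<n. (v i)\<^sup>2)" .
qed (use sym in auto)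

section \<open>The centred adjacency matrix\<close>

text \<open>The graph is handled through the indicators of its edges, indexed by increasing pairs.\<close>

definition edge_model :: "nat \<Rightarrow> (nat \<Rightarrow> nat \<Rightarrow> real) \<Rightarrow> (nat \<times> nat \<Rightarrow> bool) pmf" where
  "edge_model n p = Pi_pmf (edges n) False (\<lambda>(i, j). bernoulli_pmf (p i j))"

definition centred :: "(nat \<Rightarrow> nat \<Rightarrow> real) \<Rightarrow> (nat \<times> nat \<Rightarrow> bool) \<Rightarrow> nat \<Rightarrow> nat \<Rightarrow> real" where
  "centred p \<omega> i j = (if i = j then 0 else of_bool (\<omega> (edge i j)) - p i j)"

lemma finite_edge_model [simp]: "finite (set_pmf (edge_model n p))"
  unfolding edge_model_def by (subst set_Pi_pmf) (auto intro!: finite_PiE_dflt)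

lemma expectation_bernoulli:
  fixes f :: "bool \<Rightarrow> real"
  assumes "0 \<le> q" "q \<le> 1"
  shows "measure_pmf.expectation (bernoulli_pmf q) f = q * f True + (1 - q) * f False"
  using assms by (subst integral_measure_pmf[of UNIV]) (auto simp: UNIV_bool)

lemma edge_probsD:
  assumes "edge_probs n p" "i < n" "j < n"
  shows "0 \<le> p i j" "p i j \<le> 1" "p j i = p i j" "p i i = 0"
  using assms by (auto simp: edge_probs_def)

lemma centred_sym: "edge_probs n p \<Longrightarrow> i < n \<Longrightarrow> j < n \<Longrightarrow> centred p \<omega> i j = centred p \<omega> j i"
  by (simp add: centred_def edge_probsD(3)[of n p i j] edge_commute)

lemma abs_centred_le: "edge_probs n p \<Longrightarrow> i < n \<Longrightarrow> j < n \<Longrightarrow> \<bar>centred p \<omega> i j\<bar> \<le> 1"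
  using edge_probsD[of n p i j] by (auto simp: centred_def)

lemma expectation_edge_model_prod:
  assumes "edge_probs n p"
  shows "measure_pmf.expectation (edge_model n p) (\<lambda>\<omega>. \<Prod>e\<in>edges n. f e (\<omega> e)) =
    (\<Prod>e\<in>edges n. p (fst e) (snd e) * f e True + (1 - p (fst e) (snd e)) * f e False)"
proof -
  have "measure_pmf.expectation (edge_model n p) (\<lambda>\<omega>. \<Prod>e\<in>edges n. f e (\<omega> e))
    = (\<Prod>e\<in>edges n. measure_pmf.expectation ((\<lambda>(i, j). bernoulli_pmf (p i j)) e) (f e))"
    unfolding edge_model_def by (intro expectation_prod_Pi_pmf_signed) auto
  also have "\<dots> = (\<Prod>e\<in>edges n. p (fst e) (snd e) * f e True + (1 - p (fst e) (snd e)) * f e False)"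
    using edge_probsD[OF assms] by (intro prod.cong refl) (auto simp: expectation_bernoulli edges_def)
  finally show ?thesis .
qed

lemma expected_deviation_eq:
  assumes p: "edge_probs n p"
  shows "expected_deviation n p =
    measure_pmf.expectation (edge_model n p) (\<lambda>\<omega>. op_norm (mat n n (\<lambda>(i, j). centred p \<omega> i j)))"
proof -
  define G where "G \<omega> = {{i, j} | i j. i < j \<and> j < n \<and> \<omega> (i, j)}" for \<omega> :: "nat \<times> nat \<Rightarrow> bool"
  have er: "erdos_renyi n p = map_pmf G (edge_model n p)"
    unfolding erdos_renyi_def edge_model_def edges_def G_def ..
  have mem0: "{i, j} \<in> G \<omega> \<longleftrightarrow> \<omega> (i, j)" if "i < j" "j < n" for i j \<omega>
  proof
    assume "{i, j} \<in> G \<omega>"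
    then obtain a b where ab: "{i, j} = {a, b}" "a < b" "\<omega> (a, b)" by (auto simp: G_def)
    then have "a = i \<and> b = j" using that by (auto simp: doubleton_eq_iff)
    then show "\<omega> (i, j)" using ab by simp
  qed (use that in \<open>auto simp: G_def\<close>)
  have mem: "{i, j} \<in> G \<omega> \<longleftrightarrow> i \<noteq> j \<and> \<omega> (edge i j)" if "i < n" "j < n" for i j \<omega>
  proof (cases i j rule: linorder_cases)
    case less
    then show ?thesis using that mem0[of i j] by (simp add: edge_def)
  next
    case equal
    then show ?thesis by (auto simp: G_def doubleton_eq_iff)
  next
    case greater
    then show ?thesis using that mem0[of j i] by (simp add: edge_def insert_commute)
  qed
  have mean: "measure_pmf.expectation (edge_model n p) (\<lambda>\<omega>. of_bool ({i, j} \<in> G \<omega>)) = p i j"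
    if ij: "i < n" "j < n" for i j
  proof (cases "i = j")
    case True
    then show ?thesis using edge_probsD(4)[OF p ij] mem[OF ij] by simp
  next
    case False
    have e: "edge i j \<in> edges n" using ij False by (rule edge_in_edges)
    have "map_pmf (\<lambda>\<omega>. \<omega> (edge i j)) (edge_model n p) = (\<lambda>(i, j). bernoulli_pmf (p i j)) (edge i j)"
      unfolding edge_model_def using e by (subst Pi_pmf_component) auto
    also have "\<dots> = bernoulli_pmf (p i j)"
      using edge_probsD(3)[OF p ij] by (simp add: edge_def min_def max_def)
    finally have "measure_pmf.expectation (map_pmf (\<lambda>\<omega>. \<omega> (edge i j)) (edge_model n p)) (of_bool :: bool \<Rightarrow> real)
        = measure_pmf.expectation (bernoulli_pmf (p i j)) of_bool" by simp
    then show ?thesis using False mem[OF ij] edge_probsD[OF p ij]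
      by (simp add: expectation_bernoulli)
  qed
  have "adj_matrix n (G \<omega>) - mean_adj_matrix n p = mat n n (\<lambda>(i, j). centred p \<omega> i j)" for \<omega>
  proof (rule eq_matI)
    fix i j assume "i < dim_row (mat n n (\<lambda>(i, j). centred p \<omega> i j))" "j < dim_col (mat n n (\<lambda>(i, j). centred p \<omega> i j))"
    then have ij: "i < n" "j < n" by auto
    then show "(adj_matrix n (G \<omega>) - mean_adj_matrix n p) $$ (i, j) = mat n n (\<lambda>(i, j). centred p \<omega> i j) $$ (i, j)"
      using mean[OF ij] mem[OF ij] edge_probsD(4)[OF p ij]
      by (auto simp: adj_matrix_def mean_adj_matrix_def er centred_def)
  qed (auto simp: adj_matrix_def mean_adj_matrix_def)
  then show ?thesis unfolding expected_deviation_def er by simp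
qed

lemma expected_deviation_le_dim:
  assumes p: "edge_probs n p"
  shows "expected_deviation n p \<le> n"
proof -
  have "expected_deviation n p \<le> measure_pmf.expectation (edge_model n p) (\<lambda>_. real n)"
    unfolding expected_deviation_eq[OF p]
    by (intro expectation_mono_finite finite_edge_model op_norm_mat_le_dim)
       (use centred_sym[OF p] abs_centred_le[OF p] in auto)
  then show ?thesis by simp
qed

lemma abs_central_moment_le:
  fixes q :: real
  assumes q: "0 \<le> q" "q \<le> 1" and k: "k \<ge> 2"
  shows "\<bar>q * (1 - q) ^ k + (1 - q) * (- q) ^ k\<bar> \<le> q"
proof -
  have "\<bar>q * (1 - q) ^ k + (1 - q) * (- q) ^ k\<bar> \<le> \<bar>q * (1 - q) ^ k\<bar> + \<bar>(1 - q) * (- q) ^ k\<bar>"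
    by (rule abs_triangle_ineq)
  also have "\<dots> = q * (1 - q) ^ k + (1 - q) * q ^ k" using q by (simp add: abs_mult power_abs)
  also have "\<dots> \<le> q * (1 - q) ^ 1 + (1 - q) * q ^ 2"
    using q k by (intro add_mono mult_left_mono power_decreasing) auto
  also have "\<dots> = q * (1 - q ^ 2)" by (simp add: algebra_simps power2_eq_square)
  also have "\<dots> \<le> q * 1" using q by (intro mult_left_mono) auto
  finally show ?thesis by simp
qed

context walk_weights begin

text \<open>By independence the moment factors over the edges; a factor with exponent one vanishes.\<close>

lemma expectation_monomial_le:
  assumes p: "edge_probs n p"
  shows "measure_pmf.expectation (edge_model n p) (\<lambda>\<omega>. monomial n (centred p \<omega>) c) \<le> cover_weight c"
proof -
  let ?m = "\<lambda>e. prob_of e * (1 - prob_of e) ^ c e + (1 - prob_of e) * (- prob_of e) ^ c e"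
  have "monomial n (centred p \<omega>) c = (\<Prod>e\<in>edges n. (of_bool (\<omega> e) - prob_of e) ^ c e)" for \<omega>
    unfolding monomial_def by (intro prod.cong refl) (auto simp: centred_def edges_def edge_def prob_of_def)
  then have E: "measure_pmf.expectation (edge_model n p) (\<lambda>\<omega>. monomial n (centred p \<omega>) c) = (\<Prod>e\<in>edges n. ?m e)"
    using expectation_edge_model_prod[OF p, of "\<lambda>e b. (of_bool b - prob_of e) ^ c e"] by (simp add: prob_of_def)
  have q: "0 \<le> prob_of e \<and> prob_of e \<le> 1" if "e \<in> edges n" for e
    using that edge_probsD[OF p, of "fst e" "snd e"] by (auto simp: edges_def prob_of_def)
  show ?thesis
  proof (cases "\<exists>e\<in>edges n. c e = 1")
    case True
    then obtain e where "e \<in> edges n" "c e = 1" by blast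
    then have "e \<in> edges n" "?m e = 0" by (simp_all add: algebra_simps)
    then have "\<exists>e\<in>edges n. ?m e = 0" by blast
    then have z: "(\<Prod>e\<in>edges n. ?m e) = 0" by (intro prod_zero finite_edges)
    show ?thesis unfolding E z cover_weight_def using True by simp
  next
    case False
    have "(\<Prod>e\<in>edges n. ?m e) \<le> \<bar>\<Prod>e\<in>edges n. ?m e\<bar>" by (rule abs_ge_self)
    also have "\<dots> = (\<Prod>e\<in>edges n. \<bar>?m e\<bar>)" by (rule abs_prod)
    also have "\<dots> \<le> (\<Prod>e\<in>edges n. if c e = 0 then 1 else prob_of e)"
    proof (intro prod_mono conjI)
      fix e assume e: "e \<in> edges n"
      show "\<bar>?m e\<bar> \<le> (if c e = 0 then 1 else prob_of e)"
      proof (cases "c e = 0")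
        case False
        then have "c e \<ge> 2" using \<open>\<not> (\<exists>e\<in>edges n. c e = 1)\<close> e by (cases "c e"; cases "c e - 1") auto
        then show ?thesis using abs_central_moment_le[of "prob_of e" "c e"] q[OF e] by simp
      qed simp
    qed simp
    finally show ?thesis using E False by (simp add: cover_weight_def)
  qed
qed

text \<open>The condition that both walks end with the same directed edge is dropped, since all weights are
  nonnegative once the moments have been bounded.\<close>

lemma expectation_path_energy_le:
  assumes p: "edge_probs n p"
  shows "measure_pmf.expectation (edge_model n p) (\<lambda>\<omega>. path_energy n (centred p \<omega>) l)
    \<le> n ^ 2 * D ^ l * (128 * exp 4 * real l ^ 4 * r ^ 3)"
proof -
  let ?E = "measure_pmf.expectation (edge_model n p)"
  note fin = finite_edge_model[of n p]
  have one: "?E (\<lambda>\<omega>. walk_sum n l a x (\<lambda>_. 0) (\<lambda>b z c. walk_sum n l a x c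
       (\<lambda>b' z' c'. monomial n (centred p \<omega>) c' * of_bool (b' = b \<and> z' = z))))
     \<le> D ^ l * (128 * exp 4 * real l ^ 4 * r ^ 3)" if ax: "x < n" for a x
  proof -
    have "?E (\<lambda>\<omega>. walk_sum n l a x (\<lambda>_. 0) (\<lambda>b z c. walk_sum n l a x c
       (\<lambda>b' z' c'. monomial n (centred p \<omega>) c' * of_bool (b' = b \<and> z' = z))))
      = walk_sum n l a x (\<lambda>_. 0) (\<lambda>b z c. walk_sum n l a x c
       (\<lambda>b' z' c'. ?E (\<lambda>\<omega>. monomial n (centred p \<omega>) c' * of_bool (b' = b \<and> z' = z))))"
      by (simp only: expectation_walk_sum[OF fin])
    also have "\<dots> \<le> walk_sum n l a x (\<lambda>_. 0) (\<lambda>b z c. walk_sum n l a x c (\<lambda>b' z' c'. D ^ l * weight c'))"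
    proof (rule walk_sum_mono[OF ax], rule walk_sum_mono[OF ax])
      fix b z c b' z' and c' :: "nat \<times> nat \<Rightarrow> nat"
      assume "steps n c = steps n (\<lambda>_. 0) + l" "steps n c' = steps n c + l"
      then have t: "steps n c' = 2 * l" by (simp add: steps_def)
      have "?E (\<lambda>\<omega>. monomial n (centred p \<omega>) c') \<le> D ^ l * weight c'"
        using expectation_monomial_le[OF p, of c'] cover_weight_le[OF t] by linarith
      moreover have "0 \<le> D ^ l * weight c'" using D_ge weight_nonneg by simp
      ultimately show "?E (\<lambda>\<omega>. monomial n (centred p \<omega>) c' * of_bool (b' = b \<and> z' = z)) \<le> D ^ l * weight c'"
        by (cases "b' = b \<and> z' = z") auto
    qed
    also have "\<dots> = D ^ l * walk_sum n l a x (\<lambda>_. 0) (\<lambda>b z c. walk_sum n l a x c (\<lambda>b' z' c'. weight c'))"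
    proof -
      have s: "walk_sum n t a x c (\<lambda>b z c'. k * f b z c') = k * walk_sum n t a x c f" for t a x c f and k :: real
        by (induction t arbitrary: a x c) (auto simp: sum_distrib_left)
      show ?thesis by (simp only: s)
    qed
    also have "\<dots> \<le> D ^ l * (128 * exp 4 * real l ^ 4 * r ^ 3)"
      using double_walk_sum_le[OF ax] D_ge by (intro mult_left_mono) auto
    finally show ?thesis .
  qed
  have pw: "path_energy n (centred p \<omega>) l = (\<Sum>a<n. \<Sum>x<n. walk_sum n l a x (\<lambda>_. 0)
      (\<lambda>b z c. walk_sum n l a x c (\<lambda>b' z' c'. monomial n (centred p \<omega>) c' * of_bool (b' = b \<and> z' = z))))"
    for \<omega>
    by (rule path_energy_eq_walk_sum) (rule centred_sym[OF p])
  have "?E (\<lambda>\<omega>. path_energy n (centred p \<omega>) l)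
    = ?E (\<lambda>\<omega>. \<Sum>a<n. \<Sum>x<n. walk_sum n l a x (\<lambda>_. 0) (\<lambda>b z c. walk_sum n l a x c
       (\<lambda>b' z' c'. monomial n (centred p \<omega>) c' * of_bool (b' = b \<and> z' = z))))"
    by (simp only: pw)
  also have "\<dots> = (\<Sum>a<n. \<Sum>x<n. ?E (\<lambda>\<omega>. walk_sum n l a x (\<lambda>_. 0) (\<lambda>b z c. walk_sum n l a x c
       (\<lambda>b' z' c'. monomial n (centred p \<omega>) c' * of_bool (b' = b \<and> z' = z)))))"
    by (simp only: Bochner_Integration.integral_sum integrable_measure_pmf_finite[OF fin])
  also have "\<dots> \<le> (\<Sum>a<n. \<Sum>x<n. D ^ l * (128 * exp 4 * real l ^ 4 * r ^ 3))"
    by (intro sum_mono one) auto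
  also have "\<dots> = n ^ 2 * D ^ l * (128 * exp 4 * real l ^ 4 * r ^ 3)"
    by (simp add: power2_eq_square)
  finally show ?thesis .
qed

end

section \<open>The row norms and the expected deviation\<close>

lemma exp_mult_le_chord:
  fixes \<theta> u :: real
  assumes "0 \<le> u" "u \<le> 1"
  shows "exp (\<theta> * u) \<le> 1 + u * (exp \<theta> - 1)"
proof -
  have "exp ((1 - u) *\<^sub>R 0 + u *\<^sub>R \<theta>) \<le> (1 - u) * exp 0 + u * exp \<theta>"
    by (rule convex_onD[OF exp_convex assms]) auto
  then show ?thesis by (simp add: algebra_simps)
qed

text \<open>A square of a centred indicator lies between zero and one and has mean at most the probability, so
  replacing the exponential by its chord bounds each factor.\<close>

lemma expectation_exp_row_le:
  assumes p: "edge_probs n p" and i: "i < n" and row: "(\<Sum>j<n. p i j) \<le> d" and th: "\<theta> \<ge> 0"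
  shows "measure_pmf.expectation (edge_model n p) (\<lambda>\<omega>. exp (\<theta> * (\<Sum>j<n. (centred p \<omega> i j)\<^sup>2)))
    \<le> exp (d * (exp \<theta> - 1))"
proof -
  define S where "S = edge i ` ({..<n} - {i})"
  have inj: "inj_on (edge i) ({..<n} - {i})" by (auto simp: inj_on_def edge_eq_iff)
  have S: "S \<subseteq> edges n" using i by (auto simp: S_def intro: edge_in_edges)
  define g where "g e b = (if e \<in> S then exp (\<theta> * (of_bool b - p (fst e) (snd e))\<^sup>2) else 1)" for e b
  have prob_of: "p (fst (edge i j)) (snd (edge i j)) = p i j" if "j < n" for j
    using edge_probsD(3)[OF p i that] by (simp add: edge_def min_def max_def)
  have prodS: "(\<Prod>e\<in>edges n. if e \<in> S then h e else 1) = (\<Prod>j\<in>{..<n} - {i}. h (edge i j))" for h :: "_ \<Rightarrow> real"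
  proof -
    have "(\<Prod>e\<in>edges n. if e \<in> S then h e else 1) = (\<Prod>e\<in>S. h e)"
      using S by (subst prod.inter_restrict[symmetric]) (auto simp: Int_absorb1)
    then show ?thesis unfolding S_def using inj by (simp add: prod.reindex)
  qed
  have rw: "exp (\<theta> * (\<Sum>j<n. (centred p \<omega> i j)\<^sup>2)) = (\<Prod>e\<in>edges n. g e (\<omega> e))" for \<omega>
  proof -
    have "(\<Sum>j<n. (centred p \<omega> i j)\<^sup>2) = (\<Sum>j\<in>{..<n} - {i}. (centred p \<omega> i j)\<^sup>2)"
      using i by (subst sum.remove[of _ i]) (auto simp: centred_def)
    also have "\<dots> = (\<Sum>j\<in>{..<n} - {i}. (of_bool (\<omega> (edge i j)) - p (fst (edge i j)) (snd (edge i j)))\<^sup>2)"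
      by (rule sum.cong) (auto simp: centred_def prob_of)
    finally show ?thesis unfolding g_def prodS by (simp add: sum_distrib_left exp_sum)
  qed
  have m: "q * exp (\<theta> * (1 - q)\<^sup>2) + (1 - q) * exp (\<theta> * q\<^sup>2) \<le> exp (q * (exp \<theta> - 1))"
    if q: "0 \<le> q" "q \<le> 1" for q :: real
  proof -
    have "q * exp (\<theta> * (1 - q)\<^sup>2) + (1 - q) * exp (\<theta> * q\<^sup>2)
      \<le> q * (1 + (1 - q)\<^sup>2 * (exp \<theta> - 1)) + (1 - q) * (1 + q\<^sup>2 * (exp \<theta> - 1))"
      using q by (intro add_mono mult_left_mono exp_mult_le_chord) (auto simp: power_le_one)
    also have "\<dots> = 1 + (q - q\<^sup>2) * (exp \<theta> - 1)" by (simp add: algebra_simps power2_eq_square)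
    also have "\<dots> \<le> 1 + q * (exp \<theta> - 1)" using th by (intro add_left_mono mult_right_mono) auto
    also have "\<dots> \<le> exp (q * (exp \<theta> - 1))" by (rule exp_ge_add_one_self)
    finally show ?thesis .
  qed
  have "measure_pmf.expectation (edge_model n p) (\<lambda>\<omega>. exp (\<theta> * (\<Sum>j<n. (centred p \<omega> i j)\<^sup>2)))
    = (\<Prod>e\<in>edges n. p (fst e) (snd e) * g e True + (1 - p (fst e) (snd e)) * g e False)"
    unfolding rw by (rule expectation_edge_model_prod[OF p])
  also have "\<dots> = (\<Prod>e\<in>edges n. if e \<in> S then p (fst e) (snd e) * exp (\<theta> * (1 - p (fst e) (snd e))\<^sup>2)
       + (1 - p (fst e) (snd e)) * exp (\<theta> * (p (fst e) (snd e))\<^sup>2) else 1)"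
    by (rule prod.cong) (auto simp: g_def)
  also have "\<dots> = (\<Prod>j\<in>{..<n} - {i}. p i j * exp (\<theta> * (1 - p i j)\<^sup>2) + (1 - p i j) * exp (\<theta> * (p i j)\<^sup>2))"
    unfolding prodS by (rule prod.cong) (auto simp: prob_of)
  also have "\<dots> \<le> (\<Prod>j\<in>{..<n} - {i}. exp (p i j * (exp \<theta> - 1)))"
    using edge_probsD(1,2)[OF p i] m by (intro prod_mono) auto
  also have "\<dots> = exp ((\<Sum>j\<in>{..<n} - {i}. p i j) * (exp \<theta> - 1))"
    by (simp add: exp_sum sum_distrib_right)
  also have "\<dots> \<le> exp (d * (exp \<theta> - 1))"
  proof -
    have "(\<Sum>j\<in>{..<n} - {i}. p i j) \<le> (\<Sum>j<n. p i j)"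
      using edge_probsD(1)[OF p i] by (intro sum_mono2) auto
    then show ?thesis using row th by (simp add: mult_right_mono)
  qed
  finally show ?thesis .
qed

text \<open>On the event that the energy is below \<open>((1 + \<epsilon>) * sqrt D) ^ (2 * l)\<close>, the
  Ihara-Bass bound applies with \<open>b\<close> equal to \<open>1 + \<epsilon>\<close> times a bound \<open>sqrt Z\<close> for the row norms; otherwise the norm is at most \<open>n\<close>, and Markov's
  inequality makes this contribution at most one. The bound \<open>Z\<close> is the logarithm of a sum of
  exponentials of the squared row norms, linearised by \<open>ln W \<le> W - 1\<close>.\<close>

lemma expected_deviation_le:
  fixes n l :: nat and d D \<delta> \<epsilon> \<theta> :: real
  assumes p: "edge_probs n p" and n: "n \<ge> 1" and row: "\<And>i. i < n \<Longrightarrow> (\<Sum>j<n. p i j) \<le> d"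
    and dD: "d \<le> D" and D: "D \<ge> 1" and l: "l \<ge> 1" and delta: "\<delta> \<ge> 0"
    and p_le: "\<And>i j. i < n \<Longrightarrow> j < n \<Longrightarrow> p i j \<le> \<delta> * D"
    and small: "4 ^ 7 * real l ^ 9 * exp (4 * real l / sqrt D) ^ 2 * \<delta> \<le> 1"
    and th: "\<theta> > 0" and eps: "\<epsilon> \<ge> 0"
    and tail: "128 * exp 4 * real n ^ 3 * real l ^ 4 * exp (4 * real l / sqrt D) ^ 3 \<le> (1 + \<epsilon>) ^ (2 * l)"
  shows "expected_deviation n p
    \<le> 2 * (1 + \<epsilon>) * sqrt (D + (ln n + d * (exp \<theta> - 1 - \<theta>) + 1) / \<theta>) + 4"
proof -
  interpret walk_weights n l p D \<delta>
  proof
    show "(\<Sum>y<n. p x y) \<le> D" if "x < n" for x using row[OF that] dD by linarith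
  qed (use edge_probsD[OF p] D l delta p_le small in auto)
  let ?E = "measure_pmf.expectation (edge_model n p)"
  note int = integrable_measure_pmf_finite[OF finite_edge_model[of n p]]
  define A where "A \<omega> i = (\<Sum>j<n. (centred p \<omega> i j)\<^sup>2)" for \<omega> i
  define W where "W \<omega> = (\<Sum>i<n. exp (\<theta> * A \<omega> i) / exp (d * (exp \<theta> - 1))) / n" for \<omega>
  define s where "s = sqrt (D + (ln n + d * (exp \<theta> - 1 - \<theta>) + 1) / \<theta>)"
  define Z where "Z \<omega> = D + (ln n + d * (exp \<theta> - 1 - \<theta>) + W \<omega>) / \<theta>" for \<omega>
  define F where "F \<omega> = path_energy n (centred p \<omega>) l" for \<omega>
  define B where "B = ((1 + \<epsilon>) * sqrt D) ^ (2 * l)"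
  have d0: "d \<ge> 0"
  proof -
    have "0 \<le> (\<Sum>j<n. p 0 j)" using edge_probsD(1)[OF p] n by (intro sum_nonneg) auto
    then show ?thesis using row[of 0] n by simp
  qed
  have phi: "exp \<theta> - 1 - \<theta> \<ge> 0" using exp_ge_add_one_self[of \<theta>] by linarith
  have lnn: "ln (real n) \<ge> 0" using n by simp
  have W0: "W \<omega> > 0" for \<omega>
    unfolding W_def using n by (intro divide_pos_pos sum_pos) (auto simp: lessThan_empty_iff)
  have EW: "?E W \<le> 1"
  proof -
    have "?E W = (\<Sum>i<n. ?E (\<lambda>\<omega>. exp (\<theta> * A \<omega> i)) / exp (d * (exp \<theta> - 1))) / n"
      unfolding W_def by (simp add: Bochner_Integration.integral_sum int)
    also have "\<dots> \<le> (\<Sum>i<n. 1) / n"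
      using expectation_exp_row_le[OF p _ row, of _ \<theta>] th
      by (intro divide_right_mono sum_mono) (auto simp: A_def)
    finally show ?thesis using n by simp
  qed
  have DZ: "D \<le> Z \<omega>" for \<omega>
    unfolding Z_def using lnn d0 phi W0[of \<omega>] th by (auto intro!: divide_nonneg_pos add_nonneg_nonneg mult_nonneg_nonneg simp: less_imp_le)
  have AZ: "A \<omega> i \<le> Z \<omega>" if i: "i < n" for i \<omega>
  proof -
    have "exp (\<theta> * A \<omega> i) / exp (d * (exp \<theta> - 1)) \<le> (\<Sum>i<n. exp (\<theta> * A \<omega> i) / exp (d * (exp \<theta> - 1)))"
      using i by (intro member_le_sum) auto
    also have "\<dots> = n * W \<omega>" using n by (simp add: W_def)
    finally have "exp (\<theta> * A \<omega> i - d * (exp \<theta> - 1)) \<le> n * W \<omega>" by (simp add: exp_diff)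
    then have "ln (exp (\<theta> * A \<omega> i - d * (exp \<theta> - 1))) \<le> ln (n * W \<omega>)"
      using n W0[of \<omega>] by (subst ln_le_cancel_iff) auto
    also have "\<dots> = ln n + ln (W \<omega>)" using n W0[of \<omega>] by (simp add: ln_mult)
    also have "\<dots> \<le> ln n + W \<omega>" using ln_le_minus_one[OF W0[of \<omega>]] by simp
    finally have "\<theta> * A \<omega> i \<le> \<theta> * d + (ln n + d * (exp \<theta> - 1 - \<theta>) + W \<omega>)"
      by (simp add: algebra_simps)
    then have "A \<omega> i \<le> d + (ln n + d * (exp \<theta> - 1 - \<theta>) + W \<omega>) / \<theta>"
      using th by (simp add: field_simps)
    then show ?thesis using dD by (simp add: Z_def)
  qed
  have F0: "F \<omega> \<ge> 0" for \<omega> by (simp add: F_def path_energy_def sum_nonneg)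
  have B0: "B > 0" using D eps by (simp add: B_def)
  have s1: "s \<ge> 1"
    unfolding s_def using lnn d0 phi D th
    by (auto intro!: add_increasing2 divide_nonneg_pos add_nonneg_nonneg mult_nonneg_nonneg)
  have s2: "s\<^sup>2 = D + (ln n + d * (exp \<theta> - 1 - \<theta>) + 1) / \<theta>"
  proof -
    have "D + (ln n + d * (exp \<theta> - 1 - \<theta>) + 1) / \<theta> \<ge> 0"
      using lnn d0 phi D th by (auto intro!: add_nonneg_nonneg divide_nonneg_pos mult_nonneg_nonneg)
    then show ?thesis by (simp add: s_def)
  qed
  have pointwise: "op_norm (mat n n (\<lambda>(i, j). centred p \<omega> i j))
      \<le> (1 + \<epsilon>) / s * Z \<omega> + ((1 + \<epsilon>) * s + 3) + n / B * F \<omega>" for \<omega>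
  proof -
    define b where "b = (1 + \<epsilon>) * sqrt (Z \<omega>)"
    have Z1: "1 \<le> sqrt (Z \<omega>)" using DZ[of \<omega>] D by simp
    have b1: "sqrt (Z \<omega>) \<le> b" using Z1 eps by (simp add: b_def algebra_simps)
    \<comment> \<open>The square root is replaced by a tangent, so that only the expectation of Z is needed.\<close>
    have two: "2 * sqrt (Z \<omega>) \<le> Z \<omega> / s + s"
    proof -
      have "0 \<le> (sqrt (Z \<omega>) - s)\<^sup>2" by simp
      then have "2 * sqrt (Z \<omega>) * s \<le> Z \<omega> + s * s"
        using Z1 by (simp add: power2_diff) (simp add: power2_eq_square)
      then show ?thesis using s1 by (simp add: field_simps)
    qed
    have b2: "2 * b + 3 \<le> (1 + \<epsilon>) / s * Z \<omega> + ((1 + \<epsilon>) * s + 3)"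
    proof -
      have "(1 + \<epsilon>) * (2 * sqrt (Z \<omega>)) \<le> (1 + \<epsilon>) * (Z \<omega> / s + s)"
        using two eps by (intro mult_left_mono) auto
      then show ?thesis by (simp add: b_def distrib_left)
    qed
    have b0: "2 * b + 3 \<ge> 0" using b1 Z1 by linarith
    show ?thesis
    proof (cases "F \<omega> < B")
      case True
      have "(1 + \<epsilon>) * sqrt D \<le> b" unfolding b_def using DZ[of \<omega>] eps by (intro mult_left_mono) auto
      then have "B \<le> b ^ (2 * l)" unfolding B_def using eps D by (intro power_mono) auto
      then have Fb: "path_energy n (centred p \<omega>) l < b ^ (2 * l)" using True by (simp add: F_def)
      have rowb: "(\<Sum>y<n. (centred p \<omega> x y)\<^sup>2) \<le> b\<^sup>2" if "x < n" for x
      proof -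
        have "Z \<omega> = (sqrt (Z \<omega>))\<^sup>2" using DZ[of \<omega>] D by simp
        also have "\<dots> \<le> b\<^sup>2" using b1 Z1 by (intro power_mono) auto
        finally show ?thesis using AZ[OF that, of \<omega>] by (simp add: A_def)
      qed
      have "op_norm (mat n n (\<lambda>(i, j). centred p \<omega> i j)) \<le> 2 * b + 3"
      proof (rule op_norm_mat_le)
        fix v :: "nat \<Rightarrow> real"
        show "\<bar>\<Sum>i<n. \<Sum>j<n. centred p \<omega> i j * v i * v j\<bar> \<le> (2 * b + 3) * (\<Sum>i<n. (v i)\<^sup>2)"
        proof (rule abs_quadratic_form_le[where l = l])
          show "1 \<le> b" using b1 Z1 by linarith
        qed (use centred_sym[OF p] abs_centred_le[OF p] rowb Fb in \<open>auto simp: centred_def[of _ _ x x for x]\<close>)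
      qed (use centred_sym[OF p] b0 in auto)
      moreover have "0 \<le> n / B * F \<omega>" using B0 F0[of \<omega>] by simp
      ultimately show ?thesis using b2 by linarith
    next
      case False
      have "real n * 1 \<le> real n * (F \<omega> / B)"
        using False B0 by (intro mult_left_mono) auto
      then have "real n \<le> n / B * F \<omega>" by simp
      moreover have "op_norm (mat n n (\<lambda>(i, j). centred p \<omega> i j)) \<le> n"
        by (rule op_norm_mat_le_dim) (use centred_sym[OF p] abs_centred_le[OF p] in auto)
      ultimately show ?thesis using b2 b0 by linarith
    qed
  qed
  have EZ: "?E Z \<le> s\<^sup>2"
  proof -
    have "?E Z = D + (ln n + d * (exp \<theta> - 1 - \<theta>) + ?E W) / \<theta>"
      unfolding Z_def by (simp add: int)
    also have "\<dots> \<le> s\<^sup>2" unfolding s2 using EW th by (intro add_left_mono divide_right_mono) auto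
    finally show ?thesis .
  qed
  have EF: "n / B * ?E F \<le> 1"
  proof -
    define K where "K = 128 * exp 4 * real l ^ 4 * r ^ 3"
    have Bl: "B = (1 + \<epsilon>) ^ (2 * l) * D ^ l"
      using D by (simp add: B_def power_mult_distrib power_mult)
    have "n / B * ?E F \<le> n / B * (n ^ 2 * D ^ l * K)"
      unfolding F_def K_def using expectation_path_energy_le[OF p] B0 by (intro mult_left_mono) auto
    also have "\<dots> = (n ^ 3 * K) / (1 + \<epsilon>) ^ (2 * l)"
      using D by (simp add: Bl power2_eq_square power3_eq_cube)
    also have "\<dots> \<le> 1"
      using tail eps by (simp add: K_def r_def mult_ac)
    finally show ?thesis .
  qed
  have "expected_deviation n p \<le> ?E (\<lambda>\<omega>. (1 + \<epsilon>) / s * Z \<omega> + ((1 + \<epsilon>) * s + 3) + n / B * F \<omega>)"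
    unfolding expected_deviation_eq[OF p] by (intro expectation_mono_finite finite_edge_model pointwise)
  also have "\<dots> = (1 + \<epsilon>) / s * ?E Z + ((1 + \<epsilon>) * s + 3) + n / B * ?E F"
    by (simp add: int)
  also have "\<dots> \<le> (1 + \<epsilon>) / s * s\<^sup>2 + ((1 + \<epsilon>) * s + 3) + 1"
    using EZ EF eps s1 by (intro add_mono mult_left_mono) auto
  also have "\<dots> = 2 * (1 + \<epsilon>) * s + 4"
  proof -
    have "(1 + \<epsilon>) / s * s\<^sup>2 = (1 + \<epsilon>) * s" using s1 by (simp add: power2_eq_square)
    then show ?thesis by (simp add: algebra_simps)
  qed
  finally show ?thesis by (simp add: s_def)
qed

section \<open>Choice of the parameters\<close>

lemma power_le_exp:
  fixes c K :: real
  assumes c: "c > 0" and K: "K \<ge> 0"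
  shows "\<exists>y0\<ge>0. \<forall>y\<ge>y0. K * y ^ m \<le> exp (c * y)"
proof -
  define L where "L = K * fact m / (c / 2) ^ m"
  have L: "L \<ge> 0" using K c by (simp add: L_def)
  have "K * y ^ m \<le> exp (c * y)" if y: "y \<ge> 2 * L / c" for y
  proof -
    have y0: "y \<ge> 0" using order_trans[OF _ y, of 0] L c by simp
    have "(c / 2 * y) ^ m / fact m \<le> exp (c / 2 * y)"
    proof -
      define f where "f k = (c / 2 * y) ^ k /\<^sub>R fact k" for k
      have sums: "f sums exp (c / 2 * y)" unfolding f_def by (rule exp_converges)
      have "f k \<ge> 0" for k unfolding f_def using c y0 by simp
      then have "sum f {m} \<le> suminf f"
        by (intro sum_le_suminf sums_summable[OF sums]) auto
      then show ?thesis using sums_unique[OF sums] by (simp add: f_def field_simps)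
    qed
    then have "L * ((c / 2 * y) ^ m / fact m) \<le> L * exp (c / 2 * y)" using L by (intro mult_left_mono)
    moreover have "L * ((c / 2 * y) ^ m / fact m) = K * y ^ m"
      using c by (simp add: L_def power_mult_distrib power_divide)
    moreover have "L * exp (c / 2 * y) \<le> exp (c / 2 * y) * exp (c / 2 * y)"
    proof (intro mult_right_mono)
      have "L \<le> c / 2 * y" using y c by (simp add: field_simps)
      then show "L \<le> exp (c / 2 * y)" using exp_ge_add_one_self[of "c / 2 * y"] by linarith
    qed simp
    ultimately show ?thesis by (simp flip: exp_add)
  qed
  then show ?thesis using L c by (intro exI[of _ "2 * L / c"]) auto
qed

text \<open>With \<open>y\<close> the logarithm of the number of vertices, these are the conditions on the weights and on the
  energy for the two choices of parameters below.\<close>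

lemma large_log_bounds:
  "\<exists>y0\<ge>1. \<forall>y\<ge>y0::real.
     4 ^ 7 * (7 * sqrt y) ^ 9 * exp (56 * sqrt y) \<le> exp (y / 10) \<and>
     128 * exp 4 * (7 * sqrt y) ^ 4 * exp (84 * sqrt y) \<le> exp (8 / 5 * y) \<and>
     4 ^ 7 * (10 * y) ^ 9 * exp (y / 20) \<le> exp (y / 10) \<and>
     128 * exp 4 * (10 * y) ^ 4 * exp (3 / 40 * y) \<le> exp (2 * y)"
proof -
  obtain a where a: "a \<ge> 0" "\<And>z::real. z \<ge> a \<Longrightarrow> 4 ^ 7 * 7 ^ 9 * z ^ 9 \<le> exp (1 * z)"
    using power_le_exp[of 1 "4 ^ 7 * 7 ^ 9" 9] by auto
  obtain b where b: "b \<ge> 0" "\<And>z::real. z \<ge> b \<Longrightarrow> 128 * exp 4 * 7 ^ 4 * z ^ 4 \<le> exp (1 * z)"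
    using power_le_exp[of 1 "128 * exp 4 * 7 ^ 4" 4] by auto
  obtain c where c: "c \<ge> 0" "\<And>y::real. y \<ge> c \<Longrightarrow> 4 ^ 7 * 10 ^ 9 * y ^ 9 \<le> exp (1 / 20 * y)"
    using power_le_exp[of "1 / 20" "4 ^ 7 * 10 ^ 9" 9] by auto
  obtain d where d: "d \<ge> 0" "\<And>y::real. y \<ge> d \<Longrightarrow> 128 * exp 4 * 10 ^ 4 * y ^ 4 \<le> exp (1 * y)"
    using power_le_exp[of 1 "128 * exp 4 * 10 ^ 4" 4] by auto
  define z0 where "z0 = Max {1000, a, b, c, d}"
  have z0: "1000 \<le> z0" "a \<le> z0" "b \<le> z0" "c \<le> z0" "d \<le> z0" unfolding z0_def by (intro Max_ge; simp)+
  have z02: "z0 \<le> z0\<^sup>2" using z0(1) by (simp add: power2_eq_square)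
  show ?thesis
  proof (intro exI[of _ "z0\<^sup>2"] conjI allI impI)
    show "1 \<le> z0\<^sup>2" using z0(1) z02 by linarith
    fix y :: real assume y: "z0\<^sup>2 \<le> y"
    define z where "z = sqrt y"
    have z: "z \<ge> z0" unfolding z_def using y by (intro real_le_rsqrt)
    have yz: "y = z * z" using y z0(1) z02 by (simp add: z_def)
    have zz: "1000 * z \<le> z * z" using z z0(1) by (intro mult_right_mono) auto
    have yz0: "y \<ge> z0" using y z02 by linarith
    have "4 ^ 7 * (7 * z) ^ 9 * exp (56 * z) = 4 ^ 7 * 7 ^ 9 * z ^ 9 * exp (56 * z)"
      by (simp add: power_mult_distrib)
    also have "\<dots> \<le> exp (1 * z) * exp (56 * z)" using a(2)[of z] z z0 by (intro mult_right_mono) auto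
    also have "\<dots> = exp (57 * z)" by (simp flip: exp_add)
    also have "\<dots> \<le> exp (y / 10)" using zz z z0(1) by (simp add: yz)
    finally show "4 ^ 7 * (7 * sqrt y) ^ 9 * exp (56 * sqrt y) \<le> exp (y / 10)" by (simp add: z_def)
    have "128 * exp 4 * (7 * z) ^ 4 * exp (84 * z) = 128 * exp 4 * 7 ^ 4 * z ^ 4 * exp (84 * z)"
      by (simp add: power_mult_distrib)
    also have "\<dots> \<le> exp (1 * z) * exp (84 * z)" using b(2)[of z] z z0 by (intro mult_right_mono) auto
    also have "\<dots> = exp (85 * z)" by (simp flip: exp_add)
    also have "\<dots> \<le> exp (8 / 5 * y)" using zz z z0(1) by (simp add: yz)
    finally show "128 * exp 4 * (7 * sqrt y) ^ 4 * exp (84 * sqrt y) \<le> exp (8 / 5 * y)" by (simp add: z_def)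
    have "4 ^ 7 * (10 * y) ^ 9 * exp (y / 20) = 4 ^ 7 * 10 ^ 9 * y ^ 9 * exp (y / 20)"
      by (simp add: power_mult_distrib)
    also have "\<dots> \<le> exp (1 / 20 * y) * exp (y / 20)" using c(2)[of y] yz0 z0 by (intro mult_right_mono) auto
    also have "\<dots> = exp (y / 10)" by (simp flip: exp_add)
    finally show "4 ^ 7 * (10 * y) ^ 9 * exp (y / 20) \<le> exp (y / 10)" .
    have "128 * exp 4 * (10 * y) ^ 4 * exp (3 / 40 * y) = 128 * exp 4 * 10 ^ 4 * y ^ 4 * exp (3 / 40 * y)"
      by (simp add: power_mult_distrib)
    also have "\<dots> \<le> exp (1 * y) * exp (3 / 40 * y)" using d(2)[of y] yz0 z0 by (intro mult_right_mono) auto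
    also have "\<dots> = exp (43 / 40 * y)" by (simp flip: exp_add)
    also have "\<dots> \<le> exp (2 * y)" using yz0 z0(1) by simp
    finally show "128 * exp 4 * (10 * y) ^ 4 * exp (3 / 40 * y) \<le> exp (2 * y)" .
  qed
qed

text \<open>The sharp constant comes from walks of length \<open>l\<close> of order \<open>q * sqrt y\<close> with
  \<open>\<epsilon> = sqrt y / q\<close>: then \<open>(1 + \<epsilon>) ^ (2 * l)\<close> exceeds any fixed power of \<open>n\<close>, while in
  \<open>l ^ 9\<close> the factor \<open>q ^ 9\<close> is absorbed by \<open>\<delta>\<close> and the power of \<open>sqrt y\<close> by
  \<open>exp (y / 10)\<close>. The choice of \<open>\<theta>\<close> balances the two
  terms of the exponential moment of the row norms.\<close>

lemma sharp_bound_large: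
  assumes p: "edge_probs n p" and n: "n \<ge> 1" and row: "\<And>i. i < n \<Longrightarrow> (\<Sum>j<n. p i j) \<le> d"
    and p_le: "\<And>i j. i < n \<Longrightarrow> j < n \<Longrightarrow> p i j \<le> \<delta> * d"
    and y: "y = ln (real n)" "y \<ge> 1"
    and L1: "4 ^ 7 * (7 * sqrt y) ^ 9 * exp (56 * sqrt y) \<le> exp (y / 10)"
    and L2: "128 * exp 4 * (7 * sqrt y) ^ 4 * exp (84 * sqrt y) \<le> exp (8 / 5 * y)"
    and q: "q > 0" "y \<le> q\<^sup>2" "q\<^sup>2 \<le> d" and delta: "1 / n \<le> \<delta>" "\<delta> * q ^ 9 \<le> exp (- y / 10)"
  shows "expected_deviation n p \<le> sqrt d * (2 + 12 * (sqrt y / q))"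
proof -
  define z where "z = sqrt y"
  define \<epsilon> where "\<epsilon> = z / q"
  define \<theta> where "\<theta> = z / sqrt d"
  define l where "l = nat \<lceil>5 * q * z\<rceil>"
  have z: "z \<ge> 1" "z * z = y" using y(2) by (simp_all add: z_def)
  have zq: "z \<le> q" unfolding z_def using q by (intro real_le_lsqrt) auto
  have qd: "q \<le> sqrt d" using q(3) by (rule real_le_rsqrt)
  have q1: "q \<ge> 1" using z zq by linarith
  have d1: "d \<ge> 1" using q(3) one_le_power[OF q1, of 2] by linarith
  have sd: "sqrt d * sqrt d = d" "sqrt d \<ge> 1" using d1 by simp_all
  have qz: "1 \<le> q * z" using mult_mono[of 1 q 1 z] q1 z(1) by simp
  have l_lo: "5 * q * z \<le> real l" unfolding l_def by linarith
  have l_hi: "real l \<le> 7 * z * q" unfolding l_def using qz by (simp add: mult_ac) linarith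
  have l1: "l \<ge> 1" using l_lo qz by linarith
  have ny: "exp y = real n" using n y(1) by simp
  have d0: "\<delta> > 0" by (rule less_le_trans[OF _ delta(1)]) (use n in simp)
  have ld: "real l / sqrt d \<le> 7 * z"
  proof -
    have "real l \<le> 7 * z * sqrt d" using l_hi mult_left_mono[OF qd, of "7 * z"] z(1) by linarith
    then show ?thesis using sd by (simp add: field_simps)
  qed
  have exl: "exp (4 * real l / sqrt d) \<le> exp (28 * z)" using ld by simp
  have q10: "q \<le> exp (y / 10)"
  proof -
    have "1 / n * q ^ 9 \<le> exp (- y / 10)" using delta mult_right_mono[OF delta(1), of "q ^ 9"] q by simp
    then have "q ^ 9 \<le> exp y * exp (- y / 10)" using n ny by (simp add: field_simps)
    also have "\<dots> = exp (real 9 * (y / 10))" by (simp flip: exp_add)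
    also have "\<dots> = exp (y / 10) ^ 9" by (rule exp_of_nat_mult)
    finally show ?thesis by (rule power_le_imp_le_base[of q 8, simplified]) simp
  qed
  have eps: "0 \<le> \<epsilon>" "\<epsilon> \<le> 1" using zq q z by (simp_all add: \<epsilon>_def)
  have th: "0 < \<theta>" "\<theta> \<le> 1" using zq qd z sd by (simp_all add: \<theta>_def)
  have small: "4 ^ 7 * real l ^ 9 * exp (4 * real l / sqrt d) ^ 2 * \<delta> \<le> 1"
  proof -
    have "4 ^ 7 * real l ^ 9 * exp (4 * real l / sqrt d) ^ 2 * \<delta>
      \<le> 4 ^ 7 * (7 * z * q) ^ 9 * exp (28 * z) ^ 2 * \<delta>"
      using l_hi exl d0 z q by (intro mult_mono power_mono) auto
    also have "\<dots> = (4 ^ 7 * (7 * z) ^ 9 * exp (56 * z)) * (\<delta> * q ^ 9)"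
      by (simp add: power_mult_distrib exp_double[symmetric] flip: exp_of_nat_mult)
    also have "\<dots> \<le> exp (y / 10) * exp (- y / 10)"
      using L1 delta(2) d0 q by (intro mult_mono) (auto simp: z_def)
    also have "\<dots> = 1" by (simp flip: exp_add)
    finally show ?thesis .
  qed
  have tail: "128 * exp 4 * real n ^ 3 * real l ^ 4 * exp (4 * real l / sqrt d) ^ 3 \<le> (1 + \<epsilon>) ^ (2 * l)"
  proof -
    have "128 * exp 4 * real n ^ 3 * real l ^ 4 * exp (4 * real l / sqrt d) ^ 3
      \<le> 128 * exp 4 * real n ^ 3 * (7 * z * exp (y / 10)) ^ 4 * exp (28 * z) ^ 3"
    proof -
      have "real l \<le> 7 * z * exp (y / 10)"
        using l_hi mult_left_mono[OF q10, of "7 * z"] z(1) by linarith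
      then show ?thesis using exl z by (intro mult_mono power_mono) auto
    qed
    also have "\<dots> = (128 * exp 4 * (7 * z) ^ 4 * exp (84 * z)) * (exp (3 * y) * exp (4 / 10 * y))"
    proof -
      have "real n ^ 3 = exp (3 * y)" unfolding ny[symmetric] by (simp flip: exp_of_nat_mult)
      moreover have "exp (y / 10) ^ 4 = exp (4 / 10 * y)" by (simp flip: exp_of_nat_mult)
      moreover have "exp (28 * z) ^ 3 = exp (84 * z)" by (simp flip: exp_of_nat_mult)
      ultimately show ?thesis by (simp only: power_mult_distrib) (simp only: mult_ac)
    qed
    also have "\<dots> \<le> exp (8 / 5 * y) * (exp (3 * y) * exp (4 / 10 * y))"
      using L2 by (intro mult_right_mono) (auto simp: z_def)
    also have "\<dots> = exp (5 * y)" by (simp flip: exp_add)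
    also have "\<dots> \<le> exp (real l * \<epsilon>)"
    proof -
      have "5 * q * z * \<epsilon> \<le> real l * \<epsilon>" using l_lo eps by (intro mult_right_mono) auto
      moreover have "5 * q * z * \<epsilon> = 5 * y" using q z by (simp add: \<epsilon>_def)
      ultimately show ?thesis by simp
    qed
    also have "\<dots> = exp (\<epsilon> / 2) ^ (2 * l)" by (simp flip: exp_of_nat_mult)
    also have "\<dots> \<le> (1 + \<epsilon>) ^ (2 * l)"
    proof (intro power_mono)
      have "exp (\<epsilon> / 2) \<le> 1 + \<epsilon> / 2 + (\<epsilon> / 2)\<^sup>2" using eps by (intro exp_bound) auto
      also have "(\<epsilon> / 2)\<^sup>2 \<le> \<epsilon> / 2" using eps mult_left_mono[of \<epsilon> 1 \<epsilon>]
        by (simp add: power2_eq_square)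
      finally show "exp (\<epsilon> / 2) \<le> 1 + \<epsilon>" by simp
    qed simp
    finally show ?thesis .
  qed
  have "expected_deviation n p \<le> 2 * (1 + \<epsilon>) * sqrt (d + (ln n + d * (exp \<theta> - 1 - \<theta>) + 1) / \<theta>) + 4"
    by (rule expected_deviation_le[OF p n row _ d1 l1 _ p_le small th(1) eps(1) tail]) (use d0 in auto)
  also have "sqrt (d + (ln n + d * (exp \<theta> - 1 - \<theta>) + 1) / \<theta>) \<le> sqrt d + 3 / 2 * z"
  proof (intro real_le_lsqrt)
    have "exp \<theta> \<le> 1 + \<theta> + \<theta>\<^sup>2" using th by (intro exp_bound) auto
    then have "d * (exp \<theta> - 1 - \<theta>) \<le> d * \<theta>\<^sup>2" using d1 by (intro mult_left_mono) auto
    also have "\<dots> = y" using sd z d1 by (simp add: \<theta>_def power_divide power2_eq_square)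
    finally have "ln n + d * (exp \<theta> - 1 - \<theta>) + 1 \<le> 3 * y" using y by simp
    then have "(ln n + d * (exp \<theta> - 1 - \<theta>) + 1) / \<theta> \<le> 3 * y / \<theta>" using th by (intro divide_right_mono) auto
    also have "\<dots> = 3 * z * sqrt d" using z sd by (simp add: \<theta>_def flip: z(2))
    also have "d + 3 * z * sqrt d \<le> (sqrt d + 3 / 2 * z)\<^sup>2"
      using sd by (simp add: power2_eq_square algebra_simps)
    finally show "d + (ln n + d * (exp \<theta> - 1 - \<theta>) + 1) / \<theta> \<le> (sqrt d + 3 / 2 * z)\<^sup>2" by simp
    show "0 \<le> sqrt d + 3 / 2 * z" using z d1 by simp
  qed
  also have "2 * (1 + \<epsilon>) * (sqrt d + 3 / 2 * z) + 4 \<le> sqrt d * (2 + 12 * \<epsilon>)"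
  proof -
    have zd: "z \<le> \<epsilon> * sqrt d"
    proof -
      have "z = \<epsilon> * q" using q by (simp add: \<epsilon>_def)
      also have "\<dots> \<le> \<epsilon> * sqrt d" using qd eps by (intro mult_left_mono)
      finally show ?thesis .
    qed
    have "\<epsilon> * z \<le> 1 * z" using eps z by (intro mult_right_mono) auto
    moreover have "2 * (1 + \<epsilon>) * (sqrt d + 3 / 2 * z) + 4
        = 2 * sqrt d + 2 * (\<epsilon> * sqrt d) + 3 * z + 3 * (\<epsilon> * z) + 4"
      by (simp add: algebra_simps)
    ultimately have "2 * (1 + \<epsilon>) * (sqrt d + 3 / 2 * z) + 4
        \<le> 2 * sqrt d + 2 * (\<epsilon> * sqrt d) + 6 * z + 4 * z"
      using z(1) by linarith
    also have "\<dots> \<le> 2 * sqrt d + 2 * (\<epsilon> * sqrt d) + 10 * (\<epsilon> * sqrt d)" using zd by linarith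
    finally show ?thesis by (simp add: algebra_simps)
  qed
  finally show ?thesis using eps by (simp add: \<epsilon>_def z_def mult_left_mono)
qed

text \<open>Up to a constant it suffices to take walks of logarithmic length and \<open>\<epsilon> = 1\<close>. Enlarging \<open>D\<close> beyond
  the degree, to the order of the squared row norms, keeps \<open>l / sqrt D\<close> below a small multiple of \<open>y\<close>. The
  choice of \<open>\<theta>\<close> gives the tail of a Poisson maximum.\<close>

lemma crude_bound_large:
  assumes p: "edge_probs n p" and n: "n \<ge> 1" and row: "\<And>i. i < n \<Longrightarrow> (\<Sum>j<n. p i j) \<le> d"
    and p_le: "\<And>i j. i < n \<Longrightarrow> j < n \<Longrightarrow> p i j \<le> \<delta> * d"
    and y: "y = ln (real n)" "y \<ge> 1"
    and L3: "4 ^ 7 * (10 * y) ^ 9 * exp (y / 20) \<le> exp (y / 10)"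
    and L4: "128 * exp 4 * (10 * y) ^ 4 * exp (3 / 40 * y) \<le> exp (2 * y)"
    and d: "d \<ge> 1" and delta: "0 \<le> \<delta>" "\<delta> \<le> exp (- y / 10)"
  shows "expected_deviation n p \<le> 6408 * sqrt (max d (y / max 1 (ln (y / d))))"
proof -
  define m where "m = max d (y / max 1 (ln (y / d)))"
  \<comment> \<open>With l at most 10 * y this constant gives 4 * l / sqrt D at most y / 40.\<close>
  define D where "D = 1600\<^sup>2 * m"
  define \<theta> where "\<theta> = max 1 (ln (y / d))"
  define l where "l = nat \<lceil>5 * y\<rceil>"
  have m: "m \<ge> d" "m \<ge> 1" "y / \<theta> \<le> m" using d by (auto simp: m_def \<theta>_def)
  have D: "D \<ge> 1" "d \<le> D" using m by (auto simp: D_def)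
  have sD: "sqrt D = 1600 * sqrt m" by (simp add: D_def real_sqrt_mult)
  have sm: "sqrt m \<ge> 1" using m by simp
  have l_lo: "5 * y \<le> real l" unfolding l_def by linarith
  have l_hi: "real l \<le> 10 * y" unfolding l_def using y(2) by linarith
  have l1: "l \<ge> 1" using l_lo y(2) by linarith
  have ny: "exp y = real n" using n y(1) by simp
  have ld: "4 * real l / sqrt D \<le> y / 40"
  proof -
    have "4 * real l / sqrt D \<le> 4 * (10 * y) / 1600"
      using l_hi sD sm y(2) by (intro frac_le) auto
    then show ?thesis by simp
  qed
  have exl: "exp (4 * real l / sqrt D) \<le> exp (y / 40)" using ld by simp
  have th: "\<theta> \<ge> 1" by (simp add: \<theta>_def)
  have small: "4 ^ 7 * real l ^ 9 * exp (4 * real l / sqrt D) ^ 2 * \<delta> \<le> 1"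
  proof -
    have "4 ^ 7 * real l ^ 9 * exp (4 * real l / sqrt D) ^ 2 * \<delta>
      \<le> 4 ^ 7 * (10 * y) ^ 9 * exp (y / 40) ^ 2 * exp (- y / 10)"
      using l_hi exl delta y by (intro mult_mono power_mono) auto
    also have "\<dots> = (4 ^ 7 * (10 * y) ^ 9 * exp (y / 20)) * exp (- y / 10)"
      by (simp flip: exp_of_nat_mult)
    also have "\<dots> \<le> exp (y / 10) * exp (- y / 10)" using L3 by (intro mult_right_mono) auto
    also have "\<dots> = 1" by (simp flip: exp_add)
    finally show ?thesis .
  qed
  have tail: "128 * exp 4 * real n ^ 3 * real l ^ 4 * exp (4 * real l / sqrt D) ^ 3 \<le> (1 + 1) ^ (2 * l)"
  proof -
    have "128 * exp 4 * real n ^ 3 * real l ^ 4 * exp (4 * real l / sqrt D) ^ 3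
      \<le> 128 * exp 4 * real n ^ 3 * (10 * y) ^ 4 * exp (y / 40) ^ 3"
      using l_hi exl by (intro mult_mono power_mono) auto
    also have "\<dots> = (128 * exp 4 * (10 * y) ^ 4 * exp (3 / 40 * y)) * exp (3 * y)"
    proof -
      have "real n ^ 3 = exp (3 * y)" unfolding ny[symmetric] by (simp flip: exp_of_nat_mult)
      moreover have "exp (y / 40) ^ 3 = exp (3 / 40 * y)" by (simp flip: exp_of_nat_mult)
      ultimately show ?thesis by (simp only: mult_ac)
    qed
    also have "\<dots> \<le> exp (2 * y) * exp (3 * y)" using L4 by (intro mult_right_mono) auto
    also have "\<dots> = exp (5 * y)" by (simp flip: exp_add)
    also have "\<dots> \<le> exp (real l * 1)" using l_lo by simp
    also have "\<dots> = exp 1 ^ l" by (simp flip: exp_of_nat_mult)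
    also have "\<dots> \<le> 4 ^ l" using exp_le by (intro power_mono) auto
    also have "\<dots> = (1 + 1) ^ (2 * l)" by (simp add: power_mult)
    finally show ?thesis .
  qed
  have "expected_deviation n p \<le> 2 * (1 + 1) * sqrt (D + (ln n + d * (exp \<theta> - 1 - \<theta>) + 1) / \<theta>) + 4"
  proof (rule expected_deviation_le[OF p n row D(2,1) l1 delta(1) _ small _ _ tail])
    show "p i j \<le> \<delta> * D" if "i < n" "j < n" for i j
      using p_le[OF that] mult_left_mono[OF D(2) delta(1)] by linarith
  qed (use th in auto)
  also have "sqrt (D + (ln n + d * (exp \<theta> - 1 - \<theta>) + 1) / \<theta>) \<le> 1601 * sqrt m"
  proof (intro real_le_lsqrt)
    have "d * exp \<theta> \<le> 3 * d + y"
    proof (cases "1 \<le> ln (y / d)")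
      case True
      then have "\<theta> = ln (y / d)" by (simp add: \<theta>_def)
      then show ?thesis using y(2) d by simp
    next
      case False
      then have "\<theta> = 1" by (simp add: \<theta>_def)
      moreover have "d * exp 1 \<le> d * 3" using exp_le d by (intro mult_left_mono) auto
      ultimately show ?thesis using y(2) by simp
    qed
    moreover have "d * (exp \<theta> - 1 - \<theta>) \<le> d * exp \<theta>" using d th by (intro mult_left_mono) auto
    ultimately have "ln n + d * (exp \<theta> - 1 - \<theta>) + 1 \<le> 3 * y + 3 * d" using y by linarith
    then have "(ln n + d * (exp \<theta> - 1 - \<theta>) + 1) / \<theta> \<le> (3 * y + 3 * d) / \<theta>"
      using th by (intro divide_right_mono) auto
    also have "\<dots> = 3 * (y / \<theta>) + 3 * d / \<theta>" by (simp add: add_divide_distrib)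
    also have "3 * d / \<theta> \<le> 3 * d / 1" using th d by (intro divide_left_mono) auto
    finally have "(ln n + d * (exp \<theta> - 1 - \<theta>) + 1) / \<theta> \<le> 6 * m" using m by linarith
    moreover have "(1601 * sqrt m)\<^sup>2 = 1601\<^sup>2 * m" using m by (simp add: power_mult_distrib)
    ultimately show "D + (ln n + d * (exp \<theta> - 1 - \<theta>) + 1) / \<theta> \<le> (1601 * sqrt m)\<^sup>2"
      using m by (simp add: D_def)
    show "0 \<le> 1601 * sqrt m" using m by simp
  qed
  also have "2 * (1 + 1) * (1601 * sqrt m) + 4 = 6404 * sqrt m + 4" by simp
  also have "\<dots> \<le> 6408 * sqrt m" using sm by linarith
  finally show ?thesis unfolding m_def by simp
qed

lemma div_max_ln_mono:
  fixes x X :: real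
  assumes "0 < x" "x \<le> X"
  shows "x / max 1 (ln x) \<le> X / max 1 (ln X)"
proof -
  have "x * max 1 (ln X) \<le> X * max 1 (ln x)"
  proof (cases "ln X \<le> 1")
    case True
    have "x * 1 \<le> X * max 1 (ln x)" using assms by (intro mult_mono) auto
    then show ?thesis using True by simp
  next
    case False
    show ?thesis
    proof (cases "ln x \<le> 1")
      case True
      have "X > 0" using assms by simp
      have "ln (X / exp 1) \<le> X / exp 1 - 1" using \<open>X > 0\<close> by (intro ln_le_minus_one) auto
      then have "ln X \<le> X / exp 1" using \<open>X > 0\<close> by (simp add: ln_div)
      then have "x * ln X \<le> x * (X / exp 1)" using assms by (intro mult_left_mono) auto
      also have "\<dots> = x / exp 1 * X" by simp
      also have "\<dots> \<le> 1 * X"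
      proof (intro mult_right_mono)
        have "x \<le> exp 1" using True assms by (metis exp_le_cancel_iff exp_ln)
        then show "x / exp 1 \<le> 1" by simp
      qed (use assms in auto)
      finally show ?thesis using True False by simp
    next
      case F2: False
      have "ln (X / x) \<le> X / x - 1" using assms by (intro ln_le_minus_one) auto
      then have "ln X \<le> ln x + (X / x - 1)" using assms by (simp add: ln_div)
      then have "x * ln X \<le> x * (ln x + (X / x - 1))" using assms by (intro mult_left_mono) auto
      also have "\<dots> = x * ln x + (X - x)" using assms by (simp add: algebra_simps)
      also have "\<dots> \<le> X * ln x"
      proof -
        have "0 \<le> (X - x) * (ln x - 1)" using assms F2 by (intro mult_nonneg_nonneg) auto
        then show ?thesis by (simp add: algebra_simps)
      qed
      finally show ?thesis using F2 False by simp
    qed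
  qed
  then show ?thesis by (simp add: field_simps)
qed

text \<open>For small \<open>n\<close> the trivial bound by \<open>n\<close> is absorbed into the constant.\<close>

lemma sharp_bound:
  "\<exists>C\<ge>0. \<forall>n p d \<delta> q. edge_probs n p \<longrightarrow> n \<ge> 2 \<longrightarrow> (\<forall>i<n. (\<Sum>j<n. p i j) \<le> d) \<longrightarrow>
     (\<forall>i<n. \<forall>j<n. p i j \<le> \<delta> * d) \<longrightarrow> q > 0 \<longrightarrow> ln (real n) \<le> q\<^sup>2 \<longrightarrow> q\<^sup>2 \<le> d \<longrightarrow>
     1 / n \<le> \<delta> \<longrightarrow> \<delta> * q ^ 9 \<le> real n powr (-(1/10)) \<longrightarrow>
     expected_deviation n p \<le> sqrt d * (2 + C * (sqrt (ln (real n)) / q))"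
proof -
  obtain y0 where y0: "y0 \<ge> 1" "\<And>y::real. y \<ge> y0 \<Longrightarrow>
     4 ^ 7 * (7 * sqrt y) ^ 9 * exp (56 * sqrt y) \<le> exp (y / 10) \<and>
     128 * exp 4 * (7 * sqrt y) ^ 4 * exp (84 * sqrt y) \<le> exp (8 / 5 * y)"
    using large_log_bounds by blast
  define C where "C = 12 + 2 * exp y0"
  show ?thesis
  proof (intro exI[of _ C] conjI allI impI)
    show "C \<ge> 0" by (simp add: C_def)
    fix n p d \<delta> q
    assume p: "edge_probs n p" and n: "n \<ge> 2" and row: "\<forall>i<n. (\<Sum>j<n. p i j) \<le> d"
      and p_le: "\<forall>i<n. \<forall>j<n. p i j \<le> \<delta> * d" and q: "q > 0" "ln (real n) \<le> q\<^sup>2" "q\<^sup>2 \<le> d"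
      and delta: "1 / real n \<le> \<delta>" "\<delta> * q ^ 9 \<le> real n powr (-(1/10))"
    define y where "y = ln (real n)"
    have pw: "real n powr (-(1/10)) = exp (- y / 10)" using n by (simp add: powr_def y_def)
    have qd: "q \<le> sqrt d" using q(3) by (rule real_le_rsqrt)
    have d0: "d \<ge> 0" using q(3) zero_le_power2[of q] by linarith
    show "expected_deviation n p \<le> sqrt d * (2 + C * (sqrt (ln (real n)) / q))"
    proof (cases "y \<ge> y0")
      case True
      have "expected_deviation n p \<le> sqrt d * (2 + 12 * (sqrt y / q))"
        by (rule sharp_bound_large[of n p d \<delta> y q])
           (use p n row p_le y_def y0 True q delta pw in auto)
      also have "\<dots> \<le> sqrt d * (2 + C * (sqrt y / q))"
        using q d0 y0 True by (intro mult_left_mono add_left_mono mult_right_mono) (auto simp: C_def)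
      finally show ?thesis by (simp add: y_def)
    next
      case False
      have "expected_deviation n p \<le> n" by (rule expected_deviation_le_dim[OF p])
      also have "real n = exp y" using n by (simp add: y_def)
      also have "\<dots> \<le> exp y0" using False by simp
      also have "\<dots> \<le> C * (1 / 2)" by (simp add: C_def)
      also have "\<dots> \<le> C * sqrt y"
      proof (intro mult_left_mono)
        have "ln 2 \<le> y" using n by (simp add: y_def)
        then have "1 / 4 \<le> y" using ln2_ge_two_thirds by linarith
        then show "1 / 2 \<le> sqrt y" by (intro real_le_rsqrt) (simp add: power2_eq_square)
      qed (simp add: C_def)
      also have "\<dots> = q * (C * (sqrt y / q))" using q by simp
      also have "\<dots> \<le> sqrt d * (2 + C * (sqrt y / q))"
        using q qd d0 n by (intro mult_mono) (auto simp: C_def y_def)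
      finally show ?thesis by (simp add: y_def)
    qed
  qed
qed

lemma crude_bound:
  "\<exists>C\<ge>0. \<forall>n p d \<delta>. edge_probs n p \<longrightarrow> n \<ge> 2 \<longrightarrow> (\<forall>i<n. (\<Sum>j<n. p i j) \<le> d) \<longrightarrow>
     (\<forall>i<n. \<forall>j<n. p i j \<le> \<delta> * d) \<longrightarrow> d \<ge> 1 \<longrightarrow> 0 \<le> \<delta> \<longrightarrow> \<delta> \<le> real n powr (-(1/10)) \<longrightarrow>
     expected_deviation n p \<le> C * sqrt (max d (ln (real n) / max 1 (ln (ln (real n) / d))))"
proof -
  obtain y0 where y0: "y0 \<ge> 1" "\<And>y::real. y \<ge> y0 \<Longrightarrow>
     4 ^ 7 * (10 * y) ^ 9 * exp (y / 20) \<le> exp (y / 10) \<and>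
     128 * exp 4 * (10 * y) ^ 4 * exp (3 / 40 * y) \<le> exp (2 * y)"
    using large_log_bounds by blast
  define C where "C = 6408 + exp y0"
  show ?thesis
  proof (intro exI[of _ C] conjI allI impI)
    show "C \<ge> 0" by (simp add: C_def)
    fix n p d \<delta>
    assume p: "edge_probs n p" and n: "n \<ge> 2" and row: "\<forall>i<n. (\<Sum>j<n. p i j) \<le> d"
      and p_le: "\<forall>i<n. \<forall>j<n. p i j \<le> \<delta> * d" and d: "d \<ge> 1"
      and delta: "0 \<le> \<delta>" "\<delta> \<le> real n powr (-(1/10))"
    define y where "y = ln (real n)"
    define m where "m = max d (y / max 1 (ln (y / d)))"
    have m: "sqrt m \<ge> 1" using d by (simp add: m_def)
    have pw: "real n powr (-(1/10)) = exp (- y / 10)" using n by (simp add: powr_def y_def)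
    have "expected_deviation n p \<le> C * sqrt m"
    proof (cases "y \<ge> y0")
      case True
      have "expected_deviation n p \<le> 6408 * sqrt m" unfolding m_def
        by (rule crude_bound_large[of n p d \<delta> y])
           (use p n row p_le y_def y0 True d delta pw in auto)
      also have "\<dots> \<le> C * sqrt m" using m by (intro mult_right_mono) (auto simp: C_def)
      finally show ?thesis .
    next
      case False
      have "expected_deviation n p \<le> n" by (rule expected_deviation_le_dim[OF p])
      also have "real n = exp y" using n by (simp add: y_def)
      also have "\<dots> \<le> C * 1" using False by (simp add: C_def add_increasing)
      also have "\<dots> \<le> C * sqrt m" using m by (intro mult_left_mono) (auto simp: C_def)
      finally show ?thesis .
    qed
    then show "expected_deviation n p \<le> C * sqrt (max d (ln (real n) / max 1 (ln (ln (real n) / d))))"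
      by (simp add: m_def y_def)
  qed
qed

section \<open>The two bounds for the expected norm\<close>

lemma max_degree_max_prob:
  assumes p: "edge_probs n p" and n: "n \<ge> 1" and d: "max_degree n p > 0"
  shows "n \<ge> 2" and "\<And>i. i < n \<Longrightarrow> (\<Sum>j<n. p i j) \<le> max_degree n p"
    and "\<And>i j. i < n \<Longrightarrow> j < n \<Longrightarrow> p i j \<le> max_prob n p"
    and "max_degree n p \<le> n * max_prob n p"
proof -
  show row: "(\<Sum>j<n. p i j) \<le> max_degree n p" if "i < n" for i
    unfolding max_degree_def using that by (intro Max_ge) auto
  show pm: "p i j \<le> max_prob n p" if "i < n" "j < n" for i j
    unfolding max_prob_def using that by (intro Max_ge) (auto intro: rev_image_eqI)
  have "max_degree n p \<in> (\<lambda>i. \<Sum>j<n. p i j) ` {..<n}"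
    unfolding max_degree_def using n by (intro Max_in) (auto simp: lessThan_empty_iff)
  then obtain i where i: "i < n" "max_degree n p = (\<Sum>j<n. p i j)" by auto
  show "max_degree n p \<le> n * max_prob n p"
    unfolding i(2) using sum_bounded_above[of "{..<n}" "p i" "max_prob n p"] pm i(1) by simp
  show "n \<ge> 2"
  proof (rule ccontr)
    assume "\<not> n \<ge> 2"
    then have "n = 1" using n by simp
    then show False using i d edge_probsD(4)[OF p, of 0 0] by simp
  qed
qed

text \<open>The relative maximal probability is \<open>\<delta> = \<kappa> / n\<close>, and the definition of \<open>q\<close> gives
  \<open>\<delta> * q ^ 9 \<le> n powr (- 1 / 10)\<close>; in the second part \<open>q = sqrt d\<close> satisfies the same inequality. The
  sharp bound applies when \<open>ln n\<close> is at most \<open>q\<^sup>2\<close>. Otherwise the error term is at least of the order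
  of \<open>sqrt d\<close>, and the bound up to a constant suffices.\<close>

theorem theorem3p2:
  shows "\<exists>C::real. C > 0 \<and>
    (\<forall>(n::nat) (p :: nat \<Rightarrow> nat \<Rightarrow> real).
       n \<ge> 1 \<longrightarrow> edge_probs n p \<longrightarrow> max_degree n p > 0 \<longrightarrow>
       (let d = max_degree n p;
            \<kappa> = max_prob n p / (d / real n);
            q = min (sqrt d) (real n powr (1/10) * \<kappa> powr (-(1/9)));
            \<eta> = sqrt (ln (real n)) / q
        in (q \<ge> 1 \<longrightarrow>
              expected_deviation n p / sqrt d \<le> 2 + C * (\<eta> / sqrt (max 1 (ln \<eta>)))) \<and>
           (d \<ge> 1 \<and> d powr (7/2) * max_prob n p \<le> real n powr (-(1/10)) \<longrightarrow>
              expected_deviation n p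
                \<le> 2 * sqrt d + C * sqrt (ln (real n) / max 1 (ln (ln (real n) / d))))))"
proof -
  obtain C1 where C1: "C1 \<ge> 0" "\<And>n p d \<delta> q. edge_probs n p \<Longrightarrow> n \<ge> 2 \<Longrightarrow> (\<forall>i<n. (\<Sum>j<n. p i j) \<le> d) \<Longrightarrow>
     (\<forall>i<n. \<forall>j<n. p i j \<le> \<delta> * d) \<Longrightarrow> q > 0 \<Longrightarrow> ln (real n) \<le> q\<^sup>2 \<Longrightarrow> q\<^sup>2 \<le> d \<Longrightarrow>
     1 / n \<le> \<delta> \<Longrightarrow> \<delta> * q ^ 9 \<le> real n powr (-(1/10)) \<Longrightarrow>
     expected_deviation n p \<le> sqrt d * (2 + C1 * (sqrt (ln (real n)) / q))"
    using sharp_bound by blast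
  obtain C2 where C2: "C2 \<ge> 0" "\<And>n p d \<delta>. edge_probs n p \<Longrightarrow> n \<ge> 2 \<Longrightarrow> (\<forall>i<n. (\<Sum>j<n. p i j) \<le> d) \<Longrightarrow>
     (\<forall>i<n. \<forall>j<n. p i j \<le> \<delta> * d) \<Longrightarrow> d \<ge> 1 \<Longrightarrow> 0 \<le> \<delta> \<Longrightarrow> \<delta> \<le> real n powr (-(1/10)) \<Longrightarrow>
     expected_deviation n p \<le> C2 * sqrt (max d (ln (real n) / max 1 (ln (ln (real n) / d))))"
    using crude_bound by blast
  define C where "C = C1 + C2 + 1"
  have C: "C > 0" "C \<ge> C1" "C \<ge> C2" using C1(1) C2(1) by (auto simp: C_def)
  show ?thesis
  proof (intro exI[of _ C] conjI allI impI C(1))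
    fix n :: nat and p :: "nat \<Rightarrow> nat \<Rightarrow> real"
    assume n1: "n \<ge> 1" and p: "edge_probs n p" and d0: "max_degree n p > 0"
    define d where "d = max_degree n p"
    define pm where "pm = max_prob n p"
    define \<kappa> where "\<kappa> = pm / (d / real n)"
    define q where "q = min (sqrt d) (real n powr (1/10) * \<kappa> powr (-(1/9)))"
    define \<eta> where "\<eta> = sqrt (ln (real n)) / q"
    define y where "y = ln (real n)"
    define \<delta> where "\<delta> = pm / d"
    note mm = max_degree_max_prob[OF p n1 d0]
    have n: "n \<ge> 2" by (rule mm(1))
    have d: "d > 0" using d0 by (simp add: d_def)
    have y: "y > 0" using n by (simp add: y_def)
    have row: "\<forall>i<n. (\<Sum>j<n. p i j) \<le> d" using mm(2) by (simp add: d_def)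
    have p_le: "\<forall>i<n. \<forall>j<n. p i j \<le> \<delta> * d" using mm(3) d by (simp add: \<delta>_def pm_def)
    have dpm: "d \<le> n * pm" using mm(4) by (simp add: d_def pm_def)
    have delta: "1 / n \<le> \<delta>" using dpm d n by (simp add: \<delta>_def field_simps)
    have pm0: "pm > 0" using dpm d n by (metis less_le_trans not_less of_nat_0_le_iff mult_nonneg_nonpos)
    have kd: "\<kappa> = n * \<delta>" using d n by (simp add: \<kappa>_def \<delta>_def)
    have k1: "\<kappa> \<ge> 1" using dpm d n by (simp add: \<kappa>_def field_simps)
    have dl0: "\<delta> > 0" using pm0 d by (simp add: \<delta>_def)
    have crude: "expected_deviation n p \<le> C2 * sqrt (max d (y / max 1 (ln (y / d))))"
      if "d \<ge> 1" "\<delta> \<le> real n powr (-(1/10))"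
      unfolding y_def by (rule C2(2)[OF p n row p_le]) (use that dl0 in auto)
    have first: "expected_deviation n p / sqrt d \<le> 2 + C * (\<eta> / sqrt (max 1 (ln \<eta>)))" if q1: "q \<ge> 1"
    proof -
      have qd: "q \<le> sqrt d" by (simp add: q_def)
      have "1 \<le> sqrt d" using q1 qd by linarith
      then have d1: "d \<ge> 1" by simp
      have q2: "q\<^sup>2 \<le> d" using power_mono[OF qd, of 2] q1 d by simp
      have "q ^ 9 \<le> (real n powr (1/10) * \<kappa> powr (-(1/9))) ^ 9"
        using q1 by (intro power_mono) (auto simp: q_def)
      also have "\<dots> = real n powr (9/10) * \<kappa> powr (-1)"
        using n k1 by (simp add: power_mult_distrib powr_power)
      also have "\<kappa> powr (-1) = 1 / \<kappa>" using k1 by (intro powr_neg_one) simp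
      finally have "\<kappa> * q ^ 9 \<le> real n powr (9/10)" using k1 by (simp add: field_simps)
      then have "real n * (\<delta> * q ^ 9) \<le> real n powr (9/10)" by (simp add: kd mult_ac)
      also have "real n powr (9/10) = real n * real n powr (-(1/10))"
        using n powr_add[of "real n" 1 "-(1/10)"] by simp
      finally have dq: "\<delta> * q ^ 9 \<le> real n powr (-(1/10))" using n by simp
      have eta0: "\<eta> > 0" using y q1 by (simp add: \<eta>_def y_def)
      show ?thesis
      proof (cases "\<eta> \<le> 1")
        case True
        have "sqrt y \<le> q" using True q1 by (simp add: \<eta>_def y_def field_simps)
        then have "(sqrt y)\<^sup>2 \<le> q\<^sup>2" using y by (intro power_mono) auto
        then have yq: "y \<le> q\<^sup>2" using y by simp
        have "expected_deviation n p \<le> sqrt d * (2 + C1 * \<eta>)"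
          unfolding \<eta>_def using C1(2)[OF p n row p_le _ _ q2 delta dq] q1 yq by (simp add: y_def)
        then have "expected_deviation n p / sqrt d \<le> 2 + C1 * \<eta>" using d by (simp add: field_simps)
        also have "\<dots> \<le> 2 + C * \<eta>" using C eta0 by (intro add_left_mono mult_right_mono) auto
        also have "\<eta> = \<eta> / sqrt (max 1 (ln \<eta>))"
        proof -
          have "ln \<eta> \<le> 0" using True eta0 by simp
          then show ?thesis by simp
        qed
        finally show ?thesis .
      next
        case False
        \<comment> \<open>Both terms of the maximum in the crude bound are at most d times this quantity.\<close>
        define g where "g = \<eta>\<^sup>2 / max 1 (ln \<eta>)"
        have l1: "ln \<eta> > 0" using False by simp
        have l2: "ln (\<eta>\<^sup>2) = 2 * ln \<eta>" using eta0 by (simp add: ln_realpow)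
        have "1 \<le> q ^ 9" using q1 by (rule one_le_power)
        then have "\<delta> * 1 \<le> \<delta> * q ^ 9" using dl0 by (intro mult_left_mono) auto
        then have "\<delta> \<le> real n powr (-(1/10))" using dq by linarith
        then have W: "expected_deviation n p \<le> C2 * sqrt (max d (y / max 1 (ln (y / d))))"
          using crude d1 by blast
        have "y / d \<le> \<eta>\<^sup>2"
        proof -
          have "y / d \<le> y / q\<^sup>2" using q2 q1 y d by (intro divide_left_mono mult_pos_pos) auto
          then show ?thesis using y by (simp add: \<eta>_def y_def power_divide)
        qed
        then have "(y / d) / max 1 (ln (y / d)) \<le> \<eta>\<^sup>2 / max 1 (ln (\<eta>\<^sup>2))"
          using y d by (intro div_max_ln_mono) auto
        also have "\<dots> \<le> g"
          unfolding g_def l2 using l1 by (intro divide_left_mono) auto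
        finally have g2: "(y / d) / max 1 (ln (y / d)) \<le> g" .
        have g1: "1 \<le> g"
        proof -
          have "ln \<eta> \<le> \<eta> - 1" using eta0 by (rule ln_le_minus_one)
          moreover have "1 * \<eta> \<le> \<eta> * \<eta>" using False eta0 by (intro mult_right_mono) auto
          ultimately have "1 \<le> \<eta> * \<eta>" "ln \<eta> \<le> \<eta> * \<eta>" using False by linarith+
          then have "max 1 (ln \<eta>) \<le> \<eta>\<^sup>2" by (simp only: max.bounded_iff power2_eq_square)
          then show ?thesis by (simp add: g_def le_divide_eq)
        qed
        have "max d (y / max 1 (ln (y / d))) \<le> d * g"
        proof (rule max.boundedI)
          show "d \<le> d * g" using g1 d by simp
          have "y / max 1 (ln (y / d)) = d * ((y / d) / max 1 (ln (y / d)))" using d by simp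
          also have "\<dots> \<le> d * g" using g2 d by (intro mult_left_mono) auto
          finally show "y / max 1 (ln (y / d)) \<le> d * g" .
        qed
        then have "sqrt (max d (y / max 1 (ln (y / d)))) \<le> sqrt d * sqrt g"
          by (simp add: real_sqrt_mult[symmetric])
        then have "C2 * sqrt (max d (y / max 1 (ln (y / d)))) \<le> C2 * (sqrt d * sqrt g)"
          using C2(1) by (intro mult_left_mono)
        then have "expected_deviation n p / sqrt d \<le> C2 * sqrt g"
          using W d by (simp add: field_simps)
        also have "\<dots> \<le> C * sqrt g" using C g1 by (intro mult_right_mono) auto
        also have "sqrt g = \<eta> / sqrt (max 1 (ln \<eta>))"
          using eta0 by (simp add: g_def real_sqrt_divide)
        finally show ?thesis by linarith
      qed
    qed
    have second: "expected_deviation n p \<le> 2 * sqrt d + C * sqrt (y / max 1 (ln (y / d)))"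
      if d1: "d \<ge> 1" and dp: "d powr (7/2) * pm \<le> real n powr (-(1/10))"
    proof (cases "y \<le> d")
      case True
      have s9: "sqrt d ^ 9 = d * d powr (7/2)"
      proof -
        have "sqrt d ^ 9 = d powr (9/2)" using d by (simp add: powr_half_sqrt[symmetric] powr_power)
        also have "\<dots> = d * d powr (7/2)" using d powr_add[of d 1 "7/2"] by simp
        finally show ?thesis .
      qed
      have dq: "\<delta> * sqrt d ^ 9 \<le> real n powr (-(1/10))"
        unfolding s9 using dp d by (simp add: \<delta>_def mult.commute)
      have "expected_deviation n p \<le> sqrt d * (2 + C1 * (sqrt y / sqrt d))"
        unfolding y_def by (rule C1(2)[OF p n row p_le _ _ _ delta dq]) (use d True y_def in auto)
      also have "\<dots> = 2 * sqrt d + C1 * sqrt y" using d by (simp add: field_simps)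
      also have "\<dots> \<le> 2 * sqrt d + C * sqrt y" using C y by (intro add_left_mono mult_right_mono) auto
      also have "y = y / max 1 (ln (y / d))"
      proof -
        have "ln (y / d) \<le> 0" using True y d by simp
        then show ?thesis by simp
      qed
      finally show ?thesis .
    next
      case False
      define L where "L = y / max 1 (ln (y / d))"
      have mp: "max 1 (ln (y / d)) > 0" by (rule less_le_trans[of _ 1]) auto
      have L0: "L \<ge> 0" unfolding L_def using mp y by (intro divide_nonneg_pos) auto
      have "1 powr (7/2) \<le> d powr (7/2)" using d1 by (intro powr_mono2) auto
      then have "1 * pm \<le> d powr (7/2) * pm" using pm0 by (intro mult_right_mono) auto
      moreover have "\<delta> \<le> pm" using d1 pm0 by (simp add: \<delta>_def divide_le_eq)
      ultimately have "\<delta> \<le> real n powr (-(1/10))" using dp by linarith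
      then have "expected_deviation n p \<le> C2 * sqrt (max d L)" unfolding L_def using crude d1 by blast
      also have "max d L = L"
      proof -
        have "ln (y / d) \<le> y / d - 1" using y d by (intro ln_le_minus_one) auto
        then have "max 1 (ln (y / d)) \<le> y / d" using False d by simp
        then have "d * max 1 (ln (y / d)) \<le> d * (y / d)" using d by (intro mult_left_mono) auto
        then have "d * max 1 (ln (y / d)) \<le> y" using d by simp
        then have "d \<le> L" unfolding L_def using mp by (simp only: pos_le_divide_eq)
        then show ?thesis by simp
      qed
      also have "C2 * sqrt L \<le> C * sqrt L" using C L0 by (intro mult_right_mono) auto
      also have "\<dots> \<le> 2 * sqrt d + C * sqrt L" using d by simp
      finally show ?thesis by (simp add: L_def)
    qed
    show "let d = max_degree n p; \<kappa> = max_prob n p / (d / real n);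
            q = min (sqrt d) (real n powr (1/10) * \<kappa> powr (-(1/9)));
            \<eta> = sqrt (ln (real n)) / q
        in (q \<ge> 1 \<longrightarrow>
              expected_deviation n p / sqrt d \<le> 2 + C * (\<eta> / sqrt (max 1 (ln \<eta>)))) \<and>
           (d \<ge> 1 \<and> d powr (7/2) * max_prob n p \<le> real n powr (-(1/10)) \<longrightarrow>
              expected_deviation n p
                \<le> 2 * sqrt d + C * sqrt (ln (real n) / max 1 (ln (ln (real n) / d))))"
      unfolding Let_def
      using first second unfolding \<eta>_def q_def \<kappa>_def d_def pm_def y_def by blast
  qed
qed

end
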